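(* Let $A_0\subseteq\{2,\ldots,n\}$, let $A_1,\ldots,A_t\subseteq\{2,\ldots,n\}$ be distinct sets satisfying $A_0\subseteq A_i\subseteq\{2,\ldots,n\}$ and $|A_i\setminus A_0|=1$ for $i=1,\ldots,t$, and let $c_0,c_1,\ldots,c_t\ge 0$ be non-negative real numbers. Then the following inequality of operators holds in $\mathbb{R}[\mathrm{Sym}_n]$: $$\Big(\sum_{i=0}^{t}c_i|A_i|\Big)\Big(\sum_{j=0}^{t}c_j\big(\alpha_{A_j\cup\{1\}}-\alpha_{A_j}\big)\Big)\ \ge\ \sum_{i=0}^{t}c_i^{2}\,\alpha_{A_i}+\sum_{0\le i<j\le t}c_ic_j\big(\alpha_{A_i\cup A_j}+\alpha_{A_0}\big).$$
   Context: $\mathrm{Sym}_n$ is the symmetric group on $[n]=\{1,\ldots,n\}$. For $\emptyset\ne A\subseteq[n]$, $$\alpha_A=\frac{1}{(|A|-1)!}\sum_{\pi\in\mathrm{Sym}(A)}(\mathrm{id}-\pi)\in\mathbb{R}[\mathrm{Sym}_n],$$ where $\mathrm{Sym}(A)\subseteq\mathrm{Sym}_n$ is the subgroup of permutations fixing every element outside $A$; and $\alpha_\emptyset=0$. For $\Sigma_1,\Sigma_2\in\mathbb{R}[\mathrm{Sym}_n]$, the inequality of operators $\Sigma_1\ge\Sigma_2$ means that $\Sigma_1-\Sigma_2$ acts as a positive semi-definite (self-adjoint with non-negative eigenvalues) operator in every finite-dimensional representation of $\mathrm{Sym}_n$ (with respect to a $\mathrm{Sym}_n$-invariant inner product); equivalently,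 it acts as a positive semi-definite operator by left multiplication on the regular representation $\mathbb{R}[\mathrm{Sym}_n]$, equipped with the inner product for which the group elements are orthonormal. *)

theory Defs
  imports
    "HOL-Analysis.Analysis"
    "HOL-Algebra.Sym_Groups"
    "Jordan_Normal_Form.Char_Poly"
begin

text \<open>
  An element of the group algebra \<open>\<real>[Sym\<^sub>n]\<close> is given by its coefficient function
  \<open>x :: (nat \<Rightarrow> nat) \<Rightarrow> real\<close>, standing for the formal sum of \<open>x \<pi> \<cdot> \<pi>\<close> over
  \<open>\<pi> \<in> carrier (sym_group n)\<close>, i.e. over the \<open>\<pi>\<close> with \<open>\<pi> permutes {1..n}\<close>;
  its linear structure is pointwise.
\<close>

definition group_elem :: "(nat \<Rightarrow> nat) \<Rightarrow> (nat \<Rightarrow> nat) \<Rightarrow> real" where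
  "group_elem \<pi> = (\<lambda>\<sigma>. if \<sigma> = \<pi> then 1 else 0)"

definition alpha :: "nat set \<Rightarrow> (nat \<Rightarrow> nat) \<Rightarrow> real" where
  "alpha A = (\<lambda>\<sigma>. if A = {} then 0
     else 1 / fact (card A - 1) * (\<Sum>\<pi> | \<pi> permutes A. group_elem id \<sigma> - group_elem \<pi> \<sigma>))"

definition inner_product_on :: "nat \<Rightarrow> (complex vec \<Rightarrow> complex vec \<Rightarrow> complex) \<Rightarrow> bool" where
  "inner_product_on d ip \<longleftrightarrow>
     (\<forall>u\<in>carrier_vec d. \<forall>v\<in>carrier_vec d. \<forall>w\<in>carrier_vec d. ip (u + v) w = ip u w + ip v w) \<and>
     (\<forall>a. \<forall>u\<in>carrier_vec d. \<forall>v\<in>carrier_vec d. ip (a \<cdot>\<^sub>v u) v = a * ip u v) \<and>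
     (\<forall>u\<in>carrier_vec d. \<forall>v\<in>carrier_vec d. ip u v = cnj (ip v u)) \<and>
     (\<forall>u\<in>carrier_vec d. u \<noteq> 0\<^sub>v d \<longrightarrow> ip u u \<in> \<real> \<and> Re (ip u u) > 0)"

text \<open>
  Group homomorphisms into \<open>GL\<^sub>d(\<complex>)\<close>. Real representations are included: extend scalars,
  which keeps the matrices and the Gram matrix of the inner product.
\<close>

definition representation :: "nat \<Rightarrow> nat \<Rightarrow> ((nat \<Rightarrow> nat) \<Rightarrow> complex mat) \<Rightarrow> bool" where
  "representation n d \<rho> \<longleftrightarrow> \<rho> \<in> hom (sym_group n) (units_of (ring_mat TYPE(complex) d ()))"

definition invariant_inner_product ::
  "nat \<Rightarrow> nat \<Rightarrow> ((nat \<Rightarrow> nat) \<Rightarrow> complex mat) \<Rightarrow> (complex vec \<Rightarrow> complex vec \<Rightarrow> complex) \<Rightarrow> bool" where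
  "invariant_inner_product n d \<rho> ip \<longleftrightarrow> inner_product_on d ip \<and>
     (\<forall>\<pi>\<in>carrier (sym_group n). \<forall>u\<in>carrier_vec d. \<forall>v\<in>carrier_vec d.
        ip (\<rho> \<pi> *\<^sub>v u) (\<rho> \<pi> *\<^sub>v v) = ip u v)"

text \<open>The matrix \<open>\<Sum>\<^sub>\<pi> x \<pi> \<cdot> \<rho> \<pi>\<close>, written entrywise because matrices of
  varying size do not form a \<open>comm_monoid_add\<close>.\<close>

definition rep_operator ::
  "nat \<Rightarrow> nat \<Rightarrow> ((nat \<Rightarrow> nat) \<Rightarrow> complex mat) \<Rightarrow> ((nat \<Rightarrow> nat) \<Rightarrow> real) \<Rightarrow> complex mat" where
  "rep_operator n d \<rho> x =
     mat d d (\<lambda>(i, j). \<Sum>\<pi>\<in>carrier (sym_group n). complex_of_real (x \<pi>) * \<rho> \<pi> $$ (i, j))"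

definition psd_operator ::
  "nat \<Rightarrow> (complex vec \<Rightarrow> complex vec \<Rightarrow> complex) \<Rightarrow> complex mat \<Rightarrow> bool" where
  "psd_operator d ip M \<longleftrightarrow>
     (\<forall>u\<in>carrier_vec d. \<forall>v\<in>carrier_vec d. ip (M *\<^sub>v u) v = ip u (M *\<^sub>v v)) \<and>
     (\<forall>k. eigenvalue M k \<longrightarrow> k \<in> \<real> \<and> Re k \<ge> 0)"

definition operator_ge ::
  "nat \<Rightarrow> ((nat \<Rightarrow> nat) \<Rightarrow> real) \<Rightarrow> ((nat \<Rightarrow> nat) \<Rightarrow> real) \<Rightarrow> bool" where
  "operator_ge n x y \<longleftrightarrow>
     (\<forall>d \<rho> ip. representation n d \<rho> \<longrightarrow> invariant_inner_product n d \<rho> ip \<longrightarrow>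
        psd_operator d ip (rep_operator n d \<rho> (\<lambda>\<pi>. x \<pi> - y \<pi>)))"

end

theory Submission
  imports Defs "HOL-Analysis.Finite_Function_Topology"
begin

text \<open>
  Let \<open>v\<close> be a vector of a unitary representation \<open>\<rho>\<close>. The kernel \<open>Re \<langle>\<rho> \<pi> v, \<rho> \<sigma> v\<rangle>\<close> is positive definite,
  and the operator of an element of the group algebra with coefficients symmetric under inversion is positive
  semidefinite once its quadratic form at every \<open>v\<close> is nonnegative. So the theorem is a statement about vectors \<open>f\<close> in real
  permutation representations with an invariant semi-inner product (locale \<open>perm_rep\<close>). There \<open>\<alpha>\<^sub>A\<close> has
  the quadratic form \<open>|A| (|f|\<^sup>2 - |P\<^sub>A f|\<^sup>2)\<close>, where \<open>P\<^sub>A\<close> is the orthogonal projection \<open>avg A\<close> onto the vectors invariant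
  under the permutations of \<open>A\<close>. Let \<open>B\<close> be the common part \<open>A\<^sub>0\<close>, let \<open>X\<close> be the set of the additional points of the other sets and
  call \<open>1\<close> the hub. The part of \<open>f\<close> orthogonal to the invariants of \<open>B\<close> contributes equally to both sides, so \<open>f\<close> may be
  taken invariant under \<open>B\<close> (\<open>energy_inequality\<close>).

  If \<open>B\<close> is empty, \<open>\<alpha>\<close> of a two-element set is the identity minus a transposition, and the claim is the octopus inequality of
  Caputo, Liggett and Richthammer. The proof of \<open>octopus_inequality\<close> gives the points weights of sum zero, negative only
  at the hub. For four points there is a positive operator \<open>quad\<close> in the group algebra; its weighted sum over all quadruples
  equals \<open>6 |W|\<^sup>2 - 12 s \<theta>\<close>, where \<open>W\<close> is the weighted sum of all transpositions of \<open>f\<close>, \<open>s\<close> the sum of the squares of the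
  weights and \<open>\<theta>\<close> twice the difference of the two sides. A comparison for five points (\<open>quad_five\<close>) shows that the weighted sum is
  nonpositive, whence \<open>\<theta> \<ge> 0\<close>.

  If \<open>B\<close> is not empty, let \<open>m = |B| + 1\<close> and \<open>p = m + 1\<close>. The locale \<open>star\<close> splits \<open>f\<close> and its projections into vectors \<open>q\<close>, \<open>e x\<close>,
  \<open>u x\<close> attached to the points and \<open>v x y\<close>, \<open>n x y\<close> attached to pairs. All projections involved enlarge \<open>B\<close> by a few
  points, and an average over one more point is a sum of transpositions (\<open>avg_insert\<close>); when the larger average vanishes,
  the smaller one is just a transposition up to a factor. This makes all inner products that occur computable.
  The projections to \<open>B\<close> with two additional points, which occur with the unfavourable sign, are estimated by \<open>bracket_bound\<close>.
  The difference of the two sides is then a quadratic form in the vectors above, and \<open>assembly_identity\<close> writes its product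
  with \<open>\<Lambda> = c\<^sub>0 m + p \<Sum>c\<close> as a sum of squares attached to the hub and to the points, of forms attached to pairs of points and
  of forms attached to triples.

  The pair forms are nonnegative by the two inequalities \<open>pair_bounds\<close> between the projections for two one-point extensions
  of the same set (\<open>pair_form_nonneg\<close>). The triple forms rest on a cocycle relation: the vectors \<open>w x y\<close> are differences of
  vectors attached to \<open>x\<close> and \<open>y\<close>, so those of a triple add up to zero after projection
  (\<open>cocycle_form_nonneg\<close>, \<open>triple_cocycle\<close>, \<open>triple_form_nonneg\<close>).
\<close>

section \<open>Permutation representations with an invariant form\<close>

text \<open>The form \<open>ip\<close> is only semidefinite. This costs nothing in the proofs, since every estimate is
obtained from \<open>ip y y \<ge> 0\<close> for explicit vectors \<open>y\<close>, and it makes every positive definite kernel on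
the group an instance.\<close>

locale perm_rep =
  fixes \<Omega> :: "'a set"
    and act :: "('a \<Rightarrow> 'a) \<Rightarrow> 'v::real_vector \<Rightarrow> 'v"
    and ip :: "'v \<Rightarrow> 'v \<Rightarrow> real"
  assumes finite_points: "finite \<Omega>"
    and act_add: "\<pi> permutes \<Omega> \<Longrightarrow> act \<pi> (x + y) = act \<pi> x + act \<pi> y"
    and act_scale: "\<pi> permutes \<Omega> \<Longrightarrow> act \<pi> (r *\<^sub>R x) = r *\<^sub>R act \<pi> x"
    and act_id: "act id x = x"
    and act_comp: "\<pi> permutes \<Omega> \<Longrightarrow> \<sigma> permutes \<Omega> \<Longrightarrow> act (\<pi> \<circ> \<sigma>) x = act \<pi> (act \<sigma> x)"
    and ip_add_left: "ip (x + y) z = ip x z + ip y z"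
    and ip_scale_left: "ip (r *\<^sub>R x) y = r * ip x y"
    and ip_sym: "ip x y = ip y x"
    and ip_nonneg: "0 \<le> ip x x"
    and ip_act: "\<pi> permutes \<Omega> \<Longrightarrow> ip (act \<pi> x) (act \<pi> y) = ip x y"
begin

lemma ip_add_right: "ip z (x + y) = ip z x + ip z y"
  by (metis ip_add_left ip_sym)

lemma ip_scale_right: "ip y (r *\<^sub>R x) = r * ip y x"
  by (metis ip_scale_left ip_sym)

lemma ip_minus_left: "ip (- x) y = - ip x y"
  using ip_scale_left[of "-1" x y] by simp

lemma ip_minus_right: "ip y (- x) = - ip y x"
  using ip_scale_right[of y "-1" x] by simp

lemma ip_diff_left: "ip (x - y) z = ip x z - ip y z"
  using ip_add_left[of x "- y" z] by (simp add: ip_minus_left)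

lemma ip_diff_right: "ip z (x - y) = ip z x - ip z y"
  using ip_add_right[of z x "- y"] by (simp add: ip_minus_right)

lemma ip_zero_left: "ip 0 x = 0"
  using ip_scale_left[of 0 0 x] by simp

lemma ip_zero_right: "ip x 0 = 0"
  using ip_scale_right[of x 0 0] by simp

lemma ip_sum_left: "ip (\<Sum>i\<in>I. f i) y = (\<Sum>i\<in>I. ip (f i) y)"
  by (induction I rule: infinite_finite_induct) (auto simp: ip_zero_left ip_add_left)

lemma ip_sum_right: "ip y (\<Sum>i\<in>I. f i) = (\<Sum>i\<in>I. ip y (f i))"
  by (induction I rule: infinite_finite_induct) (auto simp: ip_zero_right ip_add_right)

lemmas ip_bilinear = ip_add_left ip_add_right ip_diff_left ip_diff_right
  ip_minus_left ip_minus_right ip_scale_left ip_scale_right ip_zero_left ip_zero_right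

lemma ip_diff_square: "ip (x - c *\<^sub>R y) (x - c *\<^sub>R y) = ip x x - 2 * c * ip x y + c\<^sup>2 * ip y y"
  by (simp add: ip_bilinear ip_sym[of y x] power2_eq_square algebra_simps)

lemma act_zero: "\<pi> permutes \<Omega> \<Longrightarrow> act \<pi> 0 = 0"
  using act_scale[of \<pi> 0 0] by simp

lemma act_minus: "\<pi> permutes \<Omega> \<Longrightarrow> act \<pi> (- x) = - act \<pi> x"
  using act_scale[of \<pi> "-1" x] by simp

lemma act_diff: "\<pi> permutes \<Omega> \<Longrightarrow> act \<pi> (x - y) = act \<pi> x - act \<pi> y"
  using act_add[of \<pi> x "- y"] by (simp add: act_minus)

lemma act_sum: "\<pi> permutes \<Omega> \<Longrightarrow> act \<pi> (\<Sum>i\<in>I. f i) = (\<Sum>i\<in>I. act \<pi> (f i))"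
  by (induction I rule: infinite_finite_induct) (auto simp: act_zero act_add)

lemmas act_linear = act_add act_diff act_minus act_scale act_zero act_sum

lemma ip_act_left:
  assumes "\<pi> permutes \<Omega>"
  shows "ip (act \<pi> x) y = ip x (act (inv_into UNIV \<pi>) y)"
proof -
  have "ip (act \<pi> x) y = ip (act \<pi> x) (act \<pi> (act (inv_into UNIV \<pi>) y))"
    using act_comp[OF assms permutes_inv[OF assms], of y] assms
    by (simp add: permutes_inv_o act_id)
  then show ?thesis
    by (simp add: ip_act assms)
qed

abbreviation swap :: "'a \<Rightarrow> 'a \<Rightarrow> 'v \<Rightarrow> 'v"
  where "swap i j \<equiv> act (Transposition.transpose i j)"

lemma swap_permutes: "i \<in> \<Omega> \<Longrightarrow> j \<in> \<Omega> \<Longrightarrow> Transposition.transpose i j permutes \<Omega>"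
  by (rule permutes_swap_id)

lemma swap_linear: "i \<in> \<Omega> \<Longrightarrow> j \<in> \<Omega> \<Longrightarrow> swap i j (y + z) = swap i j y + swap i j z"
  "i \<in> \<Omega> \<Longrightarrow> j \<in> \<Omega> \<Longrightarrow> swap i j (y - z) = swap i j y - swap i j z"
  "i \<in> \<Omega> \<Longrightarrow> j \<in> \<Omega> \<Longrightarrow> swap i j (- z) = - swap i j z"
  "i \<in> \<Omega> \<Longrightarrow> j \<in> \<Omega> \<Longrightarrow> swap i j (r *\<^sub>R z) = r *\<^sub>R swap i j z"
  "i \<in> \<Omega> \<Longrightarrow> j \<in> \<Omega> \<Longrightarrow> swap i j 0 = 0"
  by (simp_all add: act_linear swap_permutes)

lemma swap_commute: "swap i j x = swap j i x"
  by (simp add: transpose_commute)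

lemma swap_swap: "i \<in> \<Omega> \<Longrightarrow> j \<in> \<Omega> \<Longrightarrow> swap i j (swap i j x) = x"
  by (simp flip: act_comp[OF swap_permutes swap_permutes] add: act_id)

lemma ip_swap: "i \<in> \<Omega> \<Longrightarrow> j \<in> \<Omega> \<Longrightarrow> ip (swap i j x) y = ip x (swap i j y)"
  by (simp add: ip_act_left swap_permutes)

definition invariant :: "'a set \<Rightarrow> 'v \<Rightarrow> bool"
  where "invariant A x \<longleftrightarrow> (\<forall>\<pi>. \<pi> permutes A \<longrightarrow> act \<pi> x = x)"

text \<open>The orthogonal projection onto the vectors fixed by all permutations of \<open>A\<close>.\<close>

definition avg :: "'a set \<Rightarrow> 'v \<Rightarrow> 'v"
  where "avg A x = (1 / fact (card A)) *\<^sub>R (\<Sum>\<pi> | \<pi> permutes A. act \<pi> x)"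

lemma permutes_points: "\<pi> permutes A \<Longrightarrow> A \<subseteq> \<Omega> \<Longrightarrow> \<pi> permutes \<Omega>"
  by (rule permutes_subset)

lemma finite_block: "A \<subseteq> \<Omega> \<Longrightarrow> finite A"
  using finite_points by (rule finite_subset[rotated])

lemma invariantD: "invariant A x \<Longrightarrow> \<pi> permutes A \<Longrightarrow> act \<pi> x = x"
  by (simp add: invariant_def)

lemma invariant_subset: "invariant A x \<Longrightarrow> B \<subseteq> A \<Longrightarrow> invariant B x"
  by (meson invariant_def permutes_subset)

lemma invariant_swap: "invariant A x \<Longrightarrow> i \<in> A \<Longrightarrow> j \<in> A \<Longrightarrow> swap i j x = x"
  by (simp add: invariant_def permutes_swap_id)

lemma invariant_linear:
  assumes "A \<subseteq> \<Omega>"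
  shows "invariant A x \<Longrightarrow> invariant A y \<Longrightarrow> invariant A (x + y)"
    and "invariant A x \<Longrightarrow> invariant A y \<Longrightarrow> invariant A (x - y)"
    and "invariant A x \<Longrightarrow> invariant A (r *\<^sub>R x)"
    and "invariant A x \<Longrightarrow> invariant A (- x)"
    and "invariant A 0"
  using permutes_points[OF _ assms] by (auto simp: invariant_def act_linear)

lemma avg_linear:
  assumes "A \<subseteq> \<Omega>"
  shows "avg A (x + y) = avg A x + avg A y"
    and "avg A (x - y) = avg A x - avg A y"
    and "avg A (r *\<^sub>R x) = r *\<^sub>R avg A x"
    and "avg A (- x) = - avg A x"
    and "avg A 0 = 0"
  using permutes_points[OF _ assms]
  by (auto simp: avg_def act_linear sum.distrib sum_subtractf scaleR_add_right scaleR_diff_right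
      sum_negf scaleR_sum_right mult.commute intro!: sum.cong)

lemma act_avg:
  assumes A: "A \<subseteq> \<Omega>" and \<sigma>: "\<sigma> permutes \<Omega>"
  shows "act \<sigma> (avg A x) = avg (\<sigma> ` A) (act \<sigma> x)"
proof -
  let ?\<tau> = "inv_into UNIV \<sigma>"
  have inj: "inj_on \<sigma> A"
    using permutes_inj_on[OF \<sigma>] by blast
  have bij: "bij_betw \<sigma> A (\<sigma> ` A)" and bij': "bij_betw ?\<tau> (\<sigma> ` A) A"
    using inj permutes_inverses[OF \<sigma>] by (auto simp: bij_betw_def inj_on_def image_iff)
  have comp: "map_permutation A \<sigma> \<pi> \<circ> \<sigma> = \<sigma> \<circ> \<pi>" if "\<pi> permutes A" for \<pi>
  proof
    fix y
    show "(map_permutation A \<sigma> \<pi> \<circ> \<sigma>) y = (\<sigma> \<circ> \<pi>) y"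
    proof (cases "y \<in> A")
      case True
      then show ?thesis
        using map_permutation_apply[OF inj] by simp
    next
      case False
      then have "\<sigma> y \<notin> \<sigma> ` A"
        using permutes_inj[OF \<sigma>] by (auto dest: injD)
      then show ?thesis
        using False that map_permutation_permutes[OF bij that] by (simp add: permutes_not_in)
    qed
  qed
  have "(\<Sum>\<pi> | \<pi> permutes A. act (\<sigma> \<circ> \<pi>) x) = (\<Sum>\<pi> | \<pi> permutes \<sigma> ` A. act (\<pi> \<circ> \<sigma>) x)"
  proof (rule sum.reindex_bij_witness[where j = "map_permutation A \<sigma>" and i = "map_permutation (\<sigma> ` A) ?\<tau>"])
    fix \<pi> assume "\<pi> \<in> {\<pi>. \<pi> permutes \<sigma> ` A}"
    then have \<pi>: "\<pi> permutes \<sigma> ` A" by simp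
    show "map_permutation A \<sigma> (map_permutation (\<sigma> ` A) ?\<tau> \<pi>) = \<pi>"
      by (rule map_permutation_compose_inv[OF bij' \<pi>]) (simp add: permutes_inverses[OF \<sigma>])
    show "map_permutation (\<sigma> ` A) ?\<tau> \<pi> \<in> {\<pi>. \<pi> permutes A}"
      using map_permutation_permutes[OF bij' \<pi>] by simp
  next
    fix \<pi> assume "\<pi> \<in> {\<pi>. \<pi> permutes A}"
    then have \<pi>: "\<pi> permutes A" by simp
    show "map_permutation (\<sigma> ` A) ?\<tau> (map_permutation A \<sigma> \<pi>) = \<pi>"
      by (rule map_permutation_compose_inv[OF bij \<pi>]) (simp add: permutes_inverses[OF \<sigma>])
    show "map_permutation A \<sigma> \<pi> \<in> {\<pi>. \<pi> permutes \<sigma> ` A}"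
      using map_permutation_permutes[OF bij \<pi>] by simp
    show "act (map_permutation A \<sigma> \<pi> \<circ> \<sigma>) x = act (\<sigma> \<circ> \<pi>) x"
      by (simp only: comp[OF \<pi>])
  qed
  moreover have "(\<Sum>\<pi> | \<pi> permutes A. act (\<sigma> \<circ> \<pi>) x) = (\<Sum>\<pi> | \<pi> permutes A. act \<sigma> (act \<pi> x))"
    using permutes_points[OF _ A] by (intro sum.cong refl act_comp[OF \<sigma>]) simp
  moreover have "(\<Sum>\<pi> | \<pi> permutes \<sigma> ` A. act (\<pi> \<circ> \<sigma>) x) = (\<Sum>\<pi> | \<pi> permutes \<sigma> ` A. act \<pi> (act \<sigma> x))"
  proof (intro sum.cong refl act_comp[OF _ \<sigma>])
    fix \<pi> assume "\<pi> \<in> {\<pi>. \<pi> permutes \<sigma> ` A}"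
    moreover have "\<sigma> ` A \<subseteq> \<Omega>"
      using A permutes_image[OF \<sigma>] by blast
    ultimately show "\<pi> permutes \<Omega>"
      using permutes_subset by blast
  qed
  ultimately show ?thesis
    by (simp add: avg_def act_scale[OF \<sigma>] act_sum[OF \<sigma>] card_image[OF inj])
qed

lemma avg_act:
  assumes A: "A \<subseteq> \<Omega>" and \<sigma>: "\<sigma> permutes A"
  shows "avg A (act \<sigma> x) = avg A x"
proof -
  have "(\<Sum>\<pi> | \<pi> permutes A. act \<pi> (act \<sigma> x)) = (\<Sum>\<pi> | \<pi> permutes A. act (\<pi> \<circ> \<sigma>) x)"
    using permutes_points[OF _ A] \<sigma> by (intro sum.cong) (auto simp: act_comp)
  also have "\<dots> = (\<Sum>\<pi> | \<pi> permutes A. act \<pi> x)"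
    by (rule sum.reindex_bij_witness[where i = "\<lambda>\<pi>. \<pi> \<circ> inv_into UNIV \<sigma>" and j = "\<lambda>\<pi>. \<pi> \<circ> \<sigma>"])
      (use \<sigma> in \<open>auto simp: comp_assoc permutes_inv_o intro: permutes_compose permutes_inv\<close>)
  finally show ?thesis
    by (simp add: avg_def)
qed

lemma avg_invariant: 
  assumes "A \<subseteq> \<Omega>"
  shows "invariant A (avg A x)"
proof (unfold invariant_def, intro allI impI)
  fix \<pi> assume \<pi>: "\<pi> permutes A"
  show "act \<pi> (avg A x) = avg A x"
    using act_avg[OF assms permutes_points[OF \<pi> assms], of x] avg_act[OF assms \<pi>]
    by (simp add: permutes_image[OF \<pi>])
qed

lemma avg_of_invariant:
  assumes "A \<subseteq> \<Omega>" "invariant A x"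
  shows "avg A x = x"
proof -
  have "(\<Sum>\<pi> | \<pi> permutes A. act \<pi> x) = (\<Sum>\<pi> | \<pi> permutes A. x)"
    by (intro sum.cong refl) (simp add: invariantD[OF assms(2)])
  also have "\<dots> = fact (card A) *\<^sub>R x"
    using card_permutations[OF refl finite_block[OF assms(1)]] by (simp only: sum_constant_scaleR of_nat_fact)
  finally show ?thesis
    by (simp add: avg_def)
qed

lemma ip_avg:
  assumes A: "A \<subseteq> \<Omega>"
  shows "ip (avg A x) y = ip x (avg A y)"
proof -
  have "(\<Sum>\<pi> | \<pi> permutes A. ip (act \<pi> x) y) = (\<Sum>\<pi> | \<pi> permutes A. ip x (act \<pi> y))"
    by (rule sum.reindex_bij_witness[where i = "inv_into UNIV" and j = "inv_into UNIV"])
      (use permutes_points[OF _ A] in \<open>auto simp: permutes_inv permutes_inv_inv ip_act_left\<close>)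
  then show ?thesis
    by (simp add: avg_def ip_scale_left ip_scale_right ip_sum_left ip_sum_right)
qed

lemma avg_idem: "A \<subseteq> \<Omega> \<Longrightarrow> avg A (avg A x) = avg A x"
  by (rule avg_of_invariant[OF _ avg_invariant])

lemma ip_avg_avg:
  assumes "A \<subseteq> \<Omega>"
  shows "ip (avg A x) (avg A x) = ip x (avg A x)"
  by (simp only: ip_avg[OF assms, of x "avg A x"] avg_idem[OF assms])

text \<open>The projection onto a smaller space of invariants absorbs the projection onto a larger one. Almost all
vanishing statements about averages below come from this and from \<open>avg_act\<close>.\<close>

lemma avg_avg_subset:
  assumes "A \<subseteq> \<Omega>" "B \<subseteq> A"
  shows "avg A (avg B x) = avg A x" and "avg B (avg A x) = avg A x"
proof -
  have B: "B \<subseteq> \<Omega>" using assms by simp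
  have "avg A (avg B x) = (1 / fact (card B)) *\<^sub>R (\<Sum>\<pi> | \<pi> permutes B. avg A (act \<pi> x))"
  proof -
    have sum: "avg A (\<Sum>i\<in>I. f i) = (\<Sum>i\<in>I. avg A (f i))" for I :: "('a \<Rightarrow> 'a) set" and f
      by (induction I rule: infinite_finite_induct) (auto simp: avg_linear[OF assms(1)])
    show ?thesis
      by (subst (2) avg_def) (simp add: avg_linear[OF assms(1)] sum)
  qed
  also have "\<dots> = (1 / fact (card B)) *\<^sub>R (\<Sum>\<pi> | \<pi> permutes B. avg A x)"
    using avg_act[OF assms(1)] permutes_subset[OF _ assms(2)] by (intro arg_cong[where f = "scaleR _"] sum.cong) auto
  also have "\<dots> = (1 / fact (card B)) *\<^sub>R (fact (card B) *\<^sub>R avg A x)"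
    using card_permutations[OF refl finite_block[OF B]] by (simp only: sum_constant_scaleR of_nat_fact)
  also have "\<dots> = avg A x"
    by simp
  finally show "avg A (avg B x) = avg A x" .
  show "avg B (avg A x) = avg A x"
    using B avg_invariant[OF assms(1)] invariant_subset[OF _ assms(2)] by (blast intro: avg_of_invariant)
qed

lemma invariant_act:
  assumes A: "A \<subseteq> \<Omega>" and \<sigma>: "\<sigma> permutes \<Omega>" and x: "invariant A x"
  shows "invariant (\<sigma> ` A) (act \<sigma> x)"
proof -
  have "\<sigma> ` A \<subseteq> \<Omega>"
    using A permutes_image[OF \<sigma>] by blast
  moreover have "act \<sigma> x = avg (\<sigma> ` A) (act \<sigma> x)"
    using act_avg[OF A \<sigma>, of x] avg_of_invariant[OF A x] by simp
  ultimately show ?thesis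
    using avg_invariant by metis
qed

lemma transpose_image_outside: "i \<notin> C \<Longrightarrow> j \<notin> C \<Longrightarrow> Transposition.transpose i j ` C = C"
  by (auto simp: Transposition.transpose_def image_iff)

lemma invariant_swap_outside:
  assumes "C \<subseteq> \<Omega>" "i \<in> \<Omega>" "i \<notin> C" "j \<in> \<Omega>" "j \<notin> C" "invariant C x"
  shows "invariant C (swap i j x)"
  using invariant_act[OF assms(1) swap_permutes assms(6), of i j] assms by (simp add: transpose_image_outside)

lemma invariant_swap_insert:
  assumes "C \<subseteq> \<Omega>" "i \<in> \<Omega>" "i \<notin> C" "j \<in> \<Omega>" "j \<notin> C" "invariant (insert i C) x"
  shows "invariant (insert j C) (swap i j x)"
  using invariant_act[OF _ swap_permutes assms(6), of i j] assms by (simp add: transpose_image_outside)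

lemma swap_avg_outside:
  assumes "C \<subseteq> \<Omega>" "i \<in> \<Omega>" "i \<notin> C" "j \<in> \<Omega>" "j \<notin> C"
  shows "swap i j (avg C x) = avg C (swap i j x)"
  using act_avg[OF assms(1) swap_permutes, of i j x] assms by (simp add: transpose_image_outside)

lemma swap_avg:
  assumes "C \<subseteq> \<Omega>" "i \<in> \<Omega>" "j \<in> \<Omega>" "i \<notin> C" "j \<notin> C"
  shows "swap i j (avg (insert i C) x) = avg (insert j C) (swap i j x)"
  using act_avg[OF _ swap_permutes[OF assms(2,3)], of "insert i C" x] assms by (simp add: transpose_image_outside)

text \<open>The transpositions \<open>(a y)\<close>, \<open>y \<in> C\<close>, and the identity are coset representatives of the permutations of
\<open>C\<close> in those of \<open>insert a C\<close>.\<close>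

lemma avg_insert:
  assumes C: "C \<subseteq> \<Omega>" "a \<in> \<Omega>" "a \<notin> C" and inv: "invariant C x"
  shows "(real (card C) + 1) *\<^sub>R avg (insert a C) x = x + (\<Sum>y\<in>C. swap a y x)"
proof -
  have fin: "finite C" using C finite_block by blast
  have "(\<Sum>\<pi> | \<pi> permutes insert a C. act \<pi> x)
      = (\<Sum>q\<in>insert a C. \<Sum>\<pi> | \<pi> permutes C. act (Transposition.transpose a q \<circ> \<pi>) x)"
    by (rule sum_over_permutations_insert[OF fin C(3)])
  also have "\<dots> = (\<Sum>q\<in>insert a C. \<Sum>\<pi> | \<pi> permutes C. swap a q x)"
    using C swap_permutes permutes_points[OF _ C(1)] inv
    by (intro sum.cong refl) (auto simp: act_comp invariant_def subset_iff)
  also have "\<dots> = fact (card C) *\<^sub>R (\<Sum>q\<in>insert a C. swap a q x)"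
    using card_permutations[OF refl fin] by (simp only: sum_constant_scaleR of_nat_fact scaleR_sum_right)
  also have "(\<Sum>q\<in>insert a C. swap a q x) = x + (\<Sum>y\<in>C. swap a y x)"
    using fin C(3) by (simp add: act_id)
  finally show ?thesis
    using fin C(3) by (simp add: avg_def fact_reduce add.commute)
qed

section \<open>Two one-point extensions of a block\<close>

text \<open>Averaging over \<open>insert i (insert j C)\<close> after averaging over \<open>insert i C\<close> uses the transpositions \<open>(j y)\<close>,
\<open>y \<in> C\<close>, which by themselves average over \<open>insert j C\<close>, and one additional transposition \<open>(i j)\<close>.\<close>

lemma avg_pair:
  assumes C: "C \<subseteq> \<Omega>" and i: "i \<in> \<Omega>" "i \<notin> C" and j: "j \<in> \<Omega>" "j \<notin> C" and ij: "i \<noteq> j"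
    and inv: "invariant C x"
  shows "(real (card C) + 2) *\<^sub>R avg (insert i (insert j C)) x
    = (real (card C) + 1) *\<^sub>R avg (insert j C) (avg (insert i C) x) + swap i j (avg (insert i C) x)"
proof -
  let ?y = "avg (insert i C) x"
  have iC: "insert i C \<subseteq> \<Omega>" using C i by simp
  have fin: "finite C" using C finite_block by blast
  have invi: "invariant (insert i C) ?y"
    using avg_invariant[OF iC] .
  have invC: "invariant C ?y"
    using invariant_subset[OF invi] by blast
  have "(real (card (insert i C)) + 1) *\<^sub>R avg (insert j (insert i C)) ?y = ?y + (\<Sum>z\<in>insert i C. swap j z ?y)"
    by (rule avg_insert[OF iC j(1) _ invi]) (use j ij in auto)
  also have "(\<Sum>z\<in>insert i C. swap j z ?y) = swap i j ?y + (\<Sum>z\<in>C. swap j z ?y)"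
    using fin i by (simp add: transpose_commute)
  finally have "(real (card C) + 2) *\<^sub>R avg (insert j (insert i C)) ?y = ?y + (\<Sum>z\<in>C. swap j z ?y) + swap i j ?y"
    using fin i by (simp add: algebra_simps)
  moreover have "avg (insert j (insert i C)) ?y = avg (insert i (insert j C)) x"
    using avg_avg_subset(1)[of "insert i (insert j C)" "insert i C" x] iC j by (simp add: insert_commute subset_insertI2)
  ultimately show ?thesis
    using avg_insert[OF C j invC] by simp
qed

text \<open>Pairing \<open>avg_pair\<close> with \<open>x\<close> and with its transpose \<open>(i j) x\<close> determines the Gram matrix of \<open>x\<close>, its
averages over \<open>insert i C\<close>, \<open>insert j C\<close> and their union, and the images of these vectors under the
transposition, up to the numbers \<open>ip x x\<close>, \<open>ip x (swap i j x)\<close>, \<open>ip u u\<close>, \<open>ip v v\<close>, \<open>ip u (swap i j x)\<close> and \<open>ip h h\<close>.\<close>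

lemma pair_gram:
  assumes C: "C \<subseteq> \<Omega>" and i: "i \<in> \<Omega>" "i \<notin> C" and j: "j \<in> \<Omega>" "j \<notin> C" and ij: "i \<noteq> j"
    and inv: "invariant C x"
  defines "p \<equiv> real (card C) + 1"
    and "u \<equiv> avg (insert i C) x" and "v \<equiv> avg (insert j C) x" and "h \<equiv> avg (insert i (insert j C)) x"
  shows "p * ip u v = (p + 1) * ip h h - ip u (swap i j x)"
    and "p * ip u (swap i j u) = (p + 1) * ip h h - ip u u"
    and "ip v (swap i j x) = ip u (swap i j x)"
    and "ip u (swap i j v) = ip u (swap i j x)"
    and "ip x u = ip u u" and "ip x h = ip h h"
    and "ip u h = ip h h"
    and "swap i j h = h"
proof -
  have sub: "insert i C \<subseteq> \<Omega>" "insert j C \<subseteq> \<Omega>" "insert i (insert j C) \<subseteq> \<Omega>"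
    using C i j by auto
  have su: "swap i j u = avg (insert j C) (swap i j x)"
    unfolding u_def by (rule swap_avg) (use C i j in auto)
  have sv: "swap i j v = avg (insert i C) (swap i j x)"
    unfolding v_def using swap_avg[of C j i x] C i j by (simp add: transpose_commute)
  have rel: "(p + 1) *\<^sub>R h = p *\<^sub>R avg (insert j C) u + swap i j u"
    unfolding p_def h_def u_def using avg_pair[OF C i j ij inv] by (simp add: add.assoc)
  show hh: "swap i j h = h"
    unfolding h_def by (rule invariant_swap[OF avg_invariant[OF sub(3)]]) auto
  show xu: "ip x u = ip u u" 
    unfolding u_def by (rule ip_avg_avg[OF sub(1), symmetric])
  show xh: "ip x h = ip h h"
    unfolding h_def by (rule ip_avg_avg[OF sub(3), symmetric])
  have hu: "avg (insert i C) h = h"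
    unfolding h_def using avg_avg_subset(2)[OF sub(3), of "insert i C" x] by auto
  show uh: "ip u h = ip h h"
    unfolding u_def ip_avg[OF sub(1)] hu by (rule xh)
  have sx: "ip (swap i j x) h = ip h h"
    using ip_swap[OF i(1) j(1), of x h] hh xh by simp
  have "(p + 1) * ip h h = ip ((p + 1) *\<^sub>R h) x"
    using xh by (simp add: ip_bilinear ip_sym)
  also have "\<dots> = p * ip (avg (insert j C) u) x + ip (swap i j u) x"
    by (simp only: rel ip_bilinear)
  also have "ip (avg (insert j C) u) x = ip u v"
    by (simp add: ip_avg[OF sub(2)] v_def)
  also have "ip (swap i j u) x = ip u (swap i j x)"
    by (rule ip_swap[OF i(1) j(1)])
  finally show "p * ip u v = (p + 1) * ip h h - ip u (swap i j x)"
    by simp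
  have "(p + 1) * ip h h = ip ((p + 1) *\<^sub>R h) (swap i j x)"
    using sx by (simp add: ip_bilinear ip_sym)
  also have "\<dots> = p * ip (avg (insert j C) u) (swap i j x) + ip (swap i j u) (swap i j x)"
    by (simp only: rel ip_bilinear)
  also have "ip (avg (insert j C) u) (swap i j x) = ip u (swap i j u)"
    by (simp add: ip_avg[OF sub(2)] su)
  also have "ip (swap i j u) (swap i j x) = ip u u"
    using xu by (simp add: ip_act swap_permutes i j ip_sym)
  finally show "p * ip u (swap i j u) = (p + 1) * ip h h - ip u u"
    by simp
  have "ip v (swap i j x) = ip x (swap i j u)"
    by (simp add: v_def ip_avg[OF sub(2)] su)
  also have "\<dots> = ip u (swap i j x)"
    using ip_swap[OF i(1) j(1), of u x] by (simp add: ip_sym)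
  finally show "ip v (swap i j x) = ip u (swap i j x)" .
  have "ip u (swap i j v) = ip (avg (insert i C) u) (swap i j x)"
    by (simp only: sv ip_avg[OF sub(1)])
  then show "ip u (swap i j v) = ip u (swap i j x)"
    unfolding u_def avg_idem[OF sub(1)] .
qed

text \<open>The two extreme consequences of positivity of the Gram matrix of \<open>pair_gram\<close>, one in the eigenspace of the
transposition for \<open>-1\<close> and one in that for \<open>1\<close>: each is Cauchy-Schwarz for the (anti)symmetrized \<open>x\<close>
against the (anti)symmetrized \<open>u + v\<close>, written as the square that proves it.\<close>

lemma pair_bounds:
  assumes C: "C \<subseteq> \<Omega>" and i: "i \<in> \<Omega>" "i \<notin> C" and j: "j \<in> \<Omega>" "j \<notin> C" and ij: "i \<noteq> j"
    and inv: "invariant C x"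
  defines "p \<equiv> real (card C) + 1"
    and "u \<equiv> avg (insert i C) x" and "v \<equiv> avg (insert j C) x" and "h \<equiv> avg (insert i (insert j C)) x"
  shows pair_bound_antisymmetric:
      "p * (ip u u + ip v v - 2 * ip u (swap i j x)) \<le> (p + 1) * (ip x x - ip x (swap i j x))"
    and pair_bound_symmetric:
      "C \<noteq> {} \<Longrightarrow> p * (ip u u + ip v v + 2 * ip u (swap i j x) - 4 * ip h h)
        \<le> (p - 1) * (ip x x + ip x (swap i j x) - 2 * ip h h)"
proof -
  define t where "t = swap i j"
  note g1 = pair_gram[OF C i j ij inv, folded p_def u_def v_def h_def t_def]
  have hcomm: "avg (insert j (insert i C)) x = h" "swap j i = t"
    by (simp_all add: h_def t_def insert_commute transpose_commute)
  note g2 = pair_gram[OF C j i ij[symmetric] inv, folded p_def u_def v_def, unfolded hcomm]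
  define a b K H G X where "a = ip u u" and "b = ip v v" and "K = ip u (t x)" and "H = ip h h"
    and "G = ip x x" and "X = ip x (t x)"
  have p: "p \<ge> 1" by (simp add: p_def)
  have t: "ip (t y) (t z) = ip y z" "ip (t y) z = ip y (t z)" "t (t y) = y" for y z
    by (simp_all add: t_def ip_act swap_permutes i j ip_swap swap_swap)
  have tl: "t (y + z) = t y + t z" "t (y - z) = t y - t z" "t (r *\<^sub>R y) = r *\<^sub>R t y" for y z r
    by (simp_all add: t_def act_linear swap_permutes i j)
  define L where "L = ((p + 1) * H - K) / p"
  define M where "M = ((p + 1) * H - a) / p"
  define N where "N = ((p + 1) * H - b) / p"
  have uv: "ip u v = L" "ip v u = L"
    using g1(1) p by (simp_all add: L_def K_def H_def field_simps ip_sym)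
  have M: "ip u (t u) = M" and N: "ip v (t v) = N"
    using g1(2) g2(2) p by (simp_all add: M_def N_def a_def b_def H_def field_simps)
  have K: "ip u (t x) = K" "ip v (t x) = K" "ip x (t u) = K" "ip x (t v) = K" "ip u (t v) = K" "ip v (t u) = K"
    using g1(3,4) g2(3,4) t(2)[of u x] t(2)[of v x] by (simp_all add: K_def ip_sym)
  have ab: "ip x u = a" "ip u x = a" "ip x v = b" "ip v x = b" "ip u u = a" "ip v v = b"
    using g1(5) g2(5) by (simp_all add: a_def b_def ip_sym)
  have H: "ip x h = H" "ip h x = H" "ip u h = H" "ip v h = H" "ip h u = H" "ip h v = H" "ip h h = H" "t h = h"
    using g1(6,7,8) g2(6,7) by (simp_all add: H_def ip_sym)
  have hx: "ip h (t x) = H" "ip h (t u) = H" "ip h (t v) = H"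
    using t(2)[of h x] t(2)[of h u] t(2)[of h v] H by simp_all
  have GX: "ip x x = G" "ip x (t x) = X"
    by (simp_all add: G_def X_def)
  note gram = uv M N K ab H hx GX t tl ip_bilinear
  define s where "s = (u + v) - t (u + v)"
  have yy: "ip (x - t x) (x - t x) = 2 * (G - X)"
    by (simp add: gram)
  have ys: "ip (x - t x) s = 2 * (a + b - 2 * K)"
    by (simp add: s_def gram)
  have ss: "ip s s = 2 * (a + b - 2 * K) + 4 * L - 2 * M - 2 * N"
    by (simp add: s_def gram)
  also have "\<dots> = 2 * ((p + 1) / p) * (a + b - 2 * K)"
    using p by (simp add: L_def M_def N_def field_simps)
  finally have ss: "ip s s = 2 * ((p + 1) / p) * (a + b - 2 * K)" .
  have "0 \<le> ip ((p + 1) *\<^sub>R (x - t x) - p *\<^sub>R s) ((p + 1) *\<^sub>R (x - t x) - p *\<^sub>R s)"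
    by (rule ip_nonneg)
  also have "\<dots> = (p + 1)\<^sup>2 * ip (x - t x) (x - t x) - 2 * p * (p + 1) * ip (x - t x) s + p\<^sup>2 * ip s s"
    by (simp only: ip_diff_square) (simp add: ip_scale_left ip_scale_right power2_eq_square)
  also have "\<dots> = 2 * (p + 1) * ((p + 1) * (G - X) - p * (a + b - 2 * K))"
    using p by (simp add: yy ys ss field_simps power2_eq_square)
  finally have "0 \<le> 2 * (p + 1) * ((p + 1) * (G - X) - p * (a + b - 2 * K))" .
  then show "p * (ip u u + ip v v - 2 * ip u (swap i j x)) \<le> (p + 1) * (ip x x - ip x (swap i j x))"
    using p by (simp add: zero_le_mult_iff a_def b_def K_def G_def X_def t_def)
  \<comment> \<open>The vectors \<open>x\<close>, \<open>u\<close>, \<open>v\<close> and their transposes all have the projection \<open>h\<close>. Subtracting it first improves the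
    constant to \<open>(p - 1) / p\<close>.\<close>
  define r where "r = (u + v) + t (u + v) - 4 *\<^sub>R h"
  define y where "y = x + t x - 2 *\<^sub>R h"
  have yy: "ip y y = 2 * (G + X - 2 * H)"
    by (simp add: y_def gram)
  have yr: "ip y r = 2 * (a + b + 2 * K - 4 * H)"
    by (simp add: y_def r_def gram)
  have "ip r r = 2 * (a + b + 2 * K) + 4 * L + 2 * M + 2 * N - 16 * H"
    by (simp add: r_def gram)
  also have "\<dots> = 2 * ((p - 1) / p) * (a + b + 2 * K - 4 * H)"
    using p by (simp add: L_def M_def N_def field_simps)
  finally have rr: "ip r r = 2 * ((p - 1) / p) * (a + b + 2 * K - 4 * H)" .
  have "0 \<le> ip ((p - 1) *\<^sub>R y - p *\<^sub>R r) ((p - 1) *\<^sub>R y - p *\<^sub>R r)"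
    by (rule ip_nonneg)
  also have "\<dots> = (p - 1) * ((p - 1) * ip y y) - 2 * p * (p - 1) * ip y r + p * (p * ip r r)"
    by (simp add: ip_bilinear ip_sym[of r y] algebra_simps)
  also have "\<dots> = 2 * (p - 1) * ((p - 1) * (G + X - 2 * H) - p * (a + b + 2 * K - 4 * H))"
    using p by (simp add: yy yr rr field_simps)
  finally have pos: "0 \<le> 2 * (p - 1) * ((p - 1) * (G + X - 2 * H) - p * (a + b + 2 * K - 4 * H))" .
  assume "C \<noteq> {}"
  then have "p > 1"
    using finite_block[OF C] by (simp add: p_def card_gt_0_iff)
  then have "p * (a + b + 2 * K - 4 * H) \<le> (p - 1) * (G + X - 2 * H)"
    using pos by (simp add: zero_le_mult_iff)
  then show "p * (ip u u + ip v v + 2 * ip u (swap i j x) - 4 * ip h h)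
        \<le> (p - 1) * (ip x x + ip x (swap i j x) - 2 * ip h h)"
    by (simp add: a_def b_def K_def G_def X_def H_def t_def)
qed

text \<open>If the average over \<open>insert o' C\<close> vanishes, both bounds of \<open>pair_bounds\<close> concern the same number \<open>b\<close>, and the
combination with weights \<open>(p - 1) / 2\<close> and \<open>(p + 1) / 2\<close> has the coefficients that occur for
triples of sites.\<close>

lemma killed_form_nonneg:
  assumes C: "C \<subseteq> \<Omega>" "C \<noteq> {}" and o: "o' \<in> \<Omega>" "o' \<notin> C" and x: "x \<in> \<Omega>" "x \<notin> C" and ox: "o' \<noteq> x"
    and inv: "invariant C W" and kill: "avg (insert o' C) W = 0"
  defines "p \<equiv> real (card C)"
  shows "p * (p + 1) * ip (avg (insert x C) W) W \<le> (p\<^sup>2 + p - 1) * ip W W + ip W (swap o' x W)"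
proof -
  have sub: "insert o' C \<subseteq> \<Omega>" "insert o' (insert x C) \<subseteq> \<Omega>" "insert x C \<subseteq> \<Omega>" using C o x by auto
  have h: "avg (insert o' (insert x C)) W = 0"
    using avg_avg_subset(1)[OF sub(2), of "insert o' C" W] kill by (auto simp: avg_linear[OF sub(2)])
  define v where "v = avg (insert x C) W"
  define b where "b = ip v v"
  have b: "ip (avg (insert x C) W) W = b"
    unfolding b_def v_def by (simp only: ip_avg_avg[OF sub(3)] ip_sym[of "avg (insert x C) W" W])
  have p: "p \<ge> 1"
    using C finite_block[OF C(1)] by (simp add: p_def Suc_le_eq card_gt_0_iff)
  note bounds = pair_bounds[OF C(1) o x ox inv, folded p_def v_def, unfolded kill h]
  have "(p + 1) * b \<le> (p + 2) * (ip W W - ip W (swap o' x W))"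
    using bounds(1) by (simp add: b_def ip_zero_left ip_zero_right add.assoc)
  moreover have "(p + 1) * b \<le> p * (ip W W + ip W (swap o' x W))"
    using bounds(2)[OF C(2)] by (simp add: b_def ip_zero_left ip_zero_right)
  ultimately have "(p - 1) / 2 * ((p + 1) * b) + (p + 1) / 2 * ((p + 1) * b)
      \<le> (p - 1) / 2 * ((p + 2) * (ip W W - ip W (swap o' x W))) + (p + 1) / 2 * (p * (ip W W + ip W (swap o' x W)))"
    using p by (intro add_mono mult_left_mono) auto
  also have "\<dots> = (p\<^sup>2 + p - 1) * ip W W + ip W (swap o' x W)"
    by (simp add: field_simps power2_eq_square)
  finally show ?thesis
    unfolding b by (simp add: field_simps)
qed

text \<open>The form of \<open>killed_form_nonneg\<close> is applied to \<open>W + Y\<close>, where \<open>Y\<close> is killed by both averages, so that the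
average term does not see it. On such vectors the form is that of \<open>A + (o' x)\<close> with \<open>A = p\<^sup>2 + p - 1\<close>, and \<open>Y\<close>
is chosen as the image of \<open>X\<close> under the inverse \<open>(A - (o' x)) / (A\<^sup>2 - 1)\<close>.\<close>

lemma killed_form_dual:
  assumes C: "C \<subseteq> \<Omega>" and card: "card C \<ge> 2" and o: "o' \<in> \<Omega>" "o' \<notin> C" and x: "x \<in> \<Omega>" "x \<notin> C" and ox: "o' \<noteq> x"
    and W: "invariant C W" "avg (insert o' C) W = 0"
    and X: "invariant C X" "avg (insert o' C) X = 0" "avg (insert x C) X = 0"
  defines "p \<equiv> real (card C)"
  shows "0 \<le> (p\<^sup>2 + p - 1) * ip W W + ip W (swap o' x W) - p * (p + 1) * ip (avg (insert x C) W) W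
    + 2 * ip W X + ip X X / (p\<^sup>2 + p - 2)"
proof -
  define A where "A = p\<^sup>2 + p - 1"
  have ne: "C \<noteq> {}" using card by auto
  have p: "p \<ge> 2" using card by (simp add: p_def)
  have "2 * 2 \<le> p * p"
    using p by (intro mult_mono) auto
  then have A: "A > 1" "p\<^sup>2 + p - 2 = A - 1"
    using p by (simp_all add: A_def power2_eq_square)
  have A2: "A * A - 1 > 0"
    using A(1) by (simp add: less_1_mult)
  define t where "t = swap o' x"
  have t: "ip (t y) z = ip y (t z)" "t (t y) = y" "t (y + z) = t y + t z" "t (r *\<^sub>R y) = r *\<^sub>R t y"
      "t (y - z) = t y - t z" for y z r
    by (simp_all add: t_def ip_swap swap_swap act_linear swap_permutes o x)
  have sub: "insert o' C \<subseteq> \<Omega>" "insert x C \<subseteq> \<Omega>" using C o x by auto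
  have invt: "invariant C (t X)"
    unfolding t_def by (rule invariant_swap_outside[OF C o x X(1)])
  have tX: "avg (insert o' C) (t X) = 0" "avg (insert x C) (t X) = 0"
  proof -
    have "avg (insert x C) (t X) = t (avg (insert o' C) X)"
      unfolding t_def using swap_avg[OF C o(1) x(1) o(2) x(2), of X] by simp
    then show "avg (insert x C) (t X) = 0"
      using X(2) by (simp add: t_def act_zero swap_permutes o x)
    have "avg (insert o' C) (t X) = t (avg (insert x C) X)"
      unfolding t_def using swap_avg[OF C x(1) o(1) x(2) o(2), of X] by (simp add: transpose_commute)
    then show "avg (insert o' C) (t X) = 0"
      using X(3) by (simp add: t_def act_zero swap_permutes o x)
  qed
  define Y where "Y = (1 / (A * A - 1)) *\<^sub>R (A *\<^sub>R X - t X)"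
  have Y: "avg (insert o' C) Y = 0" "avg (insert x C) Y = 0" "invariant C Y"
    using X invt tX by (simp_all add: Y_def avg_linear[OF sub(1)] avg_linear[OF sub(2)] invariant_linear[OF C])
  have AY: "A *\<^sub>R Y + t Y = X"
  proof -
    define k where "k = 1 / (A * A - 1)"
    have "A *\<^sub>R Y + t Y = (k * (A * A - 1)) *\<^sub>R X"
      unfolding Y_def k_def[symmetric] by (simp add: t algebra_simps)
    then show ?thesis using A2 by (simp add: k_def)
  qed
  define B where "B = (\<lambda>Z. p * (p + 1) * ip (avg (insert x C) Z) Z)"
  have BWY: "B (W + Y) = B W"
    using ip_avg[OF sub(2), of W Y] Y(2) by (simp add: B_def avg_linear[OF sub(2)] ip_bilinear)
  have "0 \<le> A * ip (W + Y) (W + Y) + ip (W + Y) (t (W + Y)) - B (W + Y)"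
    using killed_form_nonneg[OF C ne o x ox, of "W + Y"] W Y
    by (simp add: A_def B_def p_def t_def avg_linear[OF sub(1)] invariant_linear[OF C])
  also have "\<dots> = A * ip W W + ip W (t W) - B W + 2 * ip W (A *\<^sub>R Y + t Y) + ip Y (A *\<^sub>R Y + t Y)"
    unfolding BWY using t(1)[of W Y] by (simp add: t ip_bilinear ip_sym[of Y W] ip_sym[of Y "t W"] algebra_simps)
  also have "ip Y (A *\<^sub>R Y + t Y) = (A * ip X X - ip X (t X)) / (A * A - 1)"
    unfolding AY by (simp add: Y_def ip_bilinear t(1))
  also have "\<dots> \<le> ip X X / (A - 1)"
  proof -
    have "0 \<le> ip (X + t X) (X + t X)" by (rule ip_nonneg)
    also have "\<dots> = 2 * ip X X + 2 * ip X (t X)"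
      by (simp add: ip_bilinear t)
    finally have "A * ip X X - ip X (t X) \<le> (A + 1) * ip X X"
      by (simp add: algebra_simps)
    then have "(A * ip X X - ip X (t X)) / (A * A - 1) \<le> (A + 1) * ip X X / (A * A - 1)"
      using A2 by (intro divide_right_mono) auto
    also have "\<dots> = ip X X / (A - 1)"
    proof -
      have "A * A - 1 = (A + 1) * (A - 1)" by (simp add: algebra_simps)
      then show ?thesis using A(1) by simp
    qed
    finally show ?thesis .
  qed
  finally show ?thesis
    unfolding AY unfolding A(2) B_def t_def A_def by simp
qed

text \<open>The negative term \<open>(p - 1) * ip \<omega> \<omega>\<close> for the sum \<open>\<omega>\<close> of the three vectors is paid for by the three forms. By the
cocycle condition \<open>\<omega>\<close> itself is killed by both averages, hence \<open>X i - (p - 1) \<omega>\<close> is an admissible linear term in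
\<open>killed_form_dual\<close>; what remains is a square in \<open>\<omega>\<close> and the sum of the \<open>X i\<close>, divided by \<open>p + 2\<close>.\<close>

lemma cocycle_form_nonneg:
  assumes C: "C \<subseteq> \<Omega>" and card: "card C \<ge> 2" and o: "o' \<in> \<Omega>" "o' \<notin> C" and x: "x \<in> \<Omega>" "x \<notin> C" and ox: "o' \<noteq> x"
    and W: "\<And>i. i \<in> I \<Longrightarrow> invariant C (W i)" "\<And>i. i \<in> I \<Longrightarrow> avg (insert o' C) (W i) = 0"
    and X: "\<And>i. i \<in> I \<Longrightarrow> invariant C (X i)" "\<And>i. i \<in> I \<Longrightarrow> avg (insert o' C) (X i) = 0"
      "\<And>i. i \<in> I \<Longrightarrow> avg (insert x C) (X i) = 0"
    and I: "card I = 3"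
    and cocycle: "(\<Sum>i\<in>I. avg (insert x C) (W i)) = 0"
    and odd: "swap o' x (\<Sum>i\<in>I. W i) = - (\<Sum>i\<in>I. W i)"
  defines "p \<equiv> real (card C)"
  shows "0 \<le> (\<Sum>i\<in>I. (p\<^sup>2 + p - 1) * ip (W i) (W i) + ip (W i) (swap o' x (W i)) - p * (p + 1) * ip (avg (insert x C) (W i)) (W i)
      + 2 * ip (W i) (X i) + ip (X i) (X i) / (p - 1)\<^sup>2) - (p - 1) * ip (\<Sum>i\<in>I. W i) (\<Sum>i\<in>I. W i)"
proof -
  define m where "m = p - 1"
  have m: "m \<ge> 1" using card by (simp add: m_def p_def)
  have den: "p\<^sup>2 + p - 2 = m * (m + 3)"
    by (simp add: m_def power2_eq_square algebra_simps)
  define \<omega> where "\<omega> = (\<Sum>i\<in>I. W i)"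
  have finI: "finite I" using I by (metis card.infinite zero_neq_numeral)
  have sub: "insert o' C \<subseteq> \<Omega>" "insert x C \<subseteq> \<Omega>" using C o x by auto
  have invsum: "invariant C (\<Sum>i\<in>J. W i)" if "J \<subseteq> I" for J
    using finite_subset[OF that finI] that
    by (induction J rule: finite_induct) (auto simp: invariant_linear[OF C] W)
  have avgsum: "avg D (\<Sum>i\<in>J. W i) = (\<Sum>i\<in>J. avg D (W i))" if "D \<subseteq> \<Omega>" for D J
    by (induction J rule: infinite_finite_induct) (auto simp: avg_linear[OF that])
  have \<omega>: "invariant C \<omega>" "avg (insert o' C) \<omega> = 0" "avg (insert x C) \<omega> = 0"
    using invsum[of I] cocycle by (simp_all add: \<omega>_def avgsum[OF sub(1)] avgsum[OF sub(2)] W)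
  define Gf where "Gf = (\<lambda>i. (p\<^sup>2 + p - 1) * ip (W i) (W i) + ip (W i) (swap o' x (W i)) - p * (p + 1) * ip (avg (insert x C) (W i)) (W i))"
  define N where "N = (\<Sum>i\<in>I. ip (X i) (X i))"
  define \<xi> where "\<xi> = (\<Sum>i\<in>I. X i)"
  have "0 \<le> (\<Sum>i\<in>I. Gf i + 2 * ip (W i) (X i - m *\<^sub>R \<omega>) + ip (X i - m *\<^sub>R \<omega>) (X i - m *\<^sub>R \<omega>) / (m * (m + 3)))"
  proof (rule sum_nonneg)
    fix i assume i: "i \<in> I"
    show "0 \<le> Gf i + 2 * ip (W i) (X i - m *\<^sub>R \<omega>) + ip (X i - m *\<^sub>R \<omega>) (X i - m *\<^sub>R \<omega>) / (m * (m + 3))"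
      using killed_form_dual[OF C card o x ox W(1)[OF i] W(2)[OF i], of "X i - m *\<^sub>R \<omega>", folded p_def, unfolded den]
        X(1)[OF i] X(2)[OF i] X(3)[OF i] \<omega>
      by (simp add: Gf_def avg_linear[OF sub(1)] avg_linear[OF sub(2)] invariant_linear[OF C])
  qed
  also have "\<dots> = (\<Sum>i\<in>I. Gf i) + 2 * (\<Sum>i\<in>I. ip (W i) (X i)) - 2 * m * ip \<omega> \<omega>
      + (N - 2 * m * ip \<xi> \<omega> + 3 * m\<^sup>2 * ip \<omega> \<omega>) / (m * (m + 3))"
  proof -
    have a: "(\<Sum>i\<in>I. 2 * ip (W i) (X i - m *\<^sub>R \<omega>)) = 2 * (\<Sum>i\<in>I. ip (W i) (X i)) - 2 * m * ip \<omega> \<omega>"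
      by (simp add: \<omega>_def ip_sum_left ip_diff_right ip_scale_right sum_subtractf sum_distrib_left right_diff_distrib mult.assoc)
    have b: "(\<Sum>i\<in>I. ip (X i - m *\<^sub>R \<omega>) (X i - m *\<^sub>R \<omega>)) = N - 2 * m * ip \<xi> \<omega> + 3 * m\<^sup>2 * ip \<omega> \<omega>"
      using I by (simp only: ip_diff_square sum.distrib sum_subtractf N_def \<xi>_def ip_sum_left[of X] sum_distrib_left[symmetric] sum_constant)
    show ?thesis
      unfolding sum.distrib sum_divide_distrib[symmetric] a b by simp
  qed
  finally have 1: "0 \<le> (\<Sum>i\<in>I. Gf i) + 2 * (\<Sum>i\<in>I. ip (W i) (X i)) - 2 * m * ip \<omega> \<omega>
      + (N - 2 * m * ip \<xi> \<omega> + 3 * m\<^sup>2 * ip \<omega> \<omega>) / (m * (m + 3))" .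
  have 2: "ip \<xi> \<xi> \<le> 3 * N"
  proof -
    have "0 \<le> (\<Sum>i\<in>I. ip (X i - (1/3) *\<^sub>R \<xi>) (X i - (1/3) *\<^sub>R \<xi>))"
      by (intro sum_nonneg ip_nonneg)
    also have "\<dots> = N - 2 * (1/3) * ip \<xi> \<xi> + 3 * ((1/3)\<^sup>2 * ip \<xi> \<xi>)"
      using I by (simp only: ip_diff_square sum.distrib sum_subtractf N_def \<xi>_def ip_sum_left[of X] sum_distrib_left[symmetric] sum_constant)
    finally show ?thesis by (simp add: power2_eq_square)
  qed
  have "0 \<le> ip (m *\<^sub>R \<omega> - (- (1 / m)) *\<^sub>R \<xi>) (m *\<^sub>R \<omega> - (- (1 / m)) *\<^sub>R \<xi>)"
    by (rule ip_nonneg)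
  also have "\<dots> = m\<^sup>2 * ip \<omega> \<omega> + 2 * ip \<xi> \<omega> + ip \<xi> \<xi> / m\<^sup>2"
    unfolding ip_diff_square using m by (simp add: ip_scale_left ip_scale_right ip_sym[of \<omega> \<xi>] power2_eq_square field_simps)
  also have "\<dots> \<le> m\<^sup>2 * ip \<omega> \<omega> + 2 * ip \<xi> \<omega> + 3 * N / m\<^sup>2"
    using 2 m by (simp add: divide_right_mono)
  finally have 3: "0 \<le> (m\<^sup>2 * ip \<omega> \<omega> + 2 * ip \<xi> \<omega> + 3 * N / m\<^sup>2) / (m + 3)"
    using m by simp
  have "g - 2 * m * w + (N - 2 * m * z + 3 * m\<^sup>2 * w) / (m * (m + 3)) + (m\<^sup>2 * w + 2 * z + 3 * N / m\<^sup>2) / (m + 3)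
      = g + N / m\<^sup>2 - m * w" for g w z
  proof -
    define N' where "N' = N / m\<^sup>2"
    have N: "N = m\<^sup>2 * N'" using m by (simp add: N'_def)
    have "(m\<^sup>2 * N' - 2 * m * z + 3 * m\<^sup>2 * w) / (m * (m + 3)) = (m * N' - 2 * z + 3 * m * w) / (m + 3)"
    proof -
      have "m\<^sup>2 * N' - 2 * m * z + 3 * m\<^sup>2 * w = m * (m * N' - 2 * z + 3 * m * w)"
        by (simp add: power2_eq_square algebra_simps)
      then show ?thesis using m by simp
    qed
    then have "(m\<^sup>2 * N' - 2 * m * z + 3 * m\<^sup>2 * w) / (m * (m + 3)) + (m\<^sup>2 * w + 2 * z + 3 * N') / (m + 3)
        = ((m + 3) * (N' + m * w)) / (m + 3)"
      unfolding add_divide_distrib[symmetric] by (simp only:) (simp add: power2_eq_square algebra_simps flip: add_divide_distrib)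
    also have "\<dots> = N' + m * w" using m by simp
    finally show ?thesis
      using m unfolding N by simp
  qed
  then have "0 \<le> (\<Sum>i\<in>I. Gf i) + 2 * (\<Sum>i\<in>I. ip (W i) (X i)) + N / m\<^sup>2 - m * ip \<omega> \<omega>"
    using add_nonneg_nonneg[OF 1 3] by (simp only:)
  also have "\<dots> = (\<Sum>i\<in>I. Gf i + 2 * ip (W i) (X i) + ip (X i) (X i) / m\<^sup>2) - m * ip \<omega> \<omega>"
    by (simp only: sum.distrib sum_divide_distrib sum_distrib_left N_def)
  finally show ?thesis
    unfolding Gf_def m_def \<omega>_def .
qed

lemma avg_move:
  assumes C: "C \<subseteq> \<Omega>" and i: "i \<in> \<Omega>" "i \<notin> C" and j: "j \<in> \<Omega>" "j \<notin> C" and ij: "i \<noteq> j"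
    and inv: "invariant (insert i C) z"
  shows "(real (card C) + 2) *\<^sub>R avg (insert i (insert j C)) z = (real (card C) + 1) *\<^sub>R avg (insert j C) z + swap i j z"
proof -
  have "avg (insert i C) z = z"
    using avg_of_invariant[OF _ inv] C i by simp
  then show ?thesis
    using avg_pair[OF C i j ij invariant_subset[OF inv]] by auto
qed

lemma solve_scale:
  fixes a b :: 'v
  assumes "r *\<^sub>R a + b = 0" and r: "r \<noteq> 0"
  shows "a = - (1 / r) *\<^sub>R b"
proof -
  have "r *\<^sub>R a = - b"
    using assms(1) by (simp only: eq_neg_iff_add_eq_0)
  then have "(1 / r) *\<^sub>R (r *\<^sub>R a) = (1 / r) *\<^sub>R (- b)"
    by (simp only:)
  then show ?thesis using r by simp
qed

lemma swap_braid:
  assumes "a \<in> \<Omega>" "b \<in> \<Omega>" "c \<in> \<Omega>" "a \<noteq> b" "a \<noteq> c" "b \<noteq> c"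
  shows "swap b c (swap a b z) = swap a b (swap a c z)"
    and "swap b c (swap a b z) = swap a c (swap b c z)"
proof -
  have "Transposition.transpose b c \<circ> Transposition.transpose a b = Transposition.transpose a b \<circ> Transposition.transpose a c"
    "Transposition.transpose b c \<circ> Transposition.transpose a b = Transposition.transpose a c \<circ> Transposition.transpose b c"
    using assms by (auto simp: fun_eq_iff Transposition.transpose_def)
  then show "swap b c (swap a b z) = swap a b (swap a c z)" "swap b c (swap a b z) = swap a c (swap b c z)"
    using assms by (simp_all flip: act_comp[OF swap_permutes swap_permutes])
qed

text \<open>Word identities that move the vectors attached to the three sites \<open>x\<close>, \<open>y\<close>, \<open>z\<close> into a common block.\<close>

lemma swap_relation_4:
  assumes "h \<in> \<Omega>" "x \<in> \<Omega>" "y \<in> \<Omega>" "z \<in> \<Omega>" "distinct [h, x, y, z]"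
  shows "swap x z (swap h y (swap h z k)) = swap h x (swap x y (swap z x k))"
    and "swap h x (swap x y (swap z h k)) = swap y z (swap x z (swap y h k))"
proof -
  let ?t = Transposition.transpose
  have "?t x z \<circ> (?t h y \<circ> ?t h z) = ?t h x \<circ> (?t x y \<circ> ?t z x)"
    "?t h x \<circ> (?t x y \<circ> ?t z h) = ?t y z \<circ> (?t x z \<circ> ?t y h)"
    using assms by (auto simp: fun_eq_iff Transposition.transpose_def)
  then show "swap x z (swap h y (swap h z k)) = swap h x (swap x y (swap z x k))"
    "swap h x (swap x y (swap z h k)) = swap y z (swap x z (swap y h k))"
    using assms by (simp_all flip: act_comp add: swap_permutes permutes_compose)
qed

end

section \<open>Vectors attached to the points of a star\<close>

text \<open>The block \<open>B\<close> is the common part of all sets in the inequality, \<open>hub\<close> the additional point \<open>1\<close> and \<open>X\<close> the set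
of points by which the other sets exceed \<open>B\<close>.\<close>

locale star = perm_rep \<Omega> act ip
  for \<Omega> :: "'a set" and act :: "('a \<Rightarrow> 'a) \<Rightarrow> 'v::real_vector \<Rightarrow> 'v" and ip :: "'v \<Rightarrow> 'v \<Rightarrow> real" +
  fixes B :: "'a set" and hub :: 'a and X :: "'a set" and f :: 'v
  assumes B: "B \<subseteq> \<Omega>" "B \<noteq> {}" and hub: "hub \<in> \<Omega>" "hub \<notin> B" "hub \<notin> X" and X: "X \<subseteq> \<Omega>" "X \<inter> B = {}"
    and f: "invariant B f"
begin

text \<open>The vector \<open>f\<close> is split into its projection \<open>g\<close> to the invariants of \<open>insert hub B\<close> and the rest \<open>q\<close>. For
a site \<open>x\<close>, \<open>e x\<close> is what the projection of \<open>f\<close> to the invariants of \<open>insert x B\<close> retains beyond its hub-symmetric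
part \<open>\<eta> x\<close>, and \<open>u x\<close> is the same for the copy of \<open>g\<close> in which \<open>hub\<close> has been replaced by \<open>x\<close>. The vectors \<open>w x y\<close>
measure how the copies of \<open>g\<close> at two sites differ. The vectors \<open>e x\<close> and \<open>e y\<close> are compared by transposing the
sites; the multiple \<open>v x y\<close> of a part of \<open>w x y\<close> is normalized such that the corrected difference \<open>n x y\<close> has
average zero over both sites and is orthogonal to \<open>v x y\<close> (\<open>n_props\<close>).\<close>

definition m :: real where "m = real (card B) + 1"
definition p :: real where "p = m + 1"
definition g where "g = avg (insert hub B) f"
definition q where "q = f - g"
definition \<eta> where "\<eta> x = avg (insert hub (insert x B)) g"
definition e where "e x = avg (insert x B) f - \<eta> x"
definition u where "u x = swap x hub g - \<eta> x"
definition w where "w x y = avg (insert x (insert y B)) (swap x hub g - swap y hub g)"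
definition v where "v x y = (p / (m * (m + 2))) *\<^sub>R (w x y - avg (insert hub (insert x B)) (w x y))"
definition n where "n x y = e x - swap x y (e y) + v x y"

lemma finite_B: "finite B"
  using finite_block B by blast

lemma m_ge: "m \<ge> 2"
  using finite_B B(2) by (simp add: m_def Suc_le_eq card_gt_0_iff)

lemma p_ge: "p \<ge> 3"
  using m_ge by (simp add: p_def)

lemma pt: "x \<in> X \<Longrightarrow> x \<in> \<Omega>" "x \<in> X \<Longrightarrow> x \<notin> B" "x \<in> X \<Longrightarrow> x \<noteq> hub" "x \<in> X \<Longrightarrow> hub \<noteq> x"
  using X hub by auto

lemma sub: "insert hub B \<subseteq> \<Omega>" "x \<in> X \<Longrightarrow> insert x B \<subseteq> \<Omega>" "x \<in> X \<Longrightarrow> insert hub (insert x B) \<subseteq> \<Omega>"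
  "x \<in> X \<Longrightarrow> y \<in> X \<Longrightarrow> insert x (insert y B) \<subseteq> \<Omega>"
  "x \<in> X \<Longrightarrow> y \<in> X \<Longrightarrow> insert hub (insert x (insert y B)) \<subseteq> \<Omega>"
  "x \<in> X \<Longrightarrow> y \<in> X \<Longrightarrow> z \<in> X \<Longrightarrow> insert x (insert y (insert z B)) \<subseteq> \<Omega>"
  using B hub X by auto

lemma block_card: "x \<in> X \<Longrightarrow> real (card (insert x B)) = m" "real (card (insert hub B)) = m"
  "x \<in> X \<Longrightarrow> y \<in> X \<Longrightarrow> x \<noteq> y \<Longrightarrow> real (card (insert x (insert y B))) = p"
  "x \<in> X \<Longrightarrow> real (card (insert hub (insert x B))) = p"
  using finite_B hub pt by (auto simp: m_def p_def card_insert_if)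

lemma inv_g: "invariant (insert hub B) g"
  unfolding g_def by (rule avg_invariant[OF sub(1)])

lemma \<eta>_f: "x \<in> X \<Longrightarrow> \<eta> x = avg (insert hub (insert x B)) f"
  unfolding \<eta>_def g_def by (rule avg_avg_subset(1)[OF sub(3)]) auto

lemma inv_\<eta>: "x \<in> X \<Longrightarrow> invariant (insert hub (insert x B)) (\<eta> x)"
  unfolding \<eta>_def by (rule avg_invariant[OF sub(3)])

lemma avg_\<eta>: "x \<in> X \<Longrightarrow> avg (insert hub (insert x B)) (\<eta> x) = \<eta> x"
  by (rule avg_of_invariant[OF sub(3) inv_\<eta>])

lemma avg_hub_x:
  assumes x: "x \<in> X"
  shows "avg (insert hub (insert x B)) (avg (insert x B) z) = avg (insert hub (insert x B)) z"
    "avg (insert x B) (avg (insert hub (insert x B)) z) = avg (insert hub (insert x B)) z"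
  by (rule avg_avg_subset[OF sub(3)[OF x]], auto)+

lemma e_props:
  assumes x: "x \<in> X"
  shows "invariant (insert x B) (e x)" "avg (insert hub (insert x B)) (e x) = 0"
    "ip (e x) (e x) = ip (avg (insert x B) f) (avg (insert x B) f) - ip (\<eta> x) (\<eta> x)"
proof -
  show "invariant (insert x B) (e x)"
    unfolding e_def
    by (intro invariant_linear(2)[OF sub(2)[OF x]] avg_invariant[OF sub(2)[OF x]] invariant_subset[OF inv_\<eta>[OF x]]) auto
  show "avg (insert hub (insert x B)) (e x) = 0"
    unfolding e_def avg_linear[OF sub(3)[OF x]] avg_\<eta>[OF x] avg_hub_x[OF x] by (simp add: \<eta>_f[OF x])
  have "ip (avg (insert x B) f) (\<eta> x) = ip (\<eta> x) (\<eta> x)"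
    unfolding \<eta>_f[OF x] using ip_avg[OF sub(2)[OF x], of f] avg_hub_x(2)[OF x] ip_avg_avg[OF sub(3)[OF x]] by metis
  then show "ip (e x) (e x) = ip (avg (insert x B) f) (avg (insert x B) f) - ip (\<eta> x) (\<eta> x)"
    unfolding e_def by (simp add: ip_bilinear ip_sym[of "\<eta> x" "avg (insert x B) f"])
qed

lemma inv_swap_g:
  assumes x: "x \<in> X"
  shows "invariant (insert x B) (swap x hub g)"
  using invariant_swap_insert[OF B(1) hub(1,2) pt(1,2)[OF x] inv_g] by (simp add: transpose_commute)

lemma avg_swap_g: "x \<in> X \<Longrightarrow> avg (insert hub (insert x B)) (swap x hub g) = \<eta> x"
  unfolding \<eta>_def by (rule avg_act[OF sub(3)]) (auto intro: permutes_swap_id)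

lemma u_props:
  assumes x: "x \<in> X"
  shows "invariant (insert x B) (u x)" "avg (insert hub (insert x B)) (u x) = 0"
    "ip (u x) (u x) = ip g g - ip (\<eta> x) (\<eta> x)"
proof -
  show "invariant (insert x B) (u x)"
    unfolding u_def
    by (intro invariant_linear(2)[OF sub(2)[OF x]] inv_swap_g[OF x] invariant_subset[OF inv_\<eta>[OF x]]) auto
  show "avg (insert hub (insert x B)) (u x) = 0"
    unfolding u_def avg_linear[OF sub(3)[OF x]] avg_\<eta>[OF x] avg_swap_g[OF x] by simp
  have "ip (swap x hub g) (\<eta> x) = ip (\<eta> x) (\<eta> x)"
    using ip_avg[OF sub(3)[OF x], of "swap x hub g" "\<eta> x"] avg_swap_g[OF x] avg_\<eta>[OF x] by simp
  then show "ip (u x) (u x) = ip g g - ip (\<eta> x) (\<eta> x)"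
    unfolding u_def by (simp add: ip_bilinear ip_sym[of "\<eta> x" "swap x hub g"] ip_act swap_permutes hub pt x)
qed

lemma avg_q: "avg (insert hub B) q = 0"
  unfolding q_def g_def avg_linear[OF sub(1)] avg_idem[OF sub(1)] by simp

lemma ip_f: "ip f f = ip g g + ip q q"
  using ip_avg_avg[OF sub(1), of f] unfolding q_def g_def[symmetric]
  by (simp add: ip_bilinear ip_sym[of g f])

text \<open>The link between \<open>q\<close> and the sites: \<open>q\<close> is only known to have average zero over \<open>insert hub B\<close>, but its
averages over the other one-point extensions of \<open>B\<close> are \<open>e\<close> and \<open>u\<close>.\<close>

lemma avg_x_q:
  assumes x: "x \<in> X"
  shows "avg (insert x B) q = e x + (1 / m) *\<^sub>R u x"
proof -
  have "(real (card B) + 2) *\<^sub>R avg (insert hub (insert x B)) g = (real (card B) + 1) *\<^sub>R avg (insert x B) g + swap hub x g"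
    by (rule avg_move[OF B(1) hub(1,2) pt(1,2,4)[OF x] inv_g])
  then have "p *\<^sub>R \<eta> x = m *\<^sub>R avg (insert x B) g + swap x hub g"
    by (simp add: p_def m_def \<eta>_def transpose_commute add.assoc)
  then have "m *\<^sub>R (\<eta> x - avg (insert x B) g) = u x"
    by (simp add: u_def p_def algebra_simps)
  then have "\<eta> x - avg (insert x B) g = (1 / m) *\<^sub>R u x"
    using m_ge by (auto simp flip: \<open>m *\<^sub>R (\<eta> x - avg (insert x B) g) = u x\<close>)
  then show ?thesis
    by (simp add: q_def avg_linear[OF sub(2)[OF x]] e_def algebra_simps)
qed

lemma avg_hub_u:
  assumes x: "x \<in> X"
  shows "avg (insert hub B) (u x) = - (1 / m) *\<^sub>R swap x hub (u x)"
proof -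
  have "m *\<^sub>R avg (insert hub B) (u x) + swap x hub (u x) = 0"
    using avg_move[OF B(1) pt(1,2)[OF x] hub(1,2) pt(3)[OF x] u_props(1)[OF x]] u_props(2)[OF x]
    by (simp add: m_def insert_commute)
  then show ?thesis
    by (rule solve_scale) (use m_ge in simp)
qed

lemma avg_xy_g:
  assumes x: "x \<in> X" and y: "y \<in> X" and xy: "x \<noteq> y"
  shows "avg (insert x (insert y B)) (swap x hub g) = swap x hub (\<eta> y)"
    "avg (insert x (insert y B)) (swap y hub g) = swap y hub (\<eta> x)"
proof -
  have "swap hub x (avg (insert hub (insert y B)) g) = avg (insert x (insert y B)) (swap hub x g)"
    by (rule swap_avg) (use sub(2)[OF y] hub pt[OF x] pt[OF y] xy in auto)
  then show "avg (insert x (insert y B)) (swap x hub g) = swap x hub (\<eta> y)"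
    by (simp add: \<eta>_def transpose_commute)
  have "swap hub y (avg (insert hub (insert x B)) g) = avg (insert y (insert x B)) (swap hub y g)"
    by (rule swap_avg) (use sub(2)[OF x] hub pt[OF x] pt[OF y] xy in auto)
  then show "avg (insert x (insert y B)) (swap y hub g) = swap y hub (\<eta> x)"
    by (simp add: \<eta>_def transpose_commute insert_commute)
qed

lemma w_eq: "x \<in> X \<Longrightarrow> y \<in> X \<Longrightarrow> x \<noteq> y \<Longrightarrow> w x y = swap x hub (\<eta> y) - swap y hub (\<eta> x)"
  unfolding w_def by (simp add: avg_linear[OF sub(4)] avg_xy_g)

lemma w_props:
  assumes x: "x \<in> X" and y: "y \<in> X"
  shows "invariant (insert x (insert y B)) (w x y)" "w y x = - w x y" "swap x y (w x y) = w x y" "w x x = 0"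
    "avg (insert x (insert y B)) (w x y) = w x y" "avg (insert hub (insert x (insert y B))) (w x y) = 0"
proof -
  show inv: "invariant (insert x (insert y B)) (w x y)"
    unfolding w_def by (rule avg_invariant[OF sub(4)[OF x y]])
  show "w y x = - w x y"
    unfolding w_def using sub(4)[OF x y] avg_linear(4)[OF sub(4)[OF x y], of "swap x hub g - swap y hub g"]
    by (simp add: insert_commute)
  show "swap x y (w x y) = w x y"
    by (rule invariant_swap[OF inv]) auto
  show "w x x = 0"
    unfolding w_def using avg_linear(5)[OF sub(4)[OF x x]] by simp
  show "avg (insert x (insert y B)) (w x y) = w x y"
    by (rule avg_of_invariant[OF sub(4)[OF x y] inv])
  have "avg (insert hub (insert x (insert y B))) (swap x hub g) = avg (insert hub (insert x (insert y B))) g"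
    "avg (insert hub (insert x (insert y B))) (swap y hub g) = avg (insert hub (insert x (insert y B))) g"
    by (rule avg_act[OF sub(5)[OF x y]], auto intro: permutes_swap_id)+
  moreover have "avg (insert hub (insert x (insert y B))) (w x y) = avg (insert hub (insert x (insert y B))) (swap x hub g - swap y hub g)"
    unfolding w_def by (rule avg_avg_subset(1)[OF sub(5)[OF x y]]) auto
  ultimately show "avg (insert hub (insert x (insert y B))) (w x y) = 0"
    by (simp add: avg_linear[OF sub(5)[OF x y]])
qed

text \<open>The average over \<open>insert hub (insert x (insert y B))\<close> kills \<open>w x y\<close>, so in the coset expansion of that average the
remaining terms cancel against the transposition of \<open>hub\<close> and \<open>y\<close>.\<close>

lemma avg_hub_x_w:
  assumes x: "x \<in> X" and y: "y \<in> X" and xy: "x \<noteq> y"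
  shows "avg (insert hub (insert x B)) (w x y) = - (1 / p) *\<^sub>R swap hub y (w x y)"
proof -
  have *: "(real (card (insert x B)) + 2) *\<^sub>R avg (insert y (insert hub (insert x B))) (w x y)
      = (real (card (insert x B)) + 1) *\<^sub>R avg (insert hub (insert x B)) (w x y) + swap y hub (w x y)"
    by (rule avg_move[OF sub(2)[OF x]]) (use w_props(1)[OF x y] hub pt[OF x] pt[OF y] xy in \<open>auto simp: insert_commute\<close>)
  have "avg (insert y (insert hub (insert x B))) (w x y) = 0"
    using w_props(6)[OF x y] by (simp add: insert_commute)
  then have "p *\<^sub>R avg (insert hub (insert x B)) (w x y) + swap hub y (w x y) = 0"
    using * by (simp add: block_card(1)[OF x] p_def transpose_commute)
  then show ?thesis
    by (rule solve_scale) (use p_ge in simp)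
qed

lemma avg_xy_swap_w:
  assumes x: "x \<in> X" and y: "y \<in> X" and xy: "x \<noteq> y"
  shows "avg (insert x (insert y B)) (avg (insert hub (insert x B)) (w x y)) = (1 / p\<^sup>2) *\<^sub>R w x y"
proof -
  have "avg (insert y (insert x B)) (swap hub y (w x y)) = swap hub y (avg (insert hub (insert x B)) (w x y))"
    by (rule swap_avg[symmetric]) (use sub(2)[OF x] hub pt[OF x] pt[OF y] xy in auto)
  also have "\<dots> = - (1 / p) *\<^sub>R w x y"
    by (simp add: avg_hub_x_w[OF x y xy] swap_linear swap_swap hub pt y)
  finally show ?thesis
    unfolding avg_hub_x_w[OF x y xy] using sub(4)[OF x y]
    by (simp add: avg_linear insert_commute power2_eq_square)
qed

lemma v_props:
  assumes x: "x \<in> X" and y: "y \<in> X"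
  shows "invariant (insert x B) (v x y)" "avg (insert hub (insert x B)) (v x y) = 0" "v x x = 0"
    "ip (v x y) (v x y) = ip (w x y) (w x y) / (m * (m + 2))"
    "swap x y (v x y) = - v y x"
    "avg (insert x (insert y B)) (v x y) = (1 / p) *\<^sub>R w x y"
proof -
  have "0 < m * (m + 2)"
    using m_ge by (intro mult_pos_pos) auto
  moreover have "m * (m + 2) = p\<^sup>2 - 1"
    by (simp add: p_def power2_eq_square algebra_simps)
  ultimately have mm: "m * (m + 2) \<noteq> 0" "m * (m + 2) = p\<^sup>2 - 1"
    by linarith+
  show "invariant (insert x B) (v x y)"
    unfolding v_def
    by (intro invariant_linear(2,3)[OF sub(2)[OF x]] invariant_subset[OF w_props(1)[OF x y]]
        invariant_subset[OF avg_invariant[OF sub(3)[OF x]]]) auto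
  show "avg (insert hub (insert x B)) (v x y) = 0"
    unfolding v_def avg_linear[OF sub(3)[OF x]] avg_idem[OF sub(3)[OF x]] by simp
  show vxx: "v x x = 0"
    unfolding v_def w_props(4)[OF x x] avg_linear(5)[OF sub(3)[OF x]] by simp
  show "ip (v x y) (v x y) = ip (w x y) (w x y) / (m * (m + 2))"
  proof (cases "x = y")
    case True
    then show ?thesis using vxx w_props(4)[OF x x] by (simp add: ip_zero_left)
  next
    case False
    define a where "a = avg (insert hub (insert x B)) (w x y)"
    have "ip a a = ip (w x y) (w x y) / p\<^sup>2"
      unfolding a_def avg_hub_x_w[OF x y False] using pt[OF y] hub
      by (simp add: ip_bilinear ip_act swap_permutes power2_eq_square)
    moreover have "ip (w x y) a = ip a a"
      unfolding a_def by (rule ip_avg_avg[OF sub(3)[OF x], symmetric])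
    ultimately have "ip (w x y - a) (w x y - a) = (m * (m + 2)) / p\<^sup>2 * ip (w x y) (w x y)"
      using p_ge by (simp add: mm(2) ip_bilinear ip_sym[of a "w x y"] field_simps)
    then show ?thesis
      unfolding v_def a_def[symmetric] using mm(1) p_ge by (simp add: ip_scale_left ip_scale_right power2_eq_square)
  qed
  show "swap x y (v x y) = - v y x"
  proof (cases "x = y")
    case True
    then show ?thesis using vxx by (simp add: act_id)
  next
    case False
    have "swap x y (avg (insert x (insert hub B)) (w x y)) = avg (insert y (insert hub B)) (swap x y (w x y))"
      by (rule swap_avg) (use sub hub pt[OF x] pt[OF y] in auto)
    then have "swap x y (avg (insert hub (insert x B)) (w x y)) = avg (insert hub (insert y B)) (w x y)"
      by (simp add: insert_commute w_props(3)[OF x y])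
    then show ?thesis
      unfolding v_def w_props(2)[OF x y] using pt[OF x] pt[OF y]
      by (simp add: swap_linear w_props(3)[OF x y] avg_linear[OF sub(3)[OF y]] algebra_simps)
  qed
  show "avg (insert x (insert y B)) (v x y) = (1 / p) *\<^sub>R w x y"
  proof (cases "x = y")
    case True
    then show ?thesis using vxx avg_linear(5)[OF sub(4)[OF x x]] w_props(4)[OF x x] by simp
  next
    case False
    have "avg (insert x (insert y B)) (v x y) = (p / (m * (m + 2)) * (1 - 1 / p\<^sup>2)) *\<^sub>R w x y"
    proof -
      have "r *\<^sub>R (a - k *\<^sub>R a) = (r * (1 - k)) *\<^sub>R a" for r k and a :: 'v
        by (simp add: algebra_simps)
      then show ?thesis
        unfolding v_def avg_linear[OF sub(4)[OF x y]] avg_xy_swap_w[OF x y False] w_props(5)[OF x y] by blast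
    qed
    also have "p / (m * (m + 2)) * (1 - 1 / p\<^sup>2) = 1 / p"
      using p_ge mm(1) unfolding mm(2) by (simp add: field_simps power2_eq_square)
    finally show ?thesis .
  qed
qed

lemma avg_xy_u:
  assumes x: "x \<in> X" and y: "y \<in> X" and xy: "x \<noteq> y"
  shows "p *\<^sub>R avg (insert x (insert y B)) (u x)
    = p *\<^sub>R swap x hub (\<eta> y) + swap y hub (\<eta> x) - (m + 2) *\<^sub>R avg (insert hub (insert x (insert y B))) g"
proof -
  let ?h = "avg (insert hub (insert x (insert y B)))"
  have "(real (card (insert x B)) + 2) *\<^sub>R avg (insert hub (insert y (insert x B))) (\<eta> x)
      = (real (card (insert x B)) + 1) *\<^sub>R avg (insert y (insert x B)) (\<eta> x) + swap hub y (\<eta> x)"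
    by (rule avg_move[OF sub(2)[OF x]]) (use inv_\<eta>[OF x] hub pt[OF x] pt[OF y] xy in auto)
  moreover have "?h (\<eta> x) = ?h g"
    unfolding \<eta>_def by (rule avg_avg_subset(1)[OF sub(5)[OF x y]]) auto
  ultimately have "p *\<^sub>R avg (insert x (insert y B)) (\<eta> x) = (m + 2) *\<^sub>R ?h g - swap y hub (\<eta> x)"
    by (simp add: block_card(1)[OF x] p_def insert_commute transpose_commute)
  then show ?thesis
    unfolding u_def avg_linear[OF sub(4)[OF x y]] avg_xy_g[OF x y xy]
    by (simp add: algebra_simps)
qed

lemma avg_xy_u_diff:
  assumes x: "x \<in> X" and y: "y \<in> X"
  shows "avg (insert x (insert y B)) (u x - u y) = (m / p) *\<^sub>R w x y"
proof (cases "x = y")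
  case True
  then show ?thesis using avg_linear(5)[OF sub(4)[OF x x]] w_props(4)[OF x x] by simp
next
  case False
  have "p *\<^sub>R avg (insert x (insert y B)) (u x - u y) = m *\<^sub>R w x y"
  proof -
    let ?h = "avg (insert hub (insert x (insert y B))) g"
    have "p *\<^sub>R avg (insert x (insert y B)) (u y) = p *\<^sub>R swap y hub (\<eta> x) + swap x hub (\<eta> y) - (m + 2) *\<^sub>R ?h"
      using avg_xy_u[OF y x] False by (simp add: insert_commute)
    then have "p *\<^sub>R avg (insert x (insert y B)) (u x - u y) =
        (p *\<^sub>R swap x hub (\<eta> y) + swap y hub (\<eta> x) - (m + 2) *\<^sub>R ?h)
        - (p *\<^sub>R swap y hub (\<eta> x) + swap x hub (\<eta> y) - (m + 2) *\<^sub>R ?h)"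
      using avg_xy_u[OF x y False] by (simp only: avg_linear[OF sub(4)[OF x y]] scaleR_diff_right)
    also have "\<dots> = m *\<^sub>R w x y"
      by (simp add: w_eq[OF x y False] p_def algebra_simps)
    finally show ?thesis .
  qed
  then have "(1 / p) *\<^sub>R (p *\<^sub>R avg (insert x (insert y B)) (u x - u y)) = (1 / p) *\<^sub>R (m *\<^sub>R w x y)"
    by simp
  then show ?thesis using p_ge by simp
qed

lemma swap_move_props:
  assumes x: "x \<in> X" and y: "y \<in> X"
  shows "invariant (insert y B) z \<Longrightarrow> invariant (insert x B) (swap x y z)"
    "avg (insert hub (insert x B)) (swap x y z) = swap x y (avg (insert hub (insert y B)) z)"
    "avg (insert x (insert y B)) (swap x y z) = avg (insert x (insert y B)) z"
proof -
  show "invariant (insert x B) (swap x y z)" if "invariant (insert y B) z"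
    using invariant_swap_insert[OF B(1) pt(1,2)[OF y] pt(1,2)[OF x] that] by (simp add: transpose_commute)
  have "swap y x (avg (insert y (insert hub B)) z) = avg (insert x (insert hub B)) (swap y x z)"
    by (rule swap_avg) (use sub hub pt[OF x] pt[OF y] in auto)
  then show "avg (insert hub (insert x B)) (swap x y z) = swap x y (avg (insert hub (insert y B)) z)"
    by (simp add: insert_commute transpose_commute)
  show "avg (insert x (insert y B)) (swap x y z) = avg (insert x (insert y B)) z"
    by (rule avg_act[OF sub(4)[OF x y]]) (auto intro: permutes_swap_id)
qed

text \<open>The average over both sites vanishes because \<open>e x - e y\<close> differs from the averages of the single vector \<open>q\<close> over
\<open>insert x B\<close> and \<open>insert y B\<close> by a multiple of \<open>u x - u y\<close>, whose average is a multiple of \<open>w x y\<close>; this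
is what fixes the factor in the definition of \<open>v\<close>.\<close>

lemma n_props:
  assumes x: "x \<in> X" and y: "y \<in> X"
  shows "invariant (insert x B) (n x y)" "avg (insert hub (insert x B)) (n x y) = 0" "n x x = 0"
    "swap x y (n x y) = - n y x" "avg (insert x (insert y B)) (n x y) = 0"
    "ip (v x y) (n x y) = 0"
    "ip (w x y) (n x y) = 0"
proof -
  show "invariant (insert x B) (n x y)"
    unfolding n_def
    by (intro invariant_linear(1,2)[OF sub(2)[OF x]] e_props(1)[OF x] v_props(1)[OF x y]
        swap_move_props(1)[OF x y] e_props(1)[OF y])
  show kill: "avg (insert hub (insert x B)) (n x y) = 0"
    unfolding n_def avg_linear[OF sub(3)[OF x]] swap_move_props(2)[OF x y] e_props(2)[OF x] e_props(2)[OF y] v_props(2)[OF x y]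
    using pt[OF x] pt[OF y] by (simp add: swap_linear)
  show "n x x = 0"
    unfolding n_def by (simp add: act_id v_props(3)[OF x x])
  show "swap x y (n x y) = - n y x"
    unfolding n_def using pt[OF x] pt[OF y]
    by (simp add: swap_linear swap_swap v_props(5)[OF x y] swap_commute[of y x])
  have "avg (insert x (insert y B)) (e x) - avg (insert x (insert y B)) (e y) = - (1 / p) *\<^sub>R w x y"
  proof -
    have q: "avg (insert x (insert y B)) (avg (insert x B) q) = avg (insert x (insert y B)) q"
      "avg (insert x (insert y B)) (avg (insert y B) q) = avg (insert x (insert y B)) q"
      by (rule avg_avg_subset(1)[OF sub(4)[OF x y]], auto)+
    have "e x - e y = avg (insert x B) q - avg (insert y B) q - (1 / m) *\<^sub>R (u x - u y)"
      using avg_x_q[OF x] avg_x_q[OF y] by (simp add: algebra_simps)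
    then have "avg (insert x (insert y B)) (e x - e y) = - (1 / m) *\<^sub>R ((m / p) *\<^sub>R w x y)"
      by (simp only: avg_linear[OF sub(4)[OF x y]] q avg_xy_u_diff[OF x y, unfolded avg_linear[OF sub(4)[OF x y]]]) simp
    then show ?thesis
      using m_ge by (simp add: avg_linear[OF sub(4)[OF x y]])
  qed
  then show kill2: "avg (insert x (insert y B)) (n x y) = 0"
    unfolding n_def avg_linear[OF sub(4)[OF x y]] swap_move_props(3)[OF x y] v_props(6)[OF x y] by simp
  show wn: "ip (w x y) (n x y) = 0"
    using ip_avg[OF sub(4)[OF x y], of "w x y" "n x y"] by (simp add: w_props(5)[OF x y] kill2 ip_zero_right)
  show "ip (v x y) (n x y) = 0"
    using ip_avg[OF sub(3)[OF x], of "w x y" "n x y"] unfolding v_def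
    by (simp add: ip_bilinear wn kill)
qed

lemma e_diff: "e x - swap x y (e y) = n x y - v x y"
  by (simp add: n_def)

lemma e_diff_norm:
  assumes x: "x \<in> X" and y: "y \<in> X"
  shows "ip (e x - swap x y (e y)) (e x - swap x y (e y)) = ip (n x y) (n x y) + ip (v x y) (v x y)"
  unfolding e_diff by (simp add: ip_bilinear n_props(6)[OF x y] ip_sym[of "n x y" "v x y"])

text \<open>Since \<open>v\<close> and \<open>n\<close> are odd under exchange of the sites, only the odd part of a family of vectors is seen by them.
This yields the diagonal values of the double sums of \<open>e\<close> and \<open>u\<close> against \<open>v\<close> and \<open>n\<close>.\<close>

lemma pair_sum:
  assumes x: "x \<in> X" and y: "y \<in> X" and k: "swap x y k = - k'"
  shows "ip z k + ip z' k' = ip (z - swap x y z') k"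
  using ip_swap[OF pt(1)[OF x] pt(1)[OF y], of z' k] by (simp add: k ip_bilinear)

lemma e_v: "x \<in> X \<Longrightarrow> y \<in> X \<Longrightarrow> ip (e x) (v x y) + ip (e y) (v y x) = - ip (v x y) (v x y)"
  by (subst pair_sum[OF _ _ v_props(5)])
    (simp_all only: e_diff, simp add: ip_diff_left n_props(6) ip_sym[of "n x y" "v x y"])

lemma e_n: "x \<in> X \<Longrightarrow> y \<in> X \<Longrightarrow> ip (e x) (n x y) + ip (e y) (n y x) = ip (n x y) (n x y)"
  by (subst pair_sum[OF _ _ n_props(4)]) (simp_all only: e_diff, simp add: ip_diff_left n_props(6))

lemma u_v:
  assumes x: "x \<in> X" and y: "y \<in> X"
  shows "ip (u x) (v x y) + ip (u y) (v y x) = m * ip (v x y) (v x y)"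
proof -
  let ?s = "u x - swap x y (u y)"
  have kill: "avg (insert hub (insert x B)) ?s = 0"
    unfolding avg_linear[OF sub(3)[OF x]] swap_move_props(2)[OF x y] u_props(2)[OF x] u_props(2)[OF y]
    using pt[OF x] pt[OF y] by (simp add: swap_linear)
  have "ip ?s (v x y) = (p / (m * (m + 2))) * ip ?s (w x y)"
    using ip_avg[OF sub(3)[OF x], of ?s "w x y"] kill by (simp add: v_def ip_scale_right ip_diff_right ip_zero_left)
  also have "ip ?s (w x y) = ip (avg (insert x (insert y B)) ?s) (w x y)"
    by (simp add: ip_avg[OF sub(4)[OF x y]] w_props(5)[OF x y])
  also have "avg (insert x (insert y B)) ?s = (m / p) *\<^sub>R w x y"
    using avg_xy_u_diff[OF x y] by (simp add: avg_linear[OF sub(4)[OF x y]] swap_move_props(3)[OF x y])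
  finally show ?thesis
    using m_ge p_ge by (subst pair_sum[OF x y v_props(5)[OF x y]]) (simp add: v_props(4)[OF x y] ip_scale_left)
qed

lemma u_n: "x \<in> X \<Longrightarrow> y \<in> X \<Longrightarrow> ip (u x) (n x y) + ip (u y) (n y x) = ip (u x - swap x y (u y)) (n x y)"
  by (rule pair_sum[OF _ _ n_props(4)])

lemma \<eta>_diff_norm:
  assumes x: "x \<in> X" and y: "y \<in> X" 
  shows "ip (\<eta> x - swap x y (\<eta> y)) (\<eta> x - swap x y (\<eta> y)) = ip (w x y) (w x y)"
proof (cases "x = y")
  case True
  then show ?thesis using w_props(4)[OF x x] by (simp add: act_id)
next
  case False
  have "swap y hub (swap x y (\<eta> y)) = swap x y (swap x hub (\<eta> y))"
    by (rule swap_braid(1)) (use pt[OF x] pt[OF y] hub False in auto)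
  also have "\<dots> = swap x hub (\<eta> y)"
    unfolding avg_xy_g(1)[OF x y False, symmetric]
    by (rule invariant_swap[OF avg_invariant[OF sub(4)[OF x y]]]) auto
  finally have "swap y hub (\<eta> x - swap x y (\<eta> y)) = - w x y"
    using pt[OF y] hub by (simp add: swap_linear w_eq[OF x y False])
  then have "ip (\<eta> x - swap x y (\<eta> y)) (\<eta> x - swap x y (\<eta> y)) = ip (- w x y) (- w x y)"
    using ip_act[OF swap_permutes[OF pt(1)[OF y] hub(1)]] by metis
  then show ?thesis by (simp add: ip_bilinear)
qed

end

section \<open>The form of a pair of sites\<close>

text \<open>Here \<open>G\<close>, \<open>Y\<close>, \<open>K\<close>, \<open>H\<close> are the numbers \<open>ip x x\<close>, \<open>ip x (swap i j x)\<close>, \<open>ip u (swap i j x)\<close>, \<open>ip h h\<close> of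
\<open>pair_gram\<close>, and \<open>E\<close> is \<open>ip u u + ip v v\<close>, for the block \<open>insert hub B\<close>, the vector \<open>g\<close> and the
points \<open>x\<close>, \<open>y\<close>. The two brackets on the right are the slacks of the two bounds in \<open>pair_bounds\<close>.\<close>

lemma pair_form_identity:
  fixes m p G Y E K H U \<theta> a v2 s2 :: real
  assumes m: "m \<ge> 2" and p: "p = m + 1"
    and a: "p * a = (p + 1) * H - K"
    and \<theta>: "p * (m * \<theta>) + p * (Y - K) = (p\<^sup>2 + 1) * K + p * E - (m + 2)\<^sup>2 * H"
    and U: "U = \<theta> - (G - E + a) / m\<^sup>2"
    and v2: "v2 = (E - 2 * K) / (m * (m + 2))" and s2: "s2 = 2 * G - E - 2 * (Y - K)"
  shows "(m / p) * v2 - s2 / (m * p) + (p / m) * (2 * G - E) - p * m * v2 - (2 * m / (m - 1)) * U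
    = (1 / (m * (m - 1))) * (p * (m * (G + Y - 2 * H) - p * (E + 2 * K - 4 * H)))
      + ((m - 1) / (m * p)) * ((m + 2) * (G - Y) - p * (E - 2 * K))"
proof -
  have mp: "m * p \<noteq> 0" "m \<noteq> 0" "p \<noteq> 0" "m + 2 \<noteq> 0" "m - 1 \<noteq> 0" using m p by auto
  have a': "a = ((p + 1) * H - K) / p" using a mp by (simp add: field_simps)
  have t': "\<theta> = ((p\<^sup>2 + 1) * K + p * E - (m + 2)\<^sup>2 * H - p * (Y - K)) / (p * m)" using \<theta> mp by (simp add: field_simps)
  show ?thesis
    unfolding U a' t' v2 s2 p using mp unfolding p
    by (simp add: divide_simps) (simp add: algebra_simps power2_eq_square)
qed

context star begin

lemma ip_avg_hub_u:
  assumes x: "x \<in> X" and y: "y \<in> X"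
  shows "ip (u x - avg (insert hub B) (u x)) (u y - avg (insert hub B) (u y))
    = ip (u x) (u y) - ip (g - \<eta> x) (g - \<eta> y) / m\<^sup>2"
proof -
  have s: "swap x hub (u x) = g - \<eta> x" if "x \<in> X" for x
  proof -
    have "swap x hub (\<eta> x) = \<eta> x"
      by (rule invariant_swap[OF inv_\<eta>[OF that]]) auto
    then show ?thesis
      using pt[OF that] hub by (simp add: u_def swap_linear swap_swap)
  qed
  have "ip (u x) (avg (insert hub B) (u y)) = ip (avg (insert hub B) (u x)) (avg (insert hub B) (u y))"
    using ip_avg[OF sub(1), of "u x" "avg (insert hub B) (u y)"] avg_idem[OF sub(1), of "u y"] by simp
  moreover have "ip (avg (insert hub B) (u x)) (u y) = ip (avg (insert hub B) (u x)) (avg (insert hub B) (u y))"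
    using ip_avg[OF sub(1), of "avg (insert hub B) (u x)" "u y"] avg_idem[OF sub(1), of "u x"] by simp
  ultimately have "ip (u x - avg (insert hub B) (u x)) (u y - avg (insert hub B) (u y))
      = ip (u x) (u y) - ip (avg (insert hub B) (u x)) (avg (insert hub B) (u y))"
    by (simp add: ip_diff_left ip_diff_right)
  then show ?thesis
    unfolding avg_hub_u[OF x] avg_hub_u[OF y] s[OF x] s[OF y]
    by (simp add: ip_scale_left ip_scale_right ip_minus_left ip_minus_right power2_eq_square)
qed

lemma swap_\<eta>:
  assumes x: "x \<in> X" and y: "y \<in> X"
  shows "swap x y (\<eta> y) = avg (insert hub (insert x B)) (swap x y g)"
  unfolding \<eta>_def by (rule swap_move_props(2)[OF x y, symmetric])

lemma ip_u_swap_u: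
  assumes x: "x \<in> X" and y: "y \<in> X" and xy: "x \<noteq> y"
  shows "ip (u x) (swap x y (u y)) = ip g (swap x y g) - ip (\<eta> x) (swap x y g)"
proof -
  have K1: "ip (swap x hub g) (swap x y (\<eta> y)) = ip (\<eta> x) (swap x y g)"
    unfolding swap_\<eta>[OF x y] by (simp add: ip_avg[OF sub(3)[OF x], symmetric] avg_swap_g[OF x])
  have K2: "ip (\<eta> x) (swap x y (\<eta> y)) = ip (\<eta> x) (swap x y g)"
    unfolding swap_\<eta>[OF x y] by (simp add: ip_avg[OF sub(3)[OF x], symmetric] avg_\<eta>[OF x])
  have "swap y x (\<eta> x) = avg (insert hub (insert y B)) (swap y x g)"
    by (rule swap_\<eta>[OF y x])
  then have "ip (\<eta> x) (swap x y (swap y hub g)) = ip (avg (insert hub (insert y B)) (swap x y g)) (swap y hub g)"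
    using ip_swap[OF pt(1)[OF x] pt(1)[OF y], of "\<eta> x" "swap y hub g"] by (simp add: swap_commute[of y x])
  also have "\<dots> = ip (swap x y g) (\<eta> y)"
    by (simp add: ip_avg[OF sub(3)[OF y]] avg_swap_g[OF y])
  also have "\<dots> = ip g (swap x y (\<eta> y))"
    by (rule ip_swap[OF pt(1)[OF x] pt(1)[OF y]])
  also have "\<dots> = ip g (avg (insert hub (insert x B)) (swap x y g))"
    by (simp only: swap_\<eta>[OF x y])
  also have "\<dots> = ip (\<eta> x) (swap x y g)"
    unfolding \<eta>_def by (rule ip_avg[OF sub(3)[OF x], symmetric])
  finally have K3: "ip (\<eta> x) (swap x y (swap y hub g)) = ip (\<eta> x) (swap x y g)" .
  have "swap x y (swap y hub g) = swap x hub (swap x y g)"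
    using swap_braid(1)[of x y hub g] swap_braid(2)[of y x hub g] pt[OF x] pt[OF y] hub xy
    by (metis swap_braid swap_commute)
  then have "ip (swap x hub g) (swap x y (swap y hub g)) = ip g (swap x y g)"
    using pt[OF x] hub by (simp add: ip_act swap_permutes)
  then show ?thesis
    unfolding u_def using pt[OF x] pt[OF y] by (simp add: swap_linear ip_bilinear K1 K2 K3)
qed

text \<open>The part that contains \<open>n x y\<close> is completed to the square of \<open>n - v + s / m\<close>, where \<open>s\<close> is the odd part of
\<open>u\<close>. The rest depends on \<open>g\<close> only and is nonnegative by \<open>pair_form_identity\<close>. For \<open>x = y\<close> the form is zero.\<close>

lemma pair_form_nonneg:
  assumes x: "x \<in> X" and y: "y \<in> X"
  shows "0 \<le> (p / m) * (ip (u x) (u x) + ip (u y) (u y)) - p * m * ip (v x y) (v x y)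
    + (m / p) * ip (n x y) (n x y) + (2 / p) * ip (u x - swap x y (u y)) (n x y)
    - (2 * m / (m - 1)) * ip (u x - avg (insert hub B) (u x)) (u y - avg (insert hub B) (u y))"
proof (cases "x = y")
  case True
  have id: "(2 * m / (m - 1)) * (a - a / m\<^sup>2) = (2 * p / m) * a" for a
  proof -
    have "a - a / m\<^sup>2 = (m - 1) * (p * a) / m\<^sup>2"
      using m_ge by (simp add: p_def field_simps power2_eq_square)
    then show ?thesis
      using m_ge by (simp add: power2_eq_square)
  qed
  have "ip (g - \<eta> x) (g - \<eta> x) = ip (u x) (u x)"
    using ip_avg_avg[OF sub(3)[OF x], of g] unfolding u_props(3)[OF x] \<eta>_def[symmetric]
    by (simp add: ip_bilinear ip_sym[of g "\<eta> x"])
  then have "(2 * m / (m - 1)) * (ip (u x) (u x) - ip (g - \<eta> x) (g - \<eta> x) / m\<^sup>2) = (2 * p / m) * ip (u x) (u x)"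
    by (simp only: id)
  then show ?thesis
    using True v_props(3)[OF x x] n_props(3)[OF x x]
    by (simp add: ip_avg_hub_u[OF y y] ip_zero_left ip_zero_right mult.assoc mult.left_commute)
next
  case False
  define h where "h = avg (insert x (insert y (insert hub B))) g"
  define G Y K H E where "G = ip g g" and "Y = ip g (swap x y g)" and "K = ip (\<eta> x) (swap x y g)"
    and "H = ip h h" and "E = ip (\<eta> x) (\<eta> x) + ip (\<eta> y) (\<eta> y)"
  have \<eta>: "avg (insert x (insert hub B)) g = \<eta> x" "avg (insert y (insert hub B)) g = \<eta> y"
    by (simp_all add: \<eta>_def insert_commute)
  have C: "insert hub B \<subseteq> \<Omega>" "x \<in> \<Omega>" "x \<notin> insert hub B" "y \<in> \<Omega>" "y \<notin> insert hub B" "insert hub B \<noteq> {}"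
    using sub pt[OF x] pt[OF y] by auto
  have pm: "m + 1 = p" "m + 2 = p + 1"
    by (simp_all add: p_def)
  note gram = pair_gram[OF C(1-5) False inv_g, unfolded block_card pm \<eta>, folded h_def]
  note gram' = pair_gram[OF C(1,4,5,2,3) False[symmetric] inv_g, unfolded block_card pm \<eta>]
  note bnd = pair_bounds[OF C(1-5) False inv_g, unfolded block_card pm \<eta>, folded h_def]
  have h': "avg (insert y (insert x (insert hub B))) g = h" "avg (insert hub (insert x (insert y B))) g = h"
    by (simp_all add: h_def insert_commute)
  have Zm: "0 \<le> (m + 2) * (G - Y) - p * (E - 2 * K)"
    using bnd(1) by (simp add: G_def Y_def K_def E_def p_def add.commute)
  have Zp: "0 \<le> m * (G + Y - 2 * H) - p * (E + 2 * K - 4 * H)"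
    using bnd(2)[OF C(6)] by (simp add: G_def Y_def K_def E_def H_def p_def)
  have ww: "ip (w x y) (w x y) = E - 2 * K"
    using gram(4) unfolding \<eta>_diff_norm[OF x y, symmetric]
    by (simp add: ip_diff_left ip_diff_right ip_sym[of "swap x y (\<eta> y)" "\<eta> x"] E_def K_def ip_act swap_permutes C)
  have v2: "ip (v x y) (v x y) = (E - 2 * K) / (m * (m + 2))"
    by (simp add: v_props(4)[OF x y] ww)
  define s where "s = u x - swap x y (u y)"
  have uu: "ip (u x) (u x) + ip (u y) (u y) = 2 * G - E"
    by (simp add: u_props(3)[OF x] u_props(3)[OF y] G_def E_def)
  have us: "ip (u x) (swap x y (u y)) = Y - K"
    by (simp add: ip_u_swap_u[OF x y False] Y_def K_def)
  have s2: "ip s s = 2 * G - E - 2 * (Y - K)"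
    using uu us unfolding s_def
    by (simp add: ip_diff_left ip_diff_right ip_sym[of "swap x y (u y)" "u x"] ip_act swap_permutes C)
  define \<alpha> \<beta> where "\<alpha> = swap x hub (\<eta> y)" and "\<beta> = swap y hub (\<eta> x)"
  have \<alpha>\<alpha>: "ip \<alpha> \<alpha> = ip (\<eta> y) (\<eta> y)" "ip \<beta> \<beta> = ip (\<eta> x) (\<eta> x)"
    by (simp_all add: \<alpha>_def \<beta>_def ip_act swap_permutes C hub)
  have \<alpha>\<beta>: "ip \<alpha> \<beta> = K"
    using ww \<alpha>\<alpha> unfolding w_eq[OF x y False] \<alpha>_def[symmetric] \<beta>_def[symmetric]
    by (simp add: ip_diff_left ip_diff_right ip_sym[of \<beta> \<alpha>] E_def)
  have hs: "swap x hub h = h" "swap y hub h = h"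
  proof -
    have "invariant (insert x (insert y (insert hub B))) h"
      unfolding h_def by (rule avg_invariant) (use C in auto)
    then show "swap x hub h = h" "swap y hub h = h"
      by (auto intro: invariant_swap)
  qed
  have \<alpha>h: "ip \<alpha> h = H" "ip \<beta> h = H"
    using ip_swap[OF C(2) hub(1), of "\<eta> y" h] ip_swap[OF C(4) hub(1), of "\<eta> x" h] gram(7) gram'(7)
    unfolding h' by (simp_all add: \<alpha>_def \<beta>_def hs H_def)
  have "p * (p * ip (avg (insert x (insert y B)) (u x)) (avg (insert x (insert y B)) (u y)))
      = ip (p *\<^sub>R \<alpha> + \<beta> - (m + 2) *\<^sub>R h) (p *\<^sub>R \<beta> + \<alpha> - (m + 2) *\<^sub>R h)"
  proof -
    have "p *\<^sub>R avg (insert x (insert y B)) (u x) = p *\<^sub>R \<alpha> + \<beta> - (m + 2) *\<^sub>R h"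
      using avg_xy_u[OF x y False] by (simp add: h' \<alpha>_def \<beta>_def)
    moreover have "p *\<^sub>R avg (insert x (insert y B)) (u y) = p *\<^sub>R \<beta> + \<alpha> - (m + 2) *\<^sub>R h"
      using avg_xy_u[OF y x] False by (simp add: h_def insert_commute \<alpha>_def \<beta>_def)
    ultimately show ?thesis
      by (metis ip_scale_left ip_scale_right)
  qed
  also have "\<dots> = (p\<^sup>2 + 1) * K + p * E - (m + 2)\<^sup>2 * H"
    unfolding pm(2) by (simp add: ip_add_left ip_add_right ip_diff_left ip_diff_right ip_scale_left ip_scale_right \<alpha>\<alpha> \<alpha>\<beta> \<alpha>h
        ip_sym[of \<beta> \<alpha>] ip_sym[of h \<alpha>] ip_sym[of h \<beta>] E_def H_def[symmetric] power2_eq_square algebra_simps)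
  finally have pp: "p * (p * ip (avg (insert x (insert y B)) (u x)) (avg (insert x (insert y B)) (u y)))
      = (p\<^sup>2 + 1) * K + p * E - (m + 2)\<^sup>2 * H" .
  have "p *\<^sub>R avg (insert x (insert y B)) (u y) = m *\<^sub>R avg (insert x B) (u y) + swap x y (u y)"
    using avg_move[OF B(1) pt(1,2)[OF y] pt(1,2)[OF x] False[symmetric] u_props(1)[OF y]]
    by (simp add: m_def p_def insert_commute transpose_commute add.assoc)
  then have "p * ip (u x) (avg (insert x (insert y B)) (u y)) = m * ip (u x) (avg (insert x B) (u y)) + ip (u x) (swap x y (u y))"
    by (metis ip_add_right ip_scale_right)
  moreover have "ip (u x) (avg (insert x B) (u y)) = ip (u x) (u y)"
    using ip_avg[OF sub(2)[OF x], of "u x" "u y"] avg_of_invariant[OF sub(2)[OF x] u_props(1)[OF x]] by simp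
  moreover have "ip (u x) (avg (insert x (insert y B)) (u y)) = ip (avg (insert x (insert y B)) (u x)) (avg (insert x (insert y B)) (u y))"
    using ip_avg[OF sub(4)[OF x y], of "u x" "avg (insert x (insert y B)) (u y)"] avg_idem[OF sub(4)[OF x y], of "u y"] by simp
  ultimately have "m * ip (u x) (u y) + (Y - K) = p * ip (avg (insert x (insert y B)) (u x)) (avg (insert x (insert y B)) (u y))"
    by (simp only: us)
  then have \<theta>: "p * (m * ip (u x) (u y)) + p * (Y - K) = (p\<^sup>2 + 1) * K + p * E - (m + 2)\<^sup>2 * H"
    using pp by (simp only: distrib_left[symmetric])
  have a: "p * ip (\<eta> x) (\<eta> y) = (p + 1) * H - K"
    using gram(1) by (simp add: H_def K_def)
  have gg: "ip (g - \<eta> x) (g - \<eta> y) = G - E + ip (\<eta> x) (\<eta> y)"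
    using gram(5) gram'(5) by (simp add: ip_diff_left ip_diff_right ip_sym[of "\<eta> x" g] G_def E_def)
  define U where "U = ip (u x - avg (insert hub B) (u x)) (u y - avg (insert hub B) (u y))"
  have U: "U = ip (u x) (u y) - (G - E + ip (\<eta> x) (\<eta> y)) / m\<^sup>2"
    unfolding U_def ip_avg_hub_u[OF x y] gg ..
  note id = pair_form_identity[OF m_ge p_def a \<theta> U v2 s2]
  have pos: "0 \<le> (1 / (m * (m - 1))) * (p * (m * (G + Y - 2 * H) - p * (E + 2 * K - 4 * H)))
      + ((m - 1) / (m * p)) * ((m + 2) * (G - Y) - p * (E - 2 * K))"
    using m_ge p_ge Zm Zp by (intro add_nonneg_nonneg mult_nonneg_nonneg) auto
  have sv: "ip s (v x y) = m * ip (v x y) (v x y)"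
    using u_v[OF x y] pair_sum[OF x y v_props(5)[OF x y]] by (simp add: s_def)
  define r where "r = (n x y - v x y) - (- (1 / m)) *\<^sub>R s"
  have "ip r r = ip (n x y) (n x y) + ip (v x y) (v x y) + (2 / m) * (ip s (n x y) - ip s (v x y)) + ip s s / m\<^sup>2"
    unfolding r_def ip_diff_square
    by (simp add: ip_diff_left ip_diff_right ip_sym[of "n x y" "v x y"] ip_sym[of "n x y" s] ip_sym[of "v x y" s] n_props(6)[OF x y]
        power2_eq_square field_simps)
  then have "(m / p) * ip r r = (m / p) * ip (n x y) (n x y) + (2 / p) * ip s (n x y) - (m / p) * ip (v x y) (v x y) + ip s s / (m * p)"
  proof -
    have "(m / p) * (N + V + (2 / m) * (S - m * V) + T / m\<^sup>2) = (m / p) * N + (2 / p) * S - (m / p) * V + T / (m * p)" for N V S T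
      using m_ge p_ge by (simp add: field_simps power2_eq_square)
    then show ?thesis
      using \<open>ip r r = _\<close> by (simp only: sv)
  qed
  moreover have "0 \<le> (m / p) * ip r r"
    using m_ge p_ge ip_nonneg by (intro mult_nonneg_nonneg) auto
  ultimately show ?thesis
    using pos unfolding id[symmetric] uu U_def[symmetric] s_def[symmetric] by linarith
qed

section \<open>The form of a triple of sites\<close>

text \<open>Inner products of the vectors \<open>v\<close> that share a site become inner products of the \<open>w\<close>, because both averages that
occur are given by single transpositions.\<close>

lemma v_cross:
  assumes k: "k \<in> X" and i: "i \<in> X" and j: "j \<in> X" and d: "k \<noteq> i" "k \<noteq> j" "i \<noteq> j"
  defines "R \<equiv> avg (insert k (insert i (insert j B)))"
  shows "p\<^sup>2 * ip (v k i) (v k j) = (p / (m * (m + 2)))\<^sup>2 *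
    (p * (p + 1) * ip (R (w k i)) (R (w k j)) - p * ip (w k i) (swap i j (w k j)) - ip (swap hub i (w k i)) (swap hub j (w k j)))"
proof -
  define c where "c = p / (m * (m + 2))"
  let ?H = "avg (insert hub (insert k B))"
  have "ip (w k i) (?H (w k j)) = ip (?H (w k i)) (?H (w k j))"
    using ip_avg[OF sub(3)[OF k], of "w k i" "?H (w k j)"] avg_idem[OF sub(3)[OF k], of "w k j"] by simp
  moreover have "ip (?H (w k i)) (w k j) = ip (?H (w k i)) (?H (w k j))"
    using ip_avg[OF sub(3)[OF k], of "?H (w k i)" "w k j"] avg_idem[OF sub(3)[OF k], of "w k i"] by simp
  moreover have "ip (?H (w k i)) (?H (w k j)) = ip (swap hub i (w k i)) (swap hub j (w k j)) / p\<^sup>2"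
    unfolding avg_hub_x_w[OF k i d(1)] avg_hub_x_w[OF k j d(2)]
    by (simp add: ip_scale_left ip_scale_right ip_minus_left ip_minus_right power2_eq_square)
  ultimately have 1: "ip (v k i) (v k j) = c\<^sup>2 * (ip (w k i) (w k j) - ip (swap hub i (w k i)) (swap hub j (w k j)) / p\<^sup>2)"
    unfolding v_def c_def[symmetric]
    by (simp add: ip_scale_left ip_scale_right ip_diff_left ip_diff_right power2_eq_square)
  have sub3: "insert k (insert i (insert j B)) \<subseteq> \<Omega>"
    by (rule sub(6)[OF k i j])
  have "(real (card (insert k B)) + 2) *\<^sub>R avg (insert j (insert i (insert k B))) (w k j)
      = (real (card (insert k B)) + 1) *\<^sub>R avg (insert i (insert k B)) (w k j) + swap j i (w k j)"
    by (rule avg_move[OF sub(2)[OF k]])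
      (use w_props(1)[OF k j] pt[OF i] pt[OF j] d in \<open>auto simp: insert_commute\<close>)
  then have "(p + 1) *\<^sub>R R (w k j) = p *\<^sub>R avg (insert k (insert i B)) (w k j) + swap i j (w k j)"
    by (simp add: block_card(1)[OF k] p_def R_def insert_commute transpose_commute add.commute)
  then have "(p + 1) * ip (w k i) (R (w k j)) = p * ip (w k i) (avg (insert k (insert i B)) (w k j)) + ip (w k i) (swap i j (w k j))"
    by (metis ip_add_right ip_scale_right)
  moreover have "ip (w k i) (avg (insert k (insert i B)) (w k j)) = ip (w k i) (w k j)"
    using ip_avg[OF sub(4)[OF k i], of "w k i" "w k j"] w_props(5)[OF k i] by simp
  moreover have "ip (w k i) (R (w k j)) = ip (R (w k i)) (R (w k j))"
    unfolding R_def using ip_avg[OF sub3, of "w k i" "avg (insert k (insert i (insert j B))) (w k j)"] avg_idem[OF sub3, of "w k j"] by simp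
  ultimately have "p * ip (w k i) (w k j) = (p + 1) * ip (R (w k i)) (R (w k j)) - ip (w k i) (swap i j (w k j))"
    by simp
  then have "p * (p * ip (w k i) (w k j)) = p * ((p + 1) * ip (R (w k i)) (R (w k j)) - ip (w k i) (swap i j (w k j)))"
    by (simp only:)
  then have "p\<^sup>2 * ip (w k i) (w k j) = p * (p + 1) * ip (R (w k i)) (R (w k j)) - p * ip (w k i) (swap i j (w k j))"
    by (simp only: power2_eq_square mult.assoc right_diff_distrib)
  moreover have "p\<^sup>2 * (c\<^sup>2 * (a - b / p\<^sup>2)) = c\<^sup>2 * (p\<^sup>2 * a - b)" for a b
    using p_ge by (simp add: right_diff_distrib)
  ultimately show ?thesis
    unfolding 1 c_def[symmetric] by (simp only:)
qed

text \<open>A vector that is killed by the average over \<open>insert hub (insert k B)\<close> makes a definite angle with the invariants of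
\<open>insert k (insert i B)\<close>: the \<open>hub\<close>-average of its projection is a transposition divided by \<open>- p\<close>, which leaves
the fraction \<open>1 - 1 / p\<^sup>2 = m (m + 2) / p\<^sup>2\<close> of the squared norm.\<close>

lemma avg_contracts:
  assumes k: "k \<in> X" and i: "i \<in> X" and ki: "k \<noteq> i"
    and z: "invariant (insert k B) z" "avg (insert hub (insert k B)) z = 0"
  shows "ip (avg (insert k (insert i B)) z) (avg (insert k (insert i B)) z) \<le> (m * (m + 2) / p\<^sup>2) * ip z z"
proof -
  define a where "a = avg (insert k (insert i B)) z"
  let ?H = "avg (insert hub (insert k B))"
  have inv: "invariant (insert k (insert i B)) a"
    unfolding a_def by (rule avg_invariant[OF sub(4)[OF k i]])
  have za: "ip z a = ip a a"
    unfolding a_def by (rule ip_avg_avg[OF sub(4)[OF k i], symmetric])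
  have "avg (insert hub (insert k (insert i B))) a = avg (insert hub (insert k (insert i B))) z"
    unfolding a_def by (rule avg_avg_subset(1)[OF sub(5)[OF k i]]) auto
  also have "\<dots> = avg (insert hub (insert k (insert i B))) (?H z)"
    by (rule avg_avg_subset(1)[OF sub(5)[OF k i], symmetric]) auto
  also have "\<dots> = 0"
    by (simp add: z avg_linear(5)[OF sub(5)[OF k i]])
  finally have "avg (insert hub (insert k (insert i B))) a = 0" .
  moreover have "(real (card (insert k B)) + 2) *\<^sub>R avg (insert i (insert hub (insert k B))) a
      = (real (card (insert k B)) + 1) *\<^sub>R ?H a + swap i hub a"
    by (rule avg_move[OF sub(2)[OF k]]) (use inv hub pt[OF i] pt[OF k] ki in \<open>auto simp: insert_commute\<close>)
  ultimately have "p *\<^sub>R ?H a + swap i hub a = 0"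
    by (simp add: block_card(1)[OF k] p_def insert_commute)
  then have "?H a = - (1 / p) *\<^sub>R swap i hub a"
    by (rule solve_scale) (use p_ge in simp)
  then have HH: "ip (?H a) (?H a) = ip a a / p\<^sup>2"
    using pt[OF i] hub by (simp add: ip_scale_left ip_scale_right ip_minus_left ip_minus_right ip_act swap_permutes power2_eq_square)
  have aH: "ip a (?H a) = ip (?H a) (?H a)"
    by (rule ip_avg_avg[OF sub(3)[OF k], symmetric])
  have zH: "ip z (?H a) = 0"
    using ip_avg[OF sub(3)[OF k], of z a] z by (simp add: ip_zero_left)
  define c where "c = m * (m + 2) / p\<^sup>2"
  have c: "c > 0" "1 - 1 / p\<^sup>2 = c"
  proof -
    show "c > 0"
      unfolding c_def using m_ge p_ge by (intro divide_pos_pos mult_pos_pos) auto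
    have "m * (m + 2) = p\<^sup>2 - 1"
      by (simp add: p_def power2_eq_square algebra_simps)
    then show "1 - 1 / p\<^sup>2 = c"
      using p_ge by (simp add: c_def diff_divide_distrib)
  qed
  define b where "b = a - ?H a"
  have "c * ip a a = ip a a - ip a a / p\<^sup>2"
    unfolding c(2)[symmetric] by (simp add: left_diff_distrib)
  then have bb: "ip b b = c * ip a a" and zb: "ip z b = ip a a"
    using HH aH zH za by (simp_all add: b_def ip_diff_left ip_diff_right ip_sym[of "?H a" a] algebra_simps)
  have "0 \<le> ip (b - c *\<^sub>R z) (b - c *\<^sub>R z)" by (rule ip_nonneg)
  also have "\<dots> = c * (c * ip z z - ip a a)"
    unfolding ip_diff_square by (simp add: bb zb ip_sym[of b z] power2_eq_square algebra_simps)
  finally show ?thesis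
    using c(1) unfolding a_def[symmetric] c_def[symmetric] by (simp add: zero_le_mult_iff)
qed

text \<open>The average over \<open>insert k (insert i B)\<close> kills \<open>n k i\<close>, so any multiple of it may be subtracted before
\<open>avg_contracts\<close> is used. The multiple \<open>1/8\<close> makes the final estimate in \<open>triple_form_nonneg\<close> valid
for all \<open>p \<ge> 3\<close>.\<close>

lemma cross_avg_bound:
  assumes k: "k \<in> X" and i: "i \<in> X" and j: "j \<in> X" and d: "k \<noteq> i"
  shows "ip (avg (insert k (insert i B)) (n k j - n i j)) (avg (insert k (insert i B)) (n k j - n i j))
    \<le> 2 * (m * (m + 2) / p\<^sup>2) * (ip (n k j - (1/8) *\<^sub>R n k i) (n k j - (1/8) *\<^sub>R n k i)
        + ip (n i j - (1/8) *\<^sub>R n i k) (n i j - (1/8) *\<^sub>R n i k))"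
proof -
  let ?A = "avg (insert k (insert i B))"
  have bound: "ip (avg (insert k' (insert i' B)) (n k' j)) (avg (insert k' (insert i' B)) (n k' j))
      \<le> (m * (m + 2) / p\<^sup>2) * ip (n k' j - (1/8) *\<^sub>R n k' i') (n k' j - (1/8) *\<^sub>R n k' i')"
    if "k' \<in> X" "i' \<in> X" "k' \<noteq> i'" for k' i'
  proof -
    have "avg (insert k' (insert i' B)) (n k' j) = avg (insert k' (insert i' B)) (n k' j - (1/8) *\<^sub>R n k' i')"
      by (simp add: avg_linear[OF sub(4)[OF that(1,2)]] n_props(5)[OF that(1,2)])
    then show ?thesis
      using avg_contracts[OF that, of "n k' j - (1/8) *\<^sub>R n k' i'"] n_props(1,2)[OF that(1) j] n_props(1,2)[OF that(1,2)]
      by (simp add: invariant_linear[OF sub(2)[OF that(1)]] avg_linear[OF sub(3)[OF that(1)]])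
  qed
  define a b where "a = ?A (n k j)" and "b = ?A (n i j)"
  have "0 \<le> ip (a + b) (a + b)" by (rule ip_nonneg)
  then have "ip (a - b) (a - b) \<le> 2 * ip a a + 2 * ip b b"
    by (simp add: ip_add_left ip_add_right ip_diff_left ip_diff_right ip_sym[of b a])
  then have "ip (?A (n k j - n i j)) (?A (n k j - n i j)) \<le> 2 * ip a a + 2 * ip b b"
    by (simp only: avg_linear(2)[OF sub(4)[OF k i]] a_def b_def)
  also have "\<dots> \<le> 2 * ((m * (m + 2) / p\<^sup>2) * ip (n k j - (1/8) *\<^sub>R n k i) (n k j - (1/8) *\<^sub>R n k i))
      + 2 * ((m * (m + 2) / p\<^sup>2) * ip (n i j - (1/8) *\<^sub>R n i k) (n i j - (1/8) *\<^sub>R n i k))"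
    using bound[OF k i d] bound[OF i k d[symmetric]] unfolding insert_commute[of i k B] a_def b_def by linarith
  finally show ?thesis
    by (simp only: distrib_left mult.assoc)
qed

text \<open>The vectors \<open>w y z\<close>, \<open>w z x\<close>, \<open>w x y\<close> form a cocycle: they are differences of the copies of \<open>g\<close> at the three
sites, so that their averages over all three sites add up to zero. After transpositions that move them into the block
\<open>insert y (insert z B)\<close>, their sum is odd under exchange of \<open>hub\<close> and \<open>x\<close>, and \<open>cocycle_form_nonneg\<close> applies.
By \<open>v_cross\<close> its quadratic part is the form of the \<open>v\<close> in the statement; the linear terms absorb the cross terms
of \<open>v\<close> with \<open>n\<close>.\<close>

lemma triple_cocycle:
  assumes x: "x \<in> X" and y: "y \<in> X" and z: "z \<in> X" and d: "x \<noteq> y" "x \<noteq> z" "y \<noteq> z"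
  defines "c \<equiv> p / (m * (m + 2))"
  defines "Y1 \<equiv> avg (insert y (insert z B)) (n y x - n z x)"
    and "Y2 \<equiv> avg (insert z (insert x B)) (n z y - n x y)"
    and "Y3 \<equiv> avg (insert x (insert y B)) (n x z - n y z)"
  shows "0 \<le> p\<^sup>2 * (ip (v x y) (v x y) + ip (v y z) (v y z) + ip (v z x) (v z x)
      - 2 * ip (v x y) (v x z) - 2 * ip (v y z) (v y x) - 2 * ip (v z x) (v z y))
    + 2 * c * (ip (w y z) Y1 + ip (w z x) Y2 + ip (w x y) Y3)
    + (ip Y1 Y1 + ip Y2 Y2 + ip Y3 Y3) / m\<^sup>2"
proof -
  note px = pt[OF x] and py = pt[OF y] and pz = pt[OF z]
  let ?C = "insert y (insert z B)"
  let ?R = "avg (insert x (insert y (insert z B)))"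
  have cpos: "c > 0"
    unfolding c_def using m_ge p_ge by (intro divide_pos_pos mult_pos_pos) auto
  have sR: "insert x (insert y (insert z B)) \<subseteq> \<Omega>"
    by (rule sub(6)[OF x y z])
  have C: "?C \<subseteq> \<Omega>" "hub \<in> \<Omega>" "hub \<notin> ?C" "x \<in> \<Omega>" "x \<notin> ?C" "hub \<noteq> x"
    using sub(4)[OF y z] hub px py pz d by auto
  have cardC: "real (card ?C) = p"
    by (rule block_card(3)[OF y z d(3)])
  have cardC2: "card ?C \<ge> 2"
    using cardC p_ge by linarith
  have ord: "insert z (insert x B) = insert x (insert z B)" "insert z (insert y B) = ?C"
    by (rule insert_commute)+
  \<comment> \<open>Transport of invariance and of averages to the block \<open>?C\<close> by the transpositions \<open>(x y)\<close> and \<open>(x z)\<close>.\<close>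
  have frame: "invariant ?C (swap x y k)" "avg (insert hub ?C) (swap x y k) = swap x y (avg (insert hub (insert x (insert z B))) k)"
    "avg (insert x ?C) (swap x y k) = ?R k"
    if "invariant (insert z (insert x B)) k" for k
  proof -
    show "invariant ?C (swap x y k)"
      using invariant_swap_insert[of "insert z B" x y k] that sub(2)[OF z] px py d by (simp add: insert_commute)
    show "avg (insert hub ?C) (swap x y k) = swap x y (avg (insert hub (insert x (insert z B))) k)"
      using swap_avg[of "insert hub (insert z B)" x y k] sub(3)[OF z] px py d by (simp add: insert_commute)
    show "avg (insert x ?C) (swap x y k) = ?R k"
      by (rule avg_act[OF sR]) (auto intro: permutes_swap_id)
  qed
  have frame': "invariant ?C (swap x z k)" "avg (insert hub ?C) (swap x z k) = swap x z (avg (insert hub (insert x (insert y B))) k)"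
    "avg (insert x ?C) (swap x z k) = ?R k"
    if "invariant (insert x (insert y B)) k" for k
  proof -
    show "invariant ?C (swap x z k)"
      using invariant_swap_insert[of "insert y B" x z k] that sub(2)[OF y] px pz d by (simp add: insert_commute)
    show "avg (insert hub ?C) (swap x z k) = swap x z (avg (insert hub (insert x (insert y B))) k)"
      using swap_avg[of "insert hub (insert y B)" x z k] sub(3)[OF y] px pz d by (simp add: insert_commute)
    show "avg (insert x ?C) (swap x z k) = ?R k"
      by (rule avg_act[OF sR]) (auto intro: permutes_swap_id)
  qed
  define W1 W2 W3 where "W1 = w y z" and "W2 = swap x y (w z x)" and "W3 = swap x z (w x y)"
  define X1 X2 X3 where "X1 = (1 / c) *\<^sub>R Y1" and "X2 = (1 / c) *\<^sub>R swap x y Y2" and "X3 = (1 / c) *\<^sub>R swap x z Y3"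
  have invY: "invariant ?C Y1" "invariant (insert z (insert x B)) Y2" "invariant (insert x (insert y B)) Y3"
    unfolding Y1_def Y2_def Y3_def by (rule avg_invariant[OF sub(4)] , use x y z in auto)+
  have kill_hub: "avg (insert hub (insert a (insert b B))) (avg (insert a (insert b B)) (n a k - n b k)) = 0"
    if ab: "a \<in> X" "b \<in> X" "k \<in> X" for a b k
  proof -
    have "avg (insert hub (insert a (insert b B))) (n a k) = avg (insert hub (insert a (insert b B))) (avg (insert hub (insert a B)) (n a k))"
      "avg (insert hub (insert a (insert b B))) (n b k) = avg (insert hub (insert a (insert b B))) (avg (insert hub (insert b B)) (n b k))"
      by (rule avg_avg_subset(1)[OF sub(5)[OF ab(1,2)], symmetric], auto)+
    moreover have "insert a (insert b B) \<subseteq> insert hub (insert a (insert b B))"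
      by blast
    ultimately show ?thesis
      by (simp add: avg_avg_subset(1)[OF sub(5)[OF ab(1,2)]] avg_linear[OF sub(5)[OF ab(1,2)]] n_props(2)[OF ab(1,3)] n_props(2)[OF ab(2,3)])
  qed
  have kill_third: "?R (n a b) = 0" if ab: "a \<in> {x,y,z}" "b \<in> {x,y,z}" for a b
  proof -
    have "a \<in> X" "b \<in> X" using ab x y z by auto
    then have "avg (insert a (insert b B)) (n a b) = 0"
      by (rule n_props(5))
    moreover have "?R (n a b) = ?R (avg (insert a (insert b B)) (n a b))"
      by (rule avg_avg_subset(1)[OF sR, symmetric]) (use ab in auto)
    ultimately show ?thesis
      by (simp add: avg_linear(5)[OF sR])
  qed
  have RY: "?R Y1 = 0" "?R Y2 = 0" "?R Y3 = 0"
    unfolding Y1_def Y2_def Y3_def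
    by (subst avg_avg_subset(1)[OF sR]; simp add: avg_linear[OF sR] kill_third; blast)+
  have HY: "avg (insert hub ?C) Y1 = 0" "avg (insert hub (insert x (insert z B))) Y2 = 0" "avg (insert hub (insert x (insert y B))) Y3 = 0"
    using kill_hub[OF y z x] kill_hub[OF z x y] kill_hub[OF x y z] unfolding Y1_def Y2_def Y3_def ord by simp_all
  have Xp: "invariant ?C X1" "invariant ?C X2" "invariant ?C X3"
    "avg (insert hub ?C) X1 = 0" "avg (insert hub ?C) X2 = 0" "avg (insert hub ?C) X3 = 0"
    "avg (insert x ?C) X1 = 0" "avg (insert x ?C) X2 = 0" "avg (insert x ?C) X3 = 0"
    unfolding X1_def X2_def X3_def using px py pz
    by (simp_all add: invariant_linear(3)[OF C(1)] invY frame[OF invY(2)] frame'[OF invY(3)]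
        avg_linear[OF sR] avg_linear[OF sub(5)[OF y z]] HY RY swap_linear)
  have Hw: "avg (insert hub (insert x (insert z B))) (w z x) = 0"
    using w_props(6)[OF z x] by (simp only: ord)
  have Wp: "invariant ?C W1" "invariant ?C W2" "invariant ?C W3"
    "avg (insert hub ?C) W1 = 0" "avg (insert hub ?C) W2 = 0" "avg (insert hub ?C) W3 = 0"
    unfolding W1_def W2_def W3_def using px py pz
    by (simp_all add: w_props[OF y z] frame[OF w_props(1)[OF z x]] frame'[OF w_props(1)[OF x y]] Hw w_props(6)[OF x y] swap_linear)
  define a1 a2 a3 where "a1 = ?R (w y z)" and "a2 = ?R (w z x)" and "a3 = ?R (w x y)"
  have RW: "?R W1 = a1" "?R W2 = a2" "?R W3 = a3"
    unfolding W1_def W2_def W3_def a1_def a2_def a3_def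
    by (simp_all add: frame(3)[OF w_props(1)[OF z x]] frame'(3)[OF w_props(1)[OF x y]])
  have Rw: "?R (w a b) = ?R (swap a hub g) - ?R (swap b hub g)" if "a \<in> {x,y,z}" "b \<in> {x,y,z}" for a b
    unfolding w_def using that by (subst avg_avg_subset(1)[OF sR]) (auto simp: avg_linear[OF sR])
  have asum: "a1 + a2 + a3 = 0"
    by (simp add: a1_def a2_def a3_def Rw)
  \<comment> \<open>Each of the six copies of \<open>g\<close> in the sum of the moved vectors is exchanged with its negative by \<open>(hub x)\<close>,
up to a permutation of \<open>?C\<close>.\<close>
  have W: "W1 = avg ?C (swap y hub g - swap z hub g)"
    "W2 = avg ?C (swap x y (swap z hub g) - swap x y (swap x hub g))"
    "W3 = avg ?C (swap x z (swap x hub g) - swap x z (swap y hub g))"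
  proof -
    show "W1 = avg ?C (swap y hub g - swap z hub g)"
      by (simp add: W1_def w_def)
    have "swap x y (avg (insert x (insert z B)) k) = avg ?C (swap x y k)" for k
      by (rule swap_avg) (use sub(2)[OF z] px py d in auto)
    then show "W2 = avg ?C (swap x y (swap z hub g) - swap x y (swap x hub g))"
      using px py by (simp add: W2_def w_def ord swap_linear)
    have "swap x z (avg (insert x (insert y B)) k) = avg (insert z (insert y B)) (swap x z k)" for k
      by (rule swap_avg) (use sub(2)[OF y] px pz d in auto)
    then show "W3 = avg ?C (swap x z (swap x hub g) - swap x z (swap y hub g))"
      using px pz by (simp add: W3_def w_def ord swap_linear)
  qed
  have sh: "swap hub x (avg ?C k) = avg ?C (swap hub x k)" for k
    by (rule swap_avg_outside[OF C(1-5)])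
  have absorb: "avg ?C (swap y z k) = avg ?C k" for k
    by (rule avg_act[OF C(1)]) (auto intro: permutes_swap_id)
  have m1: "swap hub x (swap y hub g) = swap x y (swap x hub g)" "swap hub x (swap z hub g) = swap x z (swap x hub g)"
    using swap_braid(2)[of y hub x g] swap_braid(2)[of z hub x g] px py pz hub d
    by (simp_all add: transpose_commute)
  have m2: "swap hub x (swap x y (swap x hub g)) = swap y hub g" "swap hub x (swap x z (swap x hub g)) = swap z hub g"
    using px hub by (simp_all add: swap_swap flip: m1)
  have m3: "avg ?C (swap hub x (swap x y (swap z hub g))) = avg ?C (swap x z (swap y hub g))"
    "avg ?C (swap hub x (swap x z (swap y hub g))) = avg ?C (swap x y (swap z hub g))"
  proof -
    show "avg ?C (swap hub x (swap x y (swap z hub g))) = avg ?C (swap x z (swap y hub g))"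
      by (subst swap_relation_4(2)) (use px py pz hub d in \<open>auto simp: absorb\<close>)
    have "avg ?C (swap hub x (swap x z (swap y hub g))) = avg ?C (swap z y (swap x y (swap z hub g)))"
      by (subst swap_relation_4(2)[of hub x z y]) (use px py pz hub d in auto)
    then show "avg ?C (swap hub x (swap x z (swap y hub g))) = avg ?C (swap x y (swap z hub g))"
      by (simp add: swap_commute[of z y] absorb)
  qed
  define \<omega> where "\<omega> = W1 + W2 + W3"
  have odd: "swap hub x \<omega> = - \<omega>"
    unfolding \<omega>_def W using C
    by (simp add: swap_linear sh avg_linear[OF C(1)] m1 m2 m3)
  \<comment> \<open>The three vectors are indexed by \<open>{0, 1, 2}\<close> to match the form of \<open>cocycle_form_nonneg\<close>.\<close>
  define WW where "WW = (\<lambda>i::nat. if i = 0 then W1 else if i = 1 then W2 else W3)"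
  define XX where "XX = (\<lambda>i::nat. if i = 0 then X1 else if i = 1 then X2 else X3)"
  have sum3: "(\<Sum>i\<in>{0, 1, 2::nat}. F i) = F 0 + F 1 + F 2" for F :: "nat \<Rightarrow> 'b::comm_monoid_add"
    by (simp add: add.assoc)
  define s where "s = swap hub x"
  have vals: "WW 0 = W1" "WW 1 = W2" "WW 2 = W3" "XX 0 = X1" "XX 1 = X2" "XX 2 = X3"
    by (simp_all add: WW_def XX_def)
  have pm: "p - 1 = m"
    by (simp add: p_def)
  have "0 \<le> (\<Sum>i\<in>{0, 1, 2}. (p\<^sup>2 + p - 1) * ip (WW i) (WW i) + ip (WW i) (s (WW i)) - p * (p + 1) * ip (avg (insert x ?C) (WW i)) (WW i)
      + 2 * ip (WW i) (XX i) + ip (XX i) (XX i) / (p - 1)\<^sup>2) - (p - 1) * ip (\<Sum>i\<in>{0, 1, 2}. WW i) (\<Sum>i\<in>{0, 1, 2}. WW i)"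
    unfolding s_def cardC[symmetric]
  proof (rule cocycle_form_nonneg[OF C(1) cardC2 C(2-6)])
    show "(\<Sum>i\<in>{0, 1, 2}. avg (insert x ?C) (WW i)) = 0"
      unfolding sum3 vals RW by (rule asum)
    show "swap hub x (\<Sum>i\<in>{0, 1, 2}. WW i) = - (\<Sum>i\<in>{0, 1, 2}. WW i)"
      using odd unfolding sum3 vals \<omega>_def .
  qed (auto simp: WW_def XX_def Wp Xp)
  note main0 = this[unfolded sum3 vals pm, folded \<omega>_def]
  have R: "ip (?R k) k = ip (?R k) (?R k)" for k
    using ip_avg_avg[OF sR, of k] ip_sym[of k "?R k"] by simp
  have "0 \<le> (p\<^sup>2 + p - 1) * ip W1 W1 + (p\<^sup>2 + p - 1) * ip W2 W2 + (p\<^sup>2 + p - 1) * ip W3 W3 + (ip W1 (s W1) + ip W2 (s W2) + ip W3 (s W3))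
      - (p * (p + 1) * ip a1 a1 + p * (p + 1) * ip a2 a2 + p * (p + 1) * ip a3 a3) + (2 * ip W1 X1 + 2 * ip W2 X2 + 2 * ip W3 X3)
      + (ip X1 X1 / m\<^sup>2 + ip X2 X2 / m\<^sup>2 + ip X3 X3 / m\<^sup>2) - m * ip \<omega> \<omega>"
    using main0 unfolding RW R[of W1, unfolded RW] R[of W2, unfolded RW] R[of W3, unfolded RW] by linarith
  then have main: "0 \<le> (p\<^sup>2 + p - 1) * (ip W1 W1 + ip W2 W2 + ip W3 W3) + (ip W1 (s W1) + ip W2 (s W2) + ip W3 (s W3))
      - p * (p + 1) * (ip a1 a1 + ip a2 a2 + ip a3 a3) + 2 * (ip W1 X1 + ip W2 X2 + ip W3 X3)
      + (ip X1 X1 + ip X2 X2 + ip X3 X3) / m\<^sup>2 - m * ip \<omega> \<omega>"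
    by (simp only: distrib_left add_divide_distrib)
  \<comment> \<open>The relations \<open>asum\<close> and \<open>odd\<close> turn the diagonal form in the moved vectors into one in their mutual products.\<close>
  have t: "ip (s k) k' = ip k (s k')" for k k'
    unfolding s_def by (rule ip_swap[OF C(2,4)])
  have Asq: "ip a1 a1 + ip a2 a2 + ip a3 a3 = - 2 * (ip a1 a2 + ip a2 a3 + ip a1 a3)"
  proof -
    have "ip (a1 + a2 + a3) (a1 + a2 + a3) = 0" by (simp add: asum ip_zero_left)
    then show ?thesis
      by (simp add: ip_add_left ip_add_right ip_sym[of a2 a1] ip_sym[of a3 a1] ip_sym[of a3 a2])
  qed
  have \<omega>\<omega>: "ip \<omega> \<omega> = ip W1 W1 + ip W2 W2 + ip W3 W3 + 2 * (ip W1 W2 + ip W2 W3 + ip W1 W3)"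
    unfolding \<omega>_def by (simp add: ip_add_left ip_add_right ip_sym[of W2 W1] ip_sym[of W3 W1] ip_sym[of W3 W2])
  have \<omega>s: "- ip \<omega> \<omega> = ip W1 (s W1) + ip W2 (s W2) + ip W3 (s W3) + 2 * (ip W1 (s W2) + ip W2 (s W3) + ip W1 (s W3))"
  proof -
    have "ip \<omega> (s \<omega>) = - ip \<omega> \<omega>"
      by (simp add: s_def odd ip_minus_right)
    moreover have "s \<omega> = s W1 + s W2 + s W3"
      using C by (simp add: s_def \<omega>_def swap_linear)
    moreover have "ip W2 (s W1) = ip W1 (s W2)" "ip W3 (s W1) = ip W1 (s W3)" "ip W3 (s W2) = ip W2 (s W3)"
      using t[of W2 W1] t[of W3 W1] t[of W3 W2] ip_sym[of "s W2" W1] ip_sym[of "s W3" W1] ip_sym[of "s W3" W2] by simp_all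
    ultimately show ?thesis
      unfolding \<omega>_def by (simp add: ip_add_left ip_add_right)
  qed
  have norms: "ip W1 W1 = ip (w y z) (w y z)" "ip W2 W2 = ip (w z x) (w z x)" "ip W3 W3 = ip (w x y) (w x y)"
    using px py pz by (simp_all add: W1_def W2_def W3_def ip_act swap_permutes)
  have WX: "c * ip W1 X1 = ip (w y z) Y1" "c * ip W2 X2 = ip (w z x) Y2" "c * ip W3 X3 = ip (w x y) Y3"
    using px py pz cpos by (simp_all add: W1_def W2_def W3_def X1_def X2_def X3_def ip_scale_right ip_act swap_permutes)
  have XX: "c\<^sup>2 * ip X1 X1 = ip Y1 Y1" "c\<^sup>2 * ip X2 X2 = ip Y2 Y2" "c\<^sup>2 * ip X3 X3 = ip Y3 Y3"
    using px py pz cpos by (simp_all add: X1_def X2_def X3_def ip_scale_left ip_scale_right ip_act swap_permutes power2_eq_square)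
  have Rperm: "avg (insert y (insert z (insert x B))) = ?R" "avg (insert z (insert x (insert y B))) = ?R"
    "avg (insert x (insert z (insert y B))) = ?R" "avg (insert z (insert y (insert x B))) = ?R" "avg (insert y (insert x (insert z B))) = ?R"
    by (simp_all add: insert_commute)
  have neg: "w z y = - w y z" "w x z = - w z x" "w y x = - w x y"
    by (rule w_props(2)[OF y z] w_props(2)[OF z x] w_props(2)[OF x y])+
  have crossz: "p\<^sup>2 * ip (v z x) (v z y) = c\<^sup>2 * (- p * (p + 1) * ip a1 a2 + p * ip W1 W2 + ip W1 (s W2))"
  proof -
    have "swap hub y (swap hub x (w z x)) = s W2"
      using swap_braid(1)[of x hub y "w z x"] px py hub d by (simp add: s_def W2_def swap_commute[of hub x])
    then have "ip (swap hub x (w z x)) (swap hub y (w y z)) = ip W1 (s W2)"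
      using ip_swap[OF C(2), of y "swap hub x (w z x)" "w y z"] py by (simp add: W1_def ip_sym)
    moreover have "ip (w z x) (swap x y (w y z)) = ip W1 W2"
      using ip_swap[OF C(4), of y "w z x" "w y z"] py by (simp add: W1_def W2_def ip_sym)
    ultimately show ?thesis
      using v_cross[OF z x y d(2)[symmetric] d(3)[symmetric] d(1)] C py
      by (simp add: Rperm neg c_def[symmetric] swap_linear ip_minus_right avg_linear[OF sR] a1_def[symmetric] a2_def[symmetric] ip_sym[of a2 a1])
  qed
  have crossy: "p\<^sup>2 * ip (v y z) (v y x) = c\<^sup>2 * (- p * (p + 1) * ip a1 a3 + p * ip W1 W3 + ip W1 (s W3))"
  proof -
    have "swap hub z (swap hub x (w x y)) = s W3"
      using swap_braid(1)[of x hub z "w x y"] px pz hub d by (simp add: s_def W3_def swap_commute[of hub x])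
    then have "ip (swap hub z (w y z)) (swap hub x (w x y)) = ip W1 (s W3)"
      using ip_swap[OF C(2), of z "w y z" "swap hub x (w x y)"] pz by (simp add: W1_def)
    moreover have "ip (w y z) (swap z x (w x y)) = ip W1 W3"
      by (simp add: W1_def W3_def swap_commute[of z x])
    ultimately show ?thesis
      using v_cross[OF y z x d(3) d(1)[symmetric] d(2)[symmetric]] C pz
      by (simp add: Rperm neg c_def[symmetric] swap_linear ip_minus_right avg_linear[OF sR] a1_def[symmetric] a3_def[symmetric])
  qed
  have crossx: "p\<^sup>2 * ip (v x y) (v x z) = c\<^sup>2 * (- p * (p + 1) * ip a2 a3 + p * ip W2 W3 + ip W2 (s W3))"
  proof -
    have wzx: "swap z x (w z x) = w z x"
      by (rule w_props(3)[OF z x])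
    have "swap x z (swap hub y (swap hub z (w z x))) = s W2"
      using swap_relation_4(1)[of hub x y z "w z x"] px py pz hub d by (simp add: s_def W2_def wzx)
    moreover have "swap x z (swap hub y (swap hub y (w x y))) = W3"
      using py hub by (simp add: W3_def swap_swap)
    ultimately have "ip (swap hub y (w x y)) (swap hub z (w z x)) = ip W3 (s W2)"
      using ip_act[OF swap_permutes[OF px(1) pz(1)], of "swap hub y (swap hub y (w x y))" "swap hub y (swap hub z (w z x))"]
        ip_act[OF swap_permutes[OF hub(1) py(1)], of "swap hub y (w x y)" "swap hub z (w z x)"] by simp
    then have 1: "ip (swap hub y (w x y)) (swap hub z (w z x)) = ip W2 (s W3)"
      using t[of W3 W2] by (simp add: ip_sym)
    have "swap z x (swap y z (w z x)) = swap y z (swap y x (w z x))"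
      by (rule swap_braid(1)) (use px py pz d in auto)
    also have "\<dots> = W2"
      using invariant_swap[OF Wp(2), of y z] by (simp add: W2_def swap_commute[of y x])
    finally have "swap x z (swap y z (w z x)) = W2"
      by (simp add: swap_commute[of z x])
    then have "ip (w x y) (swap y z (w z x)) = ip W2 W3"
      using ip_act[OF swap_permutes[OF px(1) pz(1)], of "w x y" "swap y z (w z x)"] by (simp add: W3_def ip_sym)
    then show ?thesis
      using 1 v_cross[OF x y z d(1) d(2) d(3)] C pz py
      by (simp add: Rperm neg c_def[symmetric] swap_linear ip_minus_right avg_linear[OF sR] a2_def[symmetric] a3_def[symmetric] ip_sym[of a3 a2])
  qed
  have mm: "m * (m + 2) = p\<^sup>2 - 1"
    by (simp add: p_def power2_eq_square algebra_simps)
  have vnorm: "p\<^sup>2 * ip (v a b) (v a b) = c\<^sup>2 * ((p\<^sup>2 - 1) * ip (w a b) (w a b))" if "a \<in> X" "b \<in> X" for a b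
  proof -
    have "p\<^sup>2 = c\<^sup>2 * (p\<^sup>2 - 1) * (m * (m + 2))"
      using m_ge unfolding c_def mm[symmetric] by (simp add: power2_eq_square)
    moreover have "m * (m + 2) \<noteq> 0"
      using m_ge by simp
    moreover have "a * (k / M) = b * k" if "a = b * M" "M \<noteq> 0" for a b k M :: real
      using that by simp
    ultimately have "p\<^sup>2 * (ip (w a b) (w a b) / (m * (m + 2))) = (c\<^sup>2 * (p\<^sup>2 - 1)) * ip (w a b) (w a b)"
      by blast
    then show ?thesis
      by (simp only: v_props(4)[OF that] mult.assoc)
  qed
  have "c\<^sup>2 * ((p\<^sup>2 + p - 1) * (ip W1 W1 + ip W2 W2 + ip W3 W3) + (ip W1 (s W1) + ip W2 (s W2) + ip W3 (s W3))
      - p * (p + 1) * (ip a1 a1 + ip a2 a2 + ip a3 a3) - m * ip \<omega> \<omega>)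
    = p\<^sup>2 * (ip (v x y) (v x y) + ip (v y z) (v y z) + ip (v z x) (v z x)
      - 2 * ip (v x y) (v x z) - 2 * ip (v y z) (v y x) - 2 * ip (v z x) (v z y))"
  proof -
    have "p\<^sup>2 * (ip (v x y) (v x y) + ip (v y z) (v y z) + ip (v z x) (v z x)
        - 2 * ip (v x y) (v x z) - 2 * ip (v y z) (v y x) - 2 * ip (v z x) (v z y))
      = c\<^sup>2 * ((p\<^sup>2 - 1) * (ip W1 W1 + ip W2 W2 + ip W3 W3)
        + p * (p + 1) * (2 * (ip a1 a2 + ip a2 a3 + ip a1 a3)) - p * (2 * (ip W1 W2 + ip W2 W3 + ip W1 W3))
        - 2 * (ip W1 (s W2) + ip W2 (s W3) + ip W1 (s W3)))"
      unfolding norms right_diff_distrib distrib_left[of "p\<^sup>2"] mult.left_commute[of "p\<^sup>2" 2] crossx crossy crossz vnorm[OF x y] vnorm[OF y z] vnorm[OF z x]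
      by (simp add: algebra_simps)
    also have "2 * (ip a1 a2 + ip a2 a3 + ip a1 a3) = - (ip a1 a1 + ip a2 a2 + ip a3 a3)"
      using Asq by simp
    also have "2 * (ip W1 W2 + ip W2 W3 + ip W1 W3) = ip \<omega> \<omega> - (ip W1 W1 + ip W2 W2 + ip W3 W3)"
      using \<omega>\<omega> by simp
    also have "2 * (ip W1 (s W2) + ip W2 (s W3) + ip W1 (s W3)) = - ip \<omega> \<omega> - (ip W1 (s W1) + ip W2 (s W2) + ip W3 (s W3))"
      using \<omega>s by simp
    finally show ?thesis
      by (simp add: p_def algebra_simps)
  qed
  moreover have "c\<^sup>2 * (2 * (ip W1 X1 + ip W2 X2 + ip W3 X3)) = 2 * c * (ip (w y z) Y1 + ip (w z x) Y2 + ip (w x y) Y3)"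
    unfolding WX[symmetric] by (simp add: power2_eq_square algebra_simps)
  moreover have "c\<^sup>2 * ((ip X1 X1 + ip X2 X2 + ip X3 X3) / m\<^sup>2) = (ip Y1 Y1 + ip Y2 Y2 + ip Y3 Y3) / m\<^sup>2"
    unfolding XX[symmetric] by (simp add: algebra_simps)
  moreover have "0 \<le> c\<^sup>2 * (((p\<^sup>2 + p - 1) * (ip W1 W1 + ip W2 W2 + ip W3 W3) + (ip W1 (s W1) + ip W2 (s W2) + ip W3 (s W3))
      - p * (p + 1) * (ip a1 a1 + ip a2 a2 + ip a3 a3) - m * ip \<omega> \<omega>) + 2 * (ip W1 X1 + ip W2 X2 + ip W3 X3)
      + (ip X1 X1 + ip X2 X2 + ip X3 X3) / m\<^sup>2)"
    using main by (intro mult_nonneg_nonneg) auto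
  ultimately show ?thesis
    unfolding distrib_left[of "c\<^sup>2"] by linarith
qed

end

section \<open>Assembling the sum of squares\<close>

text \<open>The four summands on the right are the square of a multiple of \<open>q\<close> plus a combination of the \<open>u\<close>, the sum of
the squares attached to the sites, the sum over pairs and the sum over triples. The letters stand for sums weighted by
\<open>c\<close>: \<open>ee\<close>, \<open>uu\<close>, \<open>eu\<close> over sites, \<open>vv\<close>, \<open>nn\<close>, \<open>sn\<close> over pairs, \<open>UU\<close> for the square of the sum of the
\<open>u x\<close> with their \<open>hub\<close>-averages removed and \<open>XX\<close> for the sum over triples of \<open>ip (\<xi> x y) (\<xi> x z)\<close>.\<close>

lemma assembly_identity:
  fixes m p S c0 \<Lambda> qq ee uu eu vv nn sn UU XX :: real
  assumes m: "m \<ge> 2" and p: "p = m + 1" and \<Lambda>: "\<Lambda> = c0 * m + p * S"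
  shows "\<Lambda> * ((m - 1) / m * \<Lambda> * c0 * qq + \<Lambda> * ee - (nn + p\<^sup>2 * vv) / (2 * p) - c0 / m * uu)
    = c0 * (m - 1) / m * (\<Lambda>\<^sup>2 * qq - 2 * \<Lambda> * (m / (m - 1)) * (eu + uu / m) + (m / (m - 1))\<^sup>2 * UU)
      + (\<Lambda>\<^sup>2 * ee + 2 * \<Lambda> * (p * ((- vv - nn / p\<^sup>2) / 2) + c0 * eu) + p\<^sup>2 * XX + 2 * c0 * p * ((m * vv - sn / p\<^sup>2) / 2) + c0\<^sup>2 * uu)
      + c0 / 2 * (p / m * (2 * S * uu) - p * m * vv + m / p * nn + 2 / p * sn - 2 * m / (m - 1) * UU)
      + (p\<^sup>2 * (S * (vv + nn / p ^ 4) / 2 - XX) + (1 - 1 / p\<^sup>2) * S * nn / 2)"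
proof -
  have nz: "m \<noteq> 0" "m - 1 \<noteq> 0" "p \<noteq> 0" using m p by auto
  define a1 a2 a3 a4 a5 a6 a7 a8 a9 where "a1 = (m - 1) / m * (\<Lambda>\<^sup>2 * c0 * qq)" and "a2 = c0 * (\<Lambda> * uu / m)"
    and "a3 = c0 * (m / (m - 1) * UU)" and "a4 = \<Lambda> * nn / p" and "a5 = p * (\<Lambda> * vv)" and "a6 = c0 * (sn / p)"
    and "a7 = c0 * p * m * vv" and "a8 = c0 * (p * S * uu / m)" and "a9 = c0 * m * nn / p"
  define b1 b2 b3 b4 b5 b6 where "b1 = \<Lambda>\<^sup>2 * ee" and "b2 = c0 * \<Lambda> * eu" and "b3 = p\<^sup>2 * XX" and "b4 = c0\<^sup>2 * uu"
    and "b5 = p\<^sup>2 * (S * vv)" and "b6 = S * nn"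
  note atoms = a1_def a2_def a3_def a4_def a5_def a6_def a7_def a8_def a9_def b1_def b2_def b3_def b4_def b5_def b6_def
  have 1: "c0 * (m - 1) / m * (\<Lambda>\<^sup>2 * qq - 2 * \<Lambda> * (m / (m - 1)) * (eu + uu / m) + (m / (m - 1))\<^sup>2 * UU)
      = a1 - 2 * b2 - 2 * a2 + a3"
  proof -
    have "c0 * k / m * (\<Lambda>\<^sup>2 * qq - 2 * \<Lambda> * (m / k) * (eu + uu / m) + (m / k)\<^sup>2 * UU)
        = k / m * (\<Lambda>\<^sup>2 * c0 * qq) - 2 * (c0 * \<Lambda> * eu) - 2 * (c0 * (\<Lambda> * uu / m)) + c0 * (m / k * UU)" if "k \<noteq> 0" for k
      using nz(1) that by (simp add: distrib_left right_diff_distrib power2_eq_square) (simp add: mult_ac)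
    from this[OF nz(2)] show ?thesis unfolding atoms .
  qed
  have 2: "\<Lambda>\<^sup>2 * ee + 2 * \<Lambda> * (p * ((- vv - nn / p\<^sup>2) / 2) + c0 * eu) + p\<^sup>2 * XX + 2 * c0 * p * ((m * vv - sn / p\<^sup>2) / 2) + c0\<^sup>2 * uu
      = b1 - a5 - a4 + 2 * b2 + b3 + a7 - a6 + b4"
    unfolding atoms using nz(3) by (simp add: field_simps power2_eq_square)
  have 3: "c0 / 2 * (p / m * (2 * S * uu) - p * m * vv + m / p * nn + 2 / p * sn - 2 * m / (m - 1) * UU)
      = a8 - a7 / 2 + a9 / 2 + a6 - a3"
  proof -
    have "c0 / 2 * (p / m * (2 * S * uu) - p * m * vv + m / p * nn + 2 / p * sn - 2 * m / k * UU)
      = c0 * (p * S * uu / m) - c0 * p * m * vv / 2 + c0 * m * nn / p / 2 + c0 * (sn / p) - c0 * (m / k * UU)" for k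
      by (simp add: algebra_simps)
    then show ?thesis unfolding atoms .
  qed
  have 4: "p\<^sup>2 * (S * (vv + nn / p ^ 4) / 2 - XX) + (1 - 1 / p\<^sup>2) * S * nn / 2 = b5 / 2 - b3 + b6 / 2"
  proof -
    have p4: "p ^ 4 = p\<^sup>2 * p\<^sup>2" by (simp add: power2_eq_square power4_eq_xxxx)
    have gen: "k * (S * (vv + nn / (k * k)) / 2 - XX) + (1 - 1 / k) * S * nn / 2 = k * (S * vv) / 2 - k * XX + S * nn / 2"
      if "k \<noteq> 0" for k
      using that by (simp add: field_simps)
    show ?thesis unfolding atoms p4 by (rule gen) (use nz(3) in simp)
  qed
  have 5: "\<Lambda> * ((m - 1) / m * \<Lambda> * c0 * qq + \<Lambda> * ee - (nn + p\<^sup>2 * vv) / (2 * p) - c0 / m * uu)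
      = a1 + b1 - a4 / 2 - a5 / 2 - a2"
  proof -
    have "(nn + p\<^sup>2 * vv) / (2 * p) = nn / p / 2 + p * vv / 2"
      using nz(3) by (simp add: field_simps power2_eq_square)
    then show ?thesis
      unfolding atoms by (simp add: algebra_simps power2_eq_square)
  qed
  have 6: "a2 = b4 + a8" "a4 = a9 + b6" "a5 = a7 + b5"
    unfolding atoms \<Lambda> using nz(1,3) by (simp_all add: field_simps power2_eq_square)
  show ?thesis
    unfolding 1 2 3 4 5 using 6 by linarith
qed

context star begin

text \<open>The combination of \<open>v\<close> and \<open>n\<close> by which \<open>e x\<close> is corrected in the squares of \<open>core_inequality\<close>.\<close>

definition \<xi> where "\<xi> x y = v x y - (1 / p\<^sup>2) *\<^sub>R n x y"

lemma n_norm_sym: "x \<in> X \<Longrightarrow> y \<in> X \<Longrightarrow> ip (n y x) (n y x) = ip (n x y) (n x y)"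
  using ip_act[OF swap_permutes[OF pt(1) pt(1)], of x y "n x y" "n x y"] by (simp add: n_props(4) ip_minus_left ip_minus_right)

lemma v_norm_sym: "x \<in> X \<Longrightarrow> y \<in> X \<Longrightarrow> ip (v y x) (v y x) = ip (v x y) (v x y)"
  using ip_act[OF swap_permutes[OF pt(1) pt(1)], of x y "v x y" "v x y"] by (simp add: v_props(5) ip_minus_left ip_minus_right)

lemma \<xi>_norm: "x \<in> X \<Longrightarrow> y \<in> X \<Longrightarrow> ip (\<xi> x y) (\<xi> x y) = ip (v x y) (v x y) + ip (n x y) (n x y) / p ^ 4"
  unfolding \<xi>_def ip_diff_square by (simp add: n_props(6) power2_eq_square power4_eq_xxxx)

lemma ip_v_n: 
  assumes "k \<in> X" "i \<in> X" "j \<in> X"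
  shows "ip (v k i) (n k j) = p / (m * (m + 2)) * ip (w k i) (n k j)"
  using ip_avg[OF sub(3)[OF assms(1)], of "w k i" "n k j"]
  by (simp add: v_def ip_scale_left ip_diff_left n_props(2)[OF assms(1,3)] ip_zero_right)

lemma ip_\<xi>_\<xi>:
  assumes "k \<in> X" "i \<in> X" "j \<in> X"
  shows "p\<^sup>2 * ip (\<xi> k i) (\<xi> k j) = p\<^sup>2 * ip (v k i) (v k j)
    - p / (m * (m + 2)) * (ip (w k i) (n k j) + ip (w k j) (n k i)) + ip (n k i) (n k j) / p\<^sup>2"
proof -
  have "ip (\<xi> k i) (\<xi> k j) = ip (v k i) (v k j) - (ip (v k i) (n k j) + ip (v k j) (n k i)) / p\<^sup>2 + ip (n k i) (n k j) / (p\<^sup>2 * p\<^sup>2)"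
    unfolding \<xi>_def by (simp add: ip_diff_left ip_diff_right ip_scale_left ip_scale_right ip_sym[of "n k i" "v k j"] add_divide_distrib diff_divide_distrib)
  moreover have "p\<^sup>2 * (a - b / p\<^sup>2 + d / (p\<^sup>2 * p\<^sup>2)) = p\<^sup>2 * a - b + d / p\<^sup>2" for a b d
  proof -
    have *: "k * (b / k) = b" "k * (d / (k * k)) = d / k" if "k \<noteq> 0" for k :: real
      using that by simp_all
    have "p\<^sup>2 \<noteq> 0" using p_ge by simp
    note *[OF this]
    then show ?thesis
      by (simp only: distrib_left right_diff_distrib)
  qed
  ultimately show ?thesis
    by (simp only: ip_v_n[OF assms] ip_v_n[OF assms(1,3,2)] distrib_left)
qed

text \<open>The products of \<open>v\<close> with \<open>n\<close> are those of \<open>w\<close> with averages of \<open>n\<close>, so \<open>triple_cocycle\<close> removes them at the price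
of the squares of these averages, which \<open>cross_avg_bound\<close> estimates by the squares of the \<open>n\<close>. For triples
with a repetition the first part vanishes.\<close>

lemma triple_form_nonneg:
  assumes x: "x \<in> X" and y: "y \<in> X" and z: "z \<in> X"
  shows "0 \<le> p\<^sup>2 * (ip (\<xi> x y) (\<xi> x y) + ip (\<xi> y z) (\<xi> y z) + ip (\<xi> z x) (\<xi> z x)
      - 2 * ip (\<xi> x y) (\<xi> x z) - 2 * ip (\<xi> y z) (\<xi> y x) - 2 * ip (\<xi> z x) (\<xi> z y))
    + (1 - 1 / p\<^sup>2) * (ip (n x y) (n x y) + ip (n y z) (n y z) + ip (n z x) (n z x))"
proof (cases "x = y \<or> y = z \<or> z = x")
  case True
  have 0: "\<xi> a a = 0" if "a \<in> X" for a
    by (simp add: \<xi>_def v_props(3)[OF that that] n_props(3)[OF that that])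
  have \<xi>sym: "ip (\<xi> b a) (\<xi> b a) = ip (\<xi> a b) (\<xi> a b)" if "a \<in> X" "b \<in> X" for a b
    using \<xi>_norm[OF that] \<xi>_norm[OF that(2,1)] n_norm_sym[OF that] v_norm_sym[OF that] by simp
  have p2: "0 \<le> 1 - 1 / p\<^sup>2"
  proof -
    have "1 \<le> p\<^sup>2" using p_ge by (simp add: one_le_power)
    then show ?thesis by (simp add: divide_le_eq)
  qed
  have "ip (\<xi> x y) (\<xi> x y) + ip (\<xi> y z) (\<xi> y z) + ip (\<xi> z x) (\<xi> z x)
      - 2 * ip (\<xi> x y) (\<xi> x z) - 2 * ip (\<xi> y z) (\<xi> y x) - 2 * ip (\<xi> z x) (\<xi> z y) = 0"
  proof -
    consider "x = y" | "y = z" | "z = x" using True by blast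
    then show ?thesis
    proof cases
      case 1
      then show ?thesis using \<xi>sym[OF y z] 0[OF y] by (simp add: ip_zero_left ip_zero_right)
    next
      case 2
      then show ?thesis using \<xi>sym[OF x z] 0[OF z] by (simp add: ip_zero_left ip_zero_right)
    next
      case 3
      then show ?thesis using \<xi>sym[OF x y] 0[OF x] by (simp add: ip_zero_left ip_zero_right)
    qed
  qed
  then show ?thesis
    using p2 ip_nonneg by (simp add: mult_nonneg_nonneg)
next
  case False
  then have d: "x \<noteq> y" "x \<noteq> z" "y \<noteq> z" by auto
  define c where "c = p / (m * (m + 2))"
  define Y1 Y2 Y3 where "Y1 = avg (insert y (insert z B)) (n y x - n z x)"
    and "Y2 = avg (insert z (insert x B)) (n z y - n x y)"
    and "Y3 = avg (insert x (insert y B)) (n x z - n y z)"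
  define N1 N2 N3 where "N1 = ip (n x y) (n x y)" and "N2 = ip (n y z) (n y z)" and "N3 = ip (n z x) (n z x)"
  define Dx Dy Dz where "Dx = ip (n x y) (n x z)" and "Dy = ip (n y z) (n y x)" and "Dz = ip (n z x) (n z y)"
  note coc = triple_cocycle[OF x y z d, folded c_def Y1_def Y2_def Y3_def]
  have N: "ip (n y x) (n y x) = N1" "ip (n z y) (n z y) = N2" "ip (n x z) (n x z) = N3"
    using n_norm_sym[OF x y] n_norm_sym[OF y z] n_norm_sym[OF z x] by (simp_all add: N1_def N2_def N3_def)
  have wY: "ip (w a b) (avg (insert a (insert b B)) k) = ip (w a b) k" if "a \<in> X" "b \<in> X" for a b k
    using ip_avg[OF sub(4)[OF that], of "w a b" k] w_props(5)[OF that] by simp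
  have Yw: "ip (w y z) Y1 = ip (w y z) (n y x) + ip (w z y) (n z x)"
    "ip (w z x) Y2 = ip (w z x) (n z y) + ip (w x z) (n x y)"
    "ip (w x y) Y3 = ip (w x y) (n x z) + ip (w y x) (n y z)"
    unfolding Y1_def Y2_def Y3_def wY[OF y z] wY[OF z x] wY[OF x y] w_props(2)[OF y z] w_props(2)[OF z x] w_props(2)[OF x y]
    by (simp_all add: ip_diff_right ip_minus_left)
  have sq: "ip (k - (1/8) *\<^sub>R l) (k - (1/8) *\<^sub>R l) = ip k k - ip k l / 4 + ip l l / 64" for k l
    unfolding ip_diff_square by (simp add: power2_eq_square)
  define \<kappa> where "\<kappa> = m * (m + 2) / p\<^sup>2"
  have bounds: "ip Y1 Y1 \<le> 2 * \<kappa> * ((N1 - Dy / 4 + N2 / 64) + (N3 - Dz / 4 + N2 / 64))"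
    "ip Y2 Y2 \<le> 2 * \<kappa> * ((N2 - Dz / 4 + N3 / 64) + (N1 - Dx / 4 + N3 / 64))"
    "ip Y3 Y3 \<le> 2 * \<kappa> * ((N3 - Dx / 4 + N1 / 64) + (N2 - Dy / 4 + N1 / 64))"
    using cross_avg_bound[OF y z x d(3)] cross_avg_bound[OF z x y d(2)[symmetric]] cross_avg_bound[OF x y z d(1)]
    unfolding sq Y1_def[symmetric] Y2_def[symmetric] Y3_def[symmetric] \<kappa>_def[symmetric] N
      N1_def[symmetric] N2_def[symmetric] N3_def[symmetric] Dx_def[symmetric] Dy_def[symmetric] Dz_def[symmetric]
      ip_sym[of "n y x" "n y z"] ip_sym[of "n z y" "n z x"] ip_sym[of "n x z" "n x y"]
    by simp_all
  define NN where "NN = N1 + N2 + N3"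
  define DD where "DD = Dx + Dy + Dz"
  have "ip Y1 Y1 + ip Y2 Y2 + ip Y3 Y3 \<le> 2 * \<kappa> * (65 / 32 * NN - DD / 2)"
  proof -
    have "ip Y1 Y1 + ip Y2 Y2 + ip Y3 Y3 \<le> 2 * \<kappa> * ((N1 - Dy / 4 + N2 / 64) + (N3 - Dz / 4 + N2 / 64))
        + 2 * \<kappa> * ((N2 - Dz / 4 + N3 / 64) + (N1 - Dx / 4 + N3 / 64))
        + 2 * \<kappa> * ((N3 - Dx / 4 + N1 / 64) + (N2 - Dy / 4 + N1 / 64))"
      by (intro add_mono bounds)
    also have "\<dots> = 2 * \<kappa> * (65 / 32 * NN - DD / 2)"
      unfolding distrib_left[symmetric] NN_def DD_def by (intro arg_cong[where f = "(*) (2 * \<kappa>)"]) (simp add: field_simps)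
    finally show ?thesis .
  qed
  then have "(ip Y1 Y1 + ip Y2 Y2 + ip Y3 Y3) / m\<^sup>2 \<le> 2 * \<kappa> * (65 / 32 * NN - DD / 2) / m\<^sup>2"
    using m_ge by (intro divide_right_mono) auto
  also have "\<dots> = (1 / p\<^sup>2) * ((m + 2) / m * (65 / 16 * NN - DD))"
    using m_ge p_ge unfolding \<kappa>_def by (simp add: field_simps power2_eq_square)
  finally have Ysum: "(ip Y1 Y1 + ip Y2 Y2 + ip Y3 Y3) / m\<^sup>2 \<le> (1 / p\<^sup>2) * ((m + 2) / m * (65 / 16 * NN - DD))" .
  have DN: "DD \<le> NN"
  proof -
    have "2 * ip k l \<le> ip k k + ip l l" for k l
      using ip_nonneg[of "k - l"] by (simp add: ip_diff_left ip_diff_right ip_sym[of l k])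
    from this[of "n x y" "n x z"] this[of "n y z" "n y x"] this[of "n z x" "n z y"]
    show ?thesis unfolding NN_def DD_def Dx_def Dy_def Dz_def N N1_def[symmetric] N2_def[symmetric] N3_def[symmetric] by linarith
  qed
  have NN0: "NN \<ge> 0"
    unfolding NN_def N1_def N2_def N3_def by (intro add_nonneg_nonneg ip_nonneg)
  define \<rho> where "\<rho> = (m + 2) / m"
  have \<rho>: "\<rho> \<le> 2"
    using m_ge by (simp add: \<rho>_def field_simps)
  have "(2 - \<rho>) * DD \<le> (2 - \<rho>) * NN"
    using \<rho> DN by (intro mult_left_mono) auto
  moreover have "9 \<le> p\<^sup>2"
    using power_mono[OF p_ge, of 2] by simp
  then have "9 * NN \<le> p\<^sup>2 * NN"
    using NN0 by (intro mult_right_mono) auto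
  moreover have "\<rho> * NN \<le> 2 * NN"
    using \<rho> NN0 by (intro mult_right_mono) auto
  ultimately have "0 \<le> p\<^sup>2 * NN - 2 * DD - \<rho> * (65 / 16 * NN - DD)"
    using NN0 by (simp add: algebra_simps)
  then have "0 \<le> (1 / p\<^sup>2) * (p\<^sup>2 * NN - 2 * DD - \<rho> * (65 / 16 * NN - DD))"
    by (intro mult_nonneg_nonneg) auto
  also have "\<dots> = NN - 2 * DD / p\<^sup>2 - (1 / p\<^sup>2) * ((m + 2) / m * (65 / 16 * NN - DD))"
    using p_ge unfolding \<rho>_def[symmetric] by (simp add: right_diff_distrib)
  finally have last: "0 \<le> NN - 2 * DD / p\<^sup>2 - (1 / p\<^sup>2) * ((m + 2) / m * (65 / 16 * NN - DD))" .
  have p4: "p\<^sup>2 * (a / p ^ 4) = a / p\<^sup>2" for a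
    using p_ge by (simp add: power2_eq_square power4_eq_xxxx)
  have \<xi>n: "p\<^sup>2 * ip (\<xi> a b) (\<xi> a b) = p\<^sup>2 * ip (v a b) (v a b) + ip (n a b) (n a b) / p\<^sup>2" if "a \<in> X" "b \<in> X" for a b
    unfolding \<xi>_norm[OF that] distrib_left p4 ..
  have "p\<^sup>2 * (ip (\<xi> x y) (\<xi> x y) + ip (\<xi> y z) (\<xi> y z) + ip (\<xi> z x) (\<xi> z x)
      - 2 * ip (\<xi> x y) (\<xi> x z) - 2 * ip (\<xi> y z) (\<xi> y x) - 2 * ip (\<xi> z x) (\<xi> z y))
    = p\<^sup>2 * ip (\<xi> x y) (\<xi> x y) + p\<^sup>2 * ip (\<xi> y z) (\<xi> y z) + p\<^sup>2 * ip (\<xi> z x) (\<xi> z x)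
      - 2 * (p\<^sup>2 * ip (\<xi> x y) (\<xi> x z)) - 2 * (p\<^sup>2 * ip (\<xi> y z) (\<xi> y x)) - 2 * (p\<^sup>2 * ip (\<xi> z x) (\<xi> z y))"
    by (simp only: right_diff_distrib distrib_left mult.left_commute)
  also have "\<dots> = p\<^sup>2 * (ip (v x y) (v x y) + ip (v y z) (v y z) + ip (v z x) (v z x)
      - 2 * ip (v x y) (v x z) - 2 * ip (v y z) (v y x) - 2 * ip (v z x) (v z y))
    + 2 * c * (ip (w y z) Y1 + ip (w z x) Y2 + ip (w x y) Y3) + NN / p\<^sup>2 - 2 * DD / p\<^sup>2"
    unfolding \<xi>n[OF x y] \<xi>n[OF y z] \<xi>n[OF z x] ip_\<xi>_\<xi>[OF x y z] ip_\<xi>_\<xi>[OF y z x] ip_\<xi>_\<xi>[OF z x y] Yw c_def[symmetric]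
      N1_def[symmetric] N2_def[symmetric] N3_def[symmetric] Dx_def[symmetric] Dy_def[symmetric] Dz_def[symmetric] NN_def DD_def
    by (simp add: algebra_simps add_divide_distrib)
  finally show ?thesis
    using coc Ysum last unfolding N1_def[symmetric] N2_def[symmetric] N3_def[symmetric] NN_def[symmetric]
    by (simp add: left_diff_distrib)
qed

lemma sum_swap_half:
  fixes F :: "'a \<Rightarrow> 'a \<Rightarrow> real"
  assumes "\<And>x y. x \<in> X \<Longrightarrow> y \<in> X \<Longrightarrow> F x y + F y x = H x y"
  shows "(\<Sum>x\<in>X. \<Sum>y\<in>X. c x * c y * F x y) = (\<Sum>x\<in>X. \<Sum>y\<in>X. c x * c y * H x y) / 2"
proof -
  have "(\<Sum>x\<in>X. \<Sum>y\<in>X. c x * c y * F x y) = (\<Sum>x\<in>X. \<Sum>y\<in>X. c x * c y * F y x)"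
    by (subst sum.swap) (simp add: mult.commute)
  then have "2 * (\<Sum>x\<in>X. \<Sum>y\<in>X. c x * c y * F x y) = (\<Sum>x\<in>X. \<Sum>y\<in>X. c x * c y * F x y + c x * c y * F y x)"
    by (simp add: sum.distrib)
  also have "\<dots> = (\<Sum>x\<in>X. \<Sum>y\<in>X. c x * c y * H x y)"
    using assms by (intro sum.cong refl) (simp flip: distrib_left)
  finally show ?thesis by simp
qed

text \<open>With \<open>U\<close> the weighted sum of the \<open>u x\<close> with their \<open>hub\<close>-averages removed, the squares are those of
\<open>\<Lambda> q - (m / (m - 1)) U\<close> and, for each site, of \<open>\<Lambda> e x + p \<Xi> x + c0 u x\<close>. Their mixed terms
are known by \<open>avg_x_q\<close> and \<open>pair_sum\<close>; what they leave over is a sum of pair forms and triple forms.\<close>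

lemma core_inequality:
  assumes c: "\<And>x. x \<in> X \<Longrightarrow> 0 \<le> c x" and c0: "0 \<le> c0"
  defines "S \<equiv> \<Sum>x\<in>X. c x"
  defines "\<Lambda> \<equiv> c0 * m + p * S"
  shows "0 \<le> \<Lambda> * ((m - 1) / m * \<Lambda> * c0 * ip q q + \<Lambda> * (\<Sum>x\<in>X. c x * ip (e x) (e x))
    - ((\<Sum>x\<in>X. \<Sum>y\<in>X. c x * c y * ip (n x y) (n x y)) + p\<^sup>2 * (\<Sum>x\<in>X. \<Sum>y\<in>X. c x * c y * ip (v x y) (v x y))) / (2 * p)
    - c0 / m * (\<Sum>x\<in>X. c x * ip (u x) (u x)))"
proof -
  define uh where "uh x = u x - avg (insert hub B) (u x)" for x
  define eu where "eu = (\<Sum>x\<in>X. c x * ip (e x) (u x))"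
  define uu where "uu = (\<Sum>x\<in>X. c x * ip (u x) (u x))"
  define ee where "ee = (\<Sum>x\<in>X. c x * ip (e x) (e x))"
  define vv where "vv = (\<Sum>x\<in>X. \<Sum>y\<in>X. c x * c y * ip (v x y) (v x y))"
  define nn where "nn = (\<Sum>x\<in>X. \<Sum>y\<in>X. c x * c y * ip (n x y) (n x y))"
  define sn where "sn = (\<Sum>x\<in>X. \<Sum>y\<in>X. c x * c y * ip (u x - swap x y (u y)) (n x y))"
  define U where "U = (\<Sum>x\<in>X. c x *\<^sub>R uh x)"
  define UU where "UU = ip U U"
  define \<Xi> where "\<Xi> x = (\<Sum>y\<in>X. c y *\<^sub>R \<xi> x y)" for x
  define XX where "XX = (\<Sum>x\<in>X. c x * ip (\<Xi> x) (\<Xi> x))"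
  have UU: "UU = (\<Sum>x\<in>X. \<Sum>y\<in>X. c x * c y * ip (uh x) (uh y))"
  proof -
    have "UU = (\<Sum>x\<in>X. \<Sum>y\<in>X. c x * c y * ip (uh y) (uh x))"
      by (simp add: UU_def U_def ip_sum_left ip_sum_right ip_scale_left ip_scale_right sum_distrib_left mult.assoc)
    then show ?thesis
      using ip_sym by (metis (no_types, lifting) sum.cong)
  qed
  have XX: "XX = (\<Sum>x\<in>X. \<Sum>y\<in>X. \<Sum>z\<in>X. c x * c y * c z * ip (\<xi> x z) (\<xi> x y))"
    by (simp add: XX_def \<Xi>_def ip_sum_left ip_sum_right ip_scale_left ip_scale_right sum_distrib_left mult.assoc)
  have qU: "ip q U = eu + uu / m"
  proof -
    have "ip q (uh x) = ip (e x) (u x) + ip (u x) (u x) / m" if x: "x \<in> X" for x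
    proof -
      have "ip q (uh x) = ip q (u x)"
        using ip_avg[OF sub(1), of q "u x"] avg_q by (simp add: uh_def ip_diff_right ip_zero_left)
      also have "\<dots> = ip (avg (insert x B) q) (u x)"
        using ip_avg[OF sub(2)[OF x], of q "u x"] avg_of_invariant[OF sub(2)[OF x] u_props(1)[OF x]] by simp
      finally show ?thesis
        by (simp add: avg_x_q[OF x] ip_add_left ip_scale_left)
    qed
    then show ?thesis
      by (simp add: U_def ip_sum_right ip_scale_right eu_def uu_def distrib_left sum.distrib sum_divide_distrib)
  qed
  have e\<Xi>: "(\<Sum>x\<in>X. c x * ip (e x) (\<Xi> x)) = (- vv - nn / p\<^sup>2) / 2"
  proof -
    have "(\<Sum>x\<in>X. c x * ip (e x) (\<Xi> x)) = (\<Sum>x\<in>X. \<Sum>y\<in>X. c x * c y * ip (e x) (\<xi> x y))"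
      by (simp add: \<Xi>_def ip_sum_right ip_scale_right sum_distrib_left mult.assoc)
    also have "\<dots> = (\<Sum>x\<in>X. \<Sum>y\<in>X. c x * c y * (- ip (v x y) (v x y) - ip (n x y) (n x y) / p\<^sup>2)) / 2"
    proof (rule sum_swap_half)
      fix x y assume xy: "x \<in> X" "y \<in> X"
      show "ip (e x) (\<xi> x y) + ip (e y) (\<xi> y x) = - ip (v x y) (v x y) - ip (n x y) (n x y) / p\<^sup>2"
        using e_v[OF xy] unfolding e_n[OF xy, symmetric] \<xi>_def
        by (simp add: ip_diff_right ip_scale_right add_divide_distrib)
    qed
    also have "(\<Sum>x\<in>X. \<Sum>y\<in>X. c x * c y * (- ip (v x y) (v x y) - ip (n x y) (n x y) / p\<^sup>2)) = - vv - nn / p\<^sup>2"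
      by (simp add: vv_def nn_def right_diff_distrib sum_subtractf sum_negf sum_divide_distrib)
    finally show ?thesis .
  qed
  have u\<Xi>: "(\<Sum>x\<in>X. c x * ip (\<Xi> x) (u x)) = (m * vv - sn / p\<^sup>2) / 2"
  proof -
    have "(\<Sum>x\<in>X. c x * ip (\<Xi> x) (u x)) = (\<Sum>x\<in>X. \<Sum>y\<in>X. c x * c y * ip (u x) (\<xi> x y))"
      by (simp add: \<Xi>_def ip_sum_left ip_scale_left sum_distrib_left mult.assoc ip_sym[of "\<xi> _ _" "u _"])
    also have "\<dots> = (\<Sum>x\<in>X. \<Sum>y\<in>X. c x * c y * (m * ip (v x y) (v x y) - ip (u x - swap x y (u y)) (n x y) / p\<^sup>2)) / 2"
    proof (rule sum_swap_half)
      fix x y assume xy: "x \<in> X" "y \<in> X"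
      show "ip (u x) (\<xi> x y) + ip (u y) (\<xi> y x) = m * ip (v x y) (v x y) - ip (u x - swap x y (u y)) (n x y) / p\<^sup>2"
        unfolding u_v[OF xy, symmetric] u_n[OF xy, symmetric] \<xi>_def
        by (simp add: ip_diff_right ip_scale_right add_divide_distrib)
    qed
    also have "(\<Sum>x\<in>X. \<Sum>y\<in>X. c x * c y * (m * ip (v x y) (v x y) - ip (u x - swap x y (u y)) (n x y) / p\<^sup>2)) = m * vv - sn / p\<^sup>2"
      by (simp add: vv_def sn_def right_diff_distrib sum_subtractf sum_divide_distrib sum_distrib_left mult.left_commute)
    finally show ?thesis .
  qed
  \<comment> \<open>The square of \<open>\<Lambda> q - (m / (m - 1)) U\<close>, where \<open>qU\<close> gives the mixed term.\<close>
  have sq0: "0 \<le> \<Lambda>\<^sup>2 * ip q q - 2 * \<Lambda> * (m / (m - 1)) * (eu + uu / m) + (m / (m - 1))\<^sup>2 * UU"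
  proof -
    have "0 \<le> \<Lambda>\<^sup>2 * ip q q - 2 * \<Lambda> * k * (eu + uu / m) + k\<^sup>2 * UU" for k
      using ip_nonneg[of "\<Lambda> *\<^sub>R q - k *\<^sub>R U"] unfolding ip_diff_square qU[symmetric] UU_def
      by (simp add: ip_scale_left ip_scale_right power2_eq_square mult_ac)
    then show ?thesis .
  qed
  \<comment> \<open>The squares attached to the sites, with mixed terms from \<open>e\<Xi>\<close> and \<open>u\<Xi>\<close>.\<close>
  have sq1: "0 \<le> \<Lambda>\<^sup>2 * ee + 2 * \<Lambda> * (p * ((- vv - nn / p\<^sup>2) / 2) + c0 * eu) + p\<^sup>2 * XX
      + 2 * c0 * p * ((m * vv - sn / p\<^sup>2) / 2) + c0\<^sup>2 * uu"
  proof -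
    have "0 \<le> (\<Sum>x\<in>X. c x * ip (\<Lambda> *\<^sub>R e x + p *\<^sub>R \<Xi> x + c0 *\<^sub>R u x) (\<Lambda> *\<^sub>R e x + p *\<^sub>R \<Xi> x + c0 *\<^sub>R u x))"
      by (intro sum_nonneg mult_nonneg_nonneg c ip_nonneg)
    also have "\<dots> = (\<Sum>x\<in>X. \<Lambda>\<^sup>2 * (c x * ip (e x) (e x)) + 2 * \<Lambda> * (p * (c x * ip (e x) (\<Xi> x)) + c0 * (c x * ip (e x) (u x)))
        + p\<^sup>2 * (c x * ip (\<Xi> x) (\<Xi> x)) + 2 * c0 * p * (c x * ip (\<Xi> x) (u x)) + c0\<^sup>2 * (c x * ip (u x) (u x)))"
    proof (intro sum.cong refl)
      fix x
      show "c x * ip (\<Lambda> *\<^sub>R e x + p *\<^sub>R \<Xi> x + c0 *\<^sub>R u x) (\<Lambda> *\<^sub>R e x + p *\<^sub>R \<Xi> x + c0 *\<^sub>R u x)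
        = \<Lambda>\<^sup>2 * (c x * ip (e x) (e x)) + 2 * \<Lambda> * (p * (c x * ip (e x) (\<Xi> x)) + c0 * (c x * ip (e x) (u x)))
        + p\<^sup>2 * (c x * ip (\<Xi> x) (\<Xi> x)) + 2 * c0 * p * (c x * ip (\<Xi> x) (u x)) + c0\<^sup>2 * (c x * ip (u x) (u x))"
        by (simp add: ip_add_left ip_add_right ip_scale_left ip_scale_right ip_sym[of "\<Xi> x" "e x"] ip_sym[of "u x" "e x"]
            ip_sym[of "u x" "\<Xi> x"] power2_eq_square algebra_simps)
    qed
    also have "\<dots> = \<Lambda>\<^sup>2 * ee + 2 * \<Lambda> * (p * ((- vv - nn / p\<^sup>2) / 2) + c0 * eu) + p\<^sup>2 * XX
      + 2 * c0 * p * ((m * vv - sn / p\<^sup>2) / 2) + c0\<^sup>2 * uu"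
      unfolding e\<Xi>[symmetric] u\<Xi>[symmetric] ee_def eu_def uu_def XX_def
      by (simp only: sum.distrib sum_distrib_left[symmetric])
    finally show ?thesis .
  qed
  \<comment> \<open>The pair forms, summed over all ordered pairs including the diagonal.\<close>
  have pairs: "0 \<le> p / m * (2 * S * uu) - p * m * vv + m / p * nn + 2 / p * sn - 2 * m / (m - 1) * UU"
  proof -
    have "0 \<le> (\<Sum>x\<in>X. \<Sum>y\<in>X. c x * c y * ((p / m) * (ip (u x) (u x) + ip (u y) (u y)) - p * m * ip (v x y) (v x y)
      + (m / p) * ip (n x y) (n x y) + (2 / p) * ip (u x - swap x y (u y)) (n x y) - (2 * m / (m - 1)) * ip (uh x) (uh y)))"
      unfolding uh_def by (intro sum_nonneg mult_nonneg_nonneg[of "c _ * c _"] mult_nonneg_nonneg[of "c _" "c _"] c pair_form_nonneg)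
    also have "\<dots> = (\<Sum>x\<in>X. \<Sum>y\<in>X. (p / m) * (c y * (c x * ip (u x) (u x)) + c x * (c y * ip (u y) (u y)))
      - p * m * (c x * c y * ip (v x y) (v x y)) + (m / p) * (c x * c y * ip (n x y) (n x y))
      + (2 / p) * (c x * c y * ip (u x - swap x y (u y)) (n x y)) - (2 * m / (m - 1)) * (c x * c y * ip (uh x) (uh y)))"
    proof -
      have "a * b * (r1 * (k1 + k2) - r2 * k3 + r4 * k4 + r5 * k5 - r6 * k6)
        = r1 * (b * (a * k1) + a * (b * k2)) - r2 * (a * b * k3) + r4 * (a * b * k4) + r5 * (a * b * k5) - r6 * (a * b * k6)"
        for a b r1 r2 r4 r5 r6 k1 k2 k3 k4 k5 k6 :: real
        by (simp add: algebra_simps)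
      then show ?thesis by (simp only:)
    qed
    also have "\<dots> = (p / m) * (S * uu + S * uu) - p * m * vv + (m / p) * nn + (2 / p) * sn - (2 * m / (m - 1)) * UU"
    proof -
      have "(\<Sum>x\<in>X. \<Sum>y\<in>X. c y * (c x * ip (u x) (u x))) = S * uu"
        by (simp add: S_def uu_def sum_distrib_left[symmetric] sum_distrib_right[symmetric])
      moreover have "(\<Sum>x\<in>X. \<Sum>y\<in>X. c x * (c y * ip (u y) (u y))) = S * uu"
        by (simp add: S_def uu_def sum_distrib_left[symmetric] sum_distrib_right[symmetric])
      ultimately show ?thesis
        unfolding vv_def nn_def sn_def UU
        by (simp only: sum.distrib sum_subtractf sum_distrib_left[symmetric])
    qed
    finally show ?thesis by (simp add: mult.assoc)
  qed
  \<comment> \<open>The triple forms, summed over all ordered triples; cyclic rotation of the summation indices identifies the three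
terms of each kind.\<close>
  have triples: "0 \<le> p\<^sup>2 * (S * (vv + nn / p ^ 4) / 2 - XX) + (1 - 1 / p\<^sup>2) * S * nn / 2"
  proof -
    define T where "T F = (\<Sum>x\<in>X. \<Sum>y\<in>X. \<Sum>z\<in>X. c x * c y * c z * F x y z)" for F :: "'a \<Rightarrow> 'a \<Rightarrow> 'a \<Rightarrow> real"
    have Tlin: "T (\<lambda>x y z. F x y z + G x y z) = T F + T G" "T (\<lambda>x y z. F x y z - G x y z) = T F - T G"
      "T (\<lambda>x y z. r * F x y z) = r * T F" for F G r
      by (simp_all add: T_def distrib_left right_diff_distrib sum.distrib sum_subtractf sum_distrib_left mult.left_commute)
    have rot: "T (\<lambda>x y z. F y z x) = T F" for F
    proof -
      have "T (\<lambda>x y z. F y z x) = (\<Sum>y\<in>X. \<Sum>x\<in>X. \<Sum>z\<in>X. c x * c y * c z * F y z x)"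
        unfolding T_def by (rule sum.swap)
      also have "\<dots> = (\<Sum>y\<in>X. \<Sum>z\<in>X. \<Sum>x\<in>X. c x * c y * c z * F y z x)"
        by (intro sum.cong refl sum.swap)
      also have "\<dots> = T F"
        unfolding T_def by (intro sum.cong refl) (simp add: mult_ac)
      finally show ?thesis .
    qed
    have two: "T (\<lambda>x y z. F x y) = S * (\<Sum>x\<in>X. \<Sum>y\<in>X. c x * c y * F x y)" for F
      unfolding T_def S_def sum_distrib_left sum_distrib_right
      by (intro sum.cong refl) (simp add: sum_distrib_left sum_distrib_right mult_ac)
    have XXT: "T (\<lambda>x y z. ip (\<xi> x y) (\<xi> x z)) = XX"
      unfolding T_def XX
    proof (intro sum.cong refl)
      fix x y z
      show "c x * c y * c z * ip (\<xi> x y) (\<xi> x z) = c x * c y * c z * ip (\<xi> x z) (\<xi> x y)"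
        by (simp only: ip_sym[of "\<xi> x y" "\<xi> x z"])
    qed
    have xx: "(\<Sum>x\<in>X. \<Sum>y\<in>X. c x * c y * ip (\<xi> x y) (\<xi> x y)) = vv + nn / p ^ 4"
      unfolding vv_def nn_def sum_divide_distrib sum.distrib[symmetric]
      by (intro sum.cong refl) (simp add: \<xi>_norm distrib_left)
    have "0 \<le> T (\<lambda>x y z. p\<^sup>2 * (ip (\<xi> x y) (\<xi> x y) + ip (\<xi> y z) (\<xi> y z) + ip (\<xi> z x) (\<xi> z x)
      - 2 * ip (\<xi> x y) (\<xi> x z) - 2 * ip (\<xi> y z) (\<xi> y x) - 2 * ip (\<xi> z x) (\<xi> z y))
      + (1 - 1 / p\<^sup>2) * (ip (n x y) (n x y) + ip (n y z) (n y z) + ip (n z x) (n z x)))"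
      unfolding T_def
      by (intro sum_nonneg mult_nonneg_nonneg[of "c _ * c _ * c _"] mult_nonneg_nonneg[of "c _ * c _" "c _"]
          mult_nonneg_nonneg[of "c _" "c _"] c triple_form_nonneg)
    also have "\<dots> = p\<^sup>2 * (3 * (S * (vv + nn / p ^ 4)) - 6 * XX) + (1 - 1 / p\<^sup>2) * (3 * (S * nn))"
    proof -
      have r: "T (\<lambda>x y z. F y z) = T (\<lambda>x y z. F x y)" "T (\<lambda>x y z. F z x) = T (\<lambda>x y z. F x y)" for F
        using rot[of "\<lambda>x y z. F x y"] rot[of "\<lambda>x y z. F y z"] by simp_all
      have r3: "T (\<lambda>x y z. F y z x) = T F" "T (\<lambda>x y z. F z x y) = T F" for F
        using rot[of F] rot[of "\<lambda>x y z. F y z x"] by simp_all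
      show ?thesis
        unfolding Tlin
        unfolding r[of "\<lambda>x y. ip (\<xi> x y) (\<xi> x y)"] r[of "\<lambda>x y. ip (n x y) (n x y)"]
          r3[of "\<lambda>x y z. ip (\<xi> x y) (\<xi> x z)"] two xx XXT nn_def[symmetric]
        by (simp add: algebra_simps)
    qed
    finally have "0 \<le> (p\<^sup>2 * (3 * (S * (vv + nn / p ^ 4)) - 6 * XX) + (1 - 1 / p\<^sup>2) * (3 * (S * nn))) / 6"
      by simp
    also have "\<dots> = p\<^sup>2 * (S * (vv + nn / p ^ 4) / 2 - XX) + (1 - 1 / p\<^sup>2) * S * nn / 2"
    proof -
      have "(k * (3 * a - 6 * b) + l * (3 * (S * d))) / 6 = k * (a / 2 - b) + l * S * d / 2" for k a b l d
        by (simp add: field_simps)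
      then show ?thesis by blast
    qed
    finally show ?thesis .
  qed
  have \<Lambda>: "\<Lambda> = c0 * m + p * S"
    by (simp only: \<Lambda>_def)
  have k: "0 \<le> c0 * (m - 1) / m" "0 \<le> c0 / 2"
    using c0 m_ge by simp_all
  show ?thesis
    unfolding ee_def[symmetric] uu_def[symmetric] vv_def[symmetric] nn_def[symmetric]
      assembly_identity[OF m_ge p_def \<Lambda>, of "ip q q" ee nn vv uu eu UU XX sn]
    by (rule add_nonneg_nonneg[OF add_nonneg_nonneg[OF add_nonneg_nonneg[OF mult_nonneg_nonneg[OF k(1) sq0] sq1]
          mult_nonneg_nonneg[OF k(2) pairs]] triples])
qed

text \<open>The bounds \<open>pair_bounds\<close> for the block \<open>B\<close> itself eliminate \<open>ip f (swap x y f)\<close> and leave the distance between the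
projection of \<open>f\<close> at \<open>x\<close> and the transposed projection at \<open>y\<close>, which splits orthogonally into the parts
\<open>w\<close>, \<open>n\<close> and \<open>v\<close>.\<close>

lemma bracket_bound:
  assumes x: "x \<in> X" and y: "y \<in> X" and xy: "x \<noteq> y"
  shows "p * (ip f f - ip (avg (insert x (insert y B)) f) (avg (insert x (insert y B)) f))
      - m * ((ip f f - ip (avg (insert x B) f) (avg (insert x B) f)) + (ip f f - ip (avg (insert y B) f) (avg (insert y B) f)))
    \<le> (m / p) * (ip (n x y) (n x y) + p\<^sup>2 * ip (v x y) (v x y))"
proof -
  define a b h where "a = avg (insert x B) f" and "b = avg (insert y B) f" and "h = avg (insert x (insert y B)) f"
  note gram = pair_gram[OF B(1) pt(1,2)[OF x] pt(1,2)[OF y] xy f, folded a_def b_def h_def m_def]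
  note bnd = pair_bounds[OF B(1) pt(1,2)[OF x] pt(1,2)[OF y] xy f, folded a_def b_def h_def m_def p_def]
  define G Y K H E where "G = ip f f" and "Y = ip f (swap x y f)" and "K = ip a (swap x y f)"
    and "H = ip h h" and "E = ip a a + ip b b"
  define r where "r = (m / p) * (E - 2 * K)"
  have "m * (E - 2 * K) \<le> p * (G - Y)"
    using bnd(1) by (simp add: G_def Y_def K_def E_def)
  then have r1: "r \<le> G - Y"
    using p_ge by (simp add: r_def field_simps)
  have r2: "m * r = m * (E - 2 * K) - r"
    using p_ge by (simp add: r_def p_def field_simps)
  have r3: "m * (E + 2 * K - 4 * H) \<le> (m - 1) * (G + Y - 2 * H)"
    using bnd(2)[OF B(2)] by (simp add: G_def Y_def K_def E_def H_def)
  have "0 \<le> (m - 1) * (G - Y - r)"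
    using r1 m_ge by (intro mult_nonneg_nonneg) auto
  then have "p * (G - H) - m * ((G - ip a a) + (G - ip b b)) \<le> r"
    using r2 r3 unfolding p_def E_def by (simp add: algebra_simps)
  also have "E - 2 * K = ip (a - swap x y b) (a - swap x y b)"
    using gram(4) by (simp add: E_def K_def ip_diff_left ip_diff_right ip_sym[of "swap x y b" a] ip_act swap_permutes pt x y)
  then have "r = (m / p) * ip (a - swap x y b) (a - swap x y b)"
    by (simp only: r_def)
  also have "ip (a - swap x y b) (a - swap x y b) = ip (n x y) (n x y) + p\<^sup>2 * ip (v x y) (v x y)"
  proof -
    let ?\<eta> = "\<eta> x - swap x y (\<eta> y)" and ?e = "e x - swap x y (e y)"
    have "avg (insert hub (insert x B)) ?\<eta> = ?\<eta>"
      by (simp add: avg_linear[OF sub(3)[OF x]] avg_\<eta>[OF x] avg_\<eta>[OF y] swap_move_props(2)[OF x y])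
    moreover have "avg (insert hub (insert x B)) ?e = 0"
      using pt[OF x] pt[OF y] by (simp add: avg_linear[OF sub(3)[OF x]] e_props(2)[OF x] e_props(2)[OF y] swap_move_props(2)[OF x y] swap_linear)
    ultimately have orth: "ip ?\<eta> ?e = 0"
      using ip_avg[OF sub(3)[OF x], of ?\<eta> ?e] by (simp add: ip_zero_right)
    have "a - swap x y b = ?\<eta> + ?e"
      using pt[OF x] pt[OF y] by (simp add: a_def b_def e_def swap_linear)
    then have "ip (a - swap x y b) (a - swap x y b) = ip ?\<eta> ?\<eta> + ip ?e ?e"
      using orth by (simp add: ip_add_left ip_add_right ip_sym[of ?e ?\<eta>])
    also have "\<dots> = ip (w x y) (w x y) + ip (n x y) (n x y) + ip (v x y) (v x y)"
      by (simp add: \<eta>_diff_norm[OF x y] e_diff_norm[OF x y])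
    also have "ip (w x y) (w x y) = (p\<^sup>2 - 1) * ip (v x y) (v x y)"
    proof -
      have "p\<^sup>2 - 1 = m * (m + 2)"
        by (simp add: p_def power2_eq_square algebra_simps)
      moreover have "m * (m + 2) \<noteq> 0"
        using m_ge by simp
      ultimately show ?thesis
        unfolding v_props(4)[OF x y] by simp
    qed
    finally show ?thesis by (simp add: algebra_simps)
  qed
  finally show ?thesis
    by (simp only: G_def H_def a_def b_def h_def)
qed

text \<open>After \<open>bracket_bound\<close> only norms of \<open>q\<close>, \<open>e\<close>, \<open>u\<close>, \<open>v\<close>, \<open>n\<close> remain, and \<open>m\<close> times the expression of
\<open>core_inequality\<close>, divided by \<open>\<Lambda>\<close>, is exactly the resulting lower bound. If \<open>\<Lambda>\<close> is zero, all weights are.\<close>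

theorem star_inequality:
  assumes fin: "finite X" and c: "\<And>x. x \<in> X \<Longrightarrow> 0 \<le> c x" and c0: "0 \<le> c0"
  defines "N \<equiv> c0 * (m - 1) + m * (\<Sum>x\<in>X. c x)"
    and "Q \<equiv> \<lambda>A. ip f f - ip (avg A f) (avg A f)"
  shows "0 \<le> N * (c0 * m * Q (insert hub B) + (\<Sum>x\<in>X. c x * (p * Q (insert hub (insert x B)) - m * Q (insert x B))))
    - (\<Sum>x\<in>X. (c x)\<^sup>2 * (m * Q (insert x B))) - c0 * (\<Sum>x\<in>X. c x * (m * Q (insert x B)))
    - (\<Sum>x\<in>X. \<Sum>y\<in>X - {x}. c x * c y * (p * Q (insert x (insert y B)))) / 2"
proof -
  define S where "S = (\<Sum>x\<in>X. c x)"
  define \<Lambda> where "\<Lambda> = c0 * m + p * S"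
  define qq where "qq = ip q q"
  define ee where "ee = (\<Sum>x\<in>X. c x * ip (e x) (e x))"
  define uu where "uu = (\<Sum>x\<in>X. c x * ip (u x) (u x))"
  define vv where "vv = (\<Sum>x\<in>X. \<Sum>y\<in>X. c x * c y * ip (v x y) (v x y))"
  define nn where "nn = (\<Sum>x\<in>X. \<Sum>y\<in>X. c x * c y * ip (n x y) (n x y))"
  define cQ where "cQ = (\<Sum>x\<in>X. c x * Q (insert x B))"
  define ccQ where "ccQ = (\<Sum>x\<in>X. (c x)\<^sup>2 * Q (insert x B))"
  define D where "D = (m - 1) / m * \<Lambda> * c0 * qq + \<Lambda> * ee - (nn + p\<^sup>2 * vv) / (2 * p) - c0 / m * uu"
  have S0: "0 \<le> S" unfolding S_def by (intro sum_nonneg c)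
  have D: "0 \<le> D"
  proof (cases "\<Lambda> = 0")
    case True
    have "0 \<le> c0 * m" "0 \<le> p * S" using S0 c0 m_ge p_ge by auto
    then have "c0 * m = 0" "p * S = 0" using True unfolding \<Lambda>_def by linarith+
    then have "c0 = 0" "S = 0" using m_ge p_ge by auto
    then have "c x = 0" if "x \<in> X" for x
      using that sum_nonneg_eq_0_iff[OF fin, of c] c unfolding S_def by auto
    then show ?thesis
      using \<open>c0 = 0\<close> by (simp add: D_def ee_def nn_def vv_def uu_def)
  next
    case False
    then have "\<Lambda> > 0" using S0 c0 m_ge p_ge unfolding \<Lambda>_def by (simp add: add_nonneg_nonneg order_less_le)
    moreover have "0 \<le> \<Lambda> * D"
      using core_inequality[of c c0, OF c c0] unfolding D_def \<Lambda>_def S_def qq_def ee_def nn_def vv_def uu_def by blast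
    ultimately show ?thesis by (simp add: zero_le_mult_iff)
  qed
  have Qhub: "Q (insert hub B) = qq"
    using ip_f by (simp add: Q_def g_def[symmetric] qq_def)
  have Qx: "Q (insert hub (insert x B)) = Q (insert x B) + ip (e x) (e x)"
    "Q (insert x B) = ip (u x) (u x) + qq - ip (e x) (e x)" if x: "x \<in> X" for x
    using e_props(3)[OF x] u_props(3)[OF x] ip_f by (simp_all add: Q_def \<eta>_f[OF x, symmetric] qq_def)
  have cQ: "cQ = uu + S * qq - ee"
    unfolding cQ_def uu_def ee_def S_def sum_distrib_right sum.distrib[symmetric] sum_subtractf[symmetric]
    by (intro sum.cong refl) (simp add: Qx(2) algebra_simps)
  have pairs: "(\<Sum>x\<in>X. \<Sum>y\<in>X - {x}. c x * c y * (p * Q (insert x (insert y B)))) / 2 \<le> m * (S * cQ - ccQ) + (m / p) * ((nn + p\<^sup>2 * vv) / 2)"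
  proof -
    have "(\<Sum>x\<in>X. \<Sum>y\<in>X - {x}. c x * c y * (p * Q (insert x (insert y B))))
      \<le> (\<Sum>x\<in>X. \<Sum>y\<in>X - {x}. c x * c y * (m * (Q (insert x B) + Q (insert y B)) + (m / p) * (ip (n x y) (n x y) + p\<^sup>2 * ip (v x y) (v x y))))"
    proof (intro sum_mono mult_left_mono)
      fix x y assume xy: "x \<in> X" "y \<in> X - {x}"
      then have "x \<noteq> y" "y \<in> X" by auto
      from bracket_bound[OF xy(1) this(2,1)]
      show "p * Q (insert x (insert y B)) \<le> m * (Q (insert x B) + Q (insert y B)) + (m / p) * (ip (n x y) (n x y) + p\<^sup>2 * ip (v x y) (v x y))"
        unfolding Q_def by linarith
      show "0 \<le> c x * c y" using xy c by auto
    qed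
    also have "\<dots> = (\<Sum>x\<in>X. (\<Sum>y\<in>X. c x * c y * (m * (Q (insert x B) + Q (insert y B)) + (m / p) * (ip (n x y) (n x y) + p\<^sup>2 * ip (v x y) (v x y))))
        - 2 * m * ((c x)\<^sup>2 * Q (insert x B)))"
      by (intro sum.cong refl)
        (simp add: sum_diff1[OF fin] n_props(3) v_props(3) ip_zero_left power2_eq_square algebra_simps)
    also have "\<dots> = (\<Sum>x\<in>X. \<Sum>y\<in>X. c x * c y * (m * (Q (insert x B) + Q (insert y B)) + (m / p) * (ip (n x y) (n x y) + p\<^sup>2 * ip (v x y) (v x y))))
        - 2 * m * ccQ"
      by (simp only: sum_subtractf sum_distrib_left ccQ_def)
    also have "(\<Sum>x\<in>X. \<Sum>y\<in>X. c x * c y * (m * (Q (insert x B) + Q (insert y B)) + (m / p) * (ip (n x y) (n x y) + p\<^sup>2 * ip (v x y) (v x y))))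
      = (\<Sum>x\<in>X. \<Sum>y\<in>X. m * (c y * (c x * Q (insert x B)) + c x * (c y * Q (insert y B)))
          + (m / p) * (c x * c y * ip (n x y) (n x y) + p\<^sup>2 * (c x * c y * ip (v x y) (v x y))))"
    proof -
      have "a * b * (r * (k1 + k2) + s * (k3 + t * k4)) = r * (b * (a * k1) + a * (b * k2)) + s * (a * b * k3 + t * (a * b * k4))"
        for a b r s t k1 k2 k3 k4 :: real
        by (simp add: algebra_simps)
      then show ?thesis by (simp only:)
    qed
    also have "\<dots> = m * (S * cQ + S * cQ) + (m / p) * (nn + p\<^sup>2 * vv)"
    proof -
      have "(\<Sum>x\<in>X. \<Sum>y\<in>X. c y * (c x * Q (insert x B))) = S * cQ"
        by (simp add: S_def cQ_def sum_distrib_left[symmetric] sum_distrib_right[symmetric])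
      moreover have "(\<Sum>x\<in>X. \<Sum>y\<in>X. c x * (c y * Q (insert y B))) = S * cQ"
        by (simp add: S_def cQ_def sum_distrib_left[symmetric] sum_distrib_right[symmetric])
      ultimately show ?thesis
        unfolding vv_def nn_def by (simp only: sum.distrib sum_distrib_left[symmetric])
    qed
    finally have "(\<Sum>x\<in>X. \<Sum>y\<in>X - {x}. c x * c y * (p * Q (insert x (insert y B))))
      \<le> m * (S * cQ + S * cQ) + (m / p) * (nn + p\<^sup>2 * vv) - 2 * m * ccQ" .
    moreover have "m * (S * cQ - ccQ) + (m / p) * ((nn + p\<^sup>2 * vv) / 2)
        = (m * (S * cQ + S * cQ) + (m / p) * (nn + p\<^sup>2 * vv) - 2 * m * ccQ) / 2"
    proof -
      have "a * (s - t) + k * (z / 2) = (a * (s + s) + k * z - 2 * a * t) / 2" for a s t k z :: real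
        by (simp add: field_simps)
      then show ?thesis .
    qed
    ultimately show ?thesis by (simp only: divide_right_mono zero_le_numeral)
  qed
  have sums: "(\<Sum>x\<in>X. c x * (p * Q (insert hub (insert x B)) - m * Q (insert x B))) = cQ + p * ee"
    unfolding cQ_def ee_def sum_distrib_left sum.distrib[symmetric]
    by (intro sum.cong refl) (simp add: Qx(1) p_def algebra_simps)
  have sums': "(\<Sum>x\<in>X. (c x)\<^sup>2 * (m * Q (insert x B))) = m * ccQ" "(\<Sum>x\<in>X. c x * (m * Q (insert x B))) = m * cQ"
    by (simp_all add: ccQ_def cQ_def sum_distrib_left mult.left_commute)
  have "m * D = N * (c0 * m * qq + (cQ + p * ee)) - m * ccQ - c0 * (m * cQ) - (m * (S * cQ - ccQ) + (m / p) * ((nn + p\<^sup>2 * vv) / 2))"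
  proof -
    have "m * D = (m - 1) * \<Lambda> * c0 * qq + m * \<Lambda> * ee - (m / p) * ((nn + p\<^sup>2 * vv) / 2) - c0 * uu"
      using m_ge p_ge by (simp add: D_def field_simps)
    also have "\<dots> = N * (c0 * m * qq + (cQ + p * ee)) - m * ccQ - c0 * (m * cQ) - (m * (S * cQ - ccQ) + (m / p) * ((nn + p\<^sup>2 * vv) / 2))"
      unfolding N_def S_def[symmetric] cQ \<Lambda>_def p_def by (simp add: algebra_simps)
    finally show ?thesis .
  qed
  moreover have "0 \<le> m * D"
    using D m_ge by simp
  ultimately show ?thesis
    using pairs unfolding Qhub sums sums' by linarith
qed

end

context perm_rep begin

section \<open>The octopus inequality\<close>

definition cyc :: "'a \<Rightarrow> 'a \<Rightarrow> 'a \<Rightarrow> 'v \<Rightarrow> 'v"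
  where "cyc a b c x = swap a b (swap b c x)"

text \<open>In the group algebra of the permutations of four points this is \<open>12\<close> times the central idempotent of the irreducible
representation of dimension two.\<close>

definition quad :: "'a \<Rightarrow> 'a \<Rightarrow> 'a \<Rightarrow> 'a \<Rightarrow> 'v \<Rightarrow> 'v"
  where "quad i j k l x = 2 *\<^sub>R x
    + 2 *\<^sub>R (swap i j (swap k l x) + swap i k (swap j l x) + swap i l (swap j k x))
    - (cyc i j k x + cyc i k j x + cyc i j l x + cyc i l j x + cyc i k l x + cyc i l k x + cyc j k l x + cyc j l k x)"

lemma quad_linear:
  assumes "i \<in> \<Omega>" "j \<in> \<Omega>" "k \<in> \<Omega>" "l \<in> \<Omega>"
  shows "quad i j k l (x - y) = quad i j k l x - quad i j k l y"
    and "quad i j k l (r *\<^sub>R x) = r *\<^sub>R quad i j k l x"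
  using assms by (simp_all add: quad_def cyc_def swap_linear algebra_simps)

lemma cyc_relations:
  assumes "i \<in> \<Omega>" "j \<in> \<Omega>" "k \<in> \<Omega>" "l \<in> \<Omega>" "distinct [i, j, k, l]"
  shows "cyc i j k (cyc i j k x) = cyc i k j x" "cyc i j k (cyc i k j x) = x"
    and "cyc i j k (swap i j (swap k l x)) = cyc i k l x"
    and "cyc i j k (swap i k (swap j l x)) = cyc j l k x"
    and "cyc i j k (swap i l (swap j k x)) = cyc i l j x"
    and "cyc i k j (swap i j (swap k l x)) = cyc j k l x"
    and "cyc i k j (swap i k (swap j l x)) = cyc i j l x"
    and "cyc i k j (swap i l (swap j k x)) = cyc i l k x"
    and "swap i j (swap k l (cyc i j k x)) = cyc i j k (swap i k (swap j l x))"
    and "swap i k (swap j l (cyc i j k x)) = cyc i j k (swap i l (swap j k x))"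
    and "swap i l (swap j k (cyc i j k x)) = cyc i j k (swap i j (swap k l x))"
    and "swap i j (swap k l (swap i k (swap j l x))) = swap i l (swap j k x)"
    and "swap i j (swap k l (swap i l (swap j k x))) = swap i k (swap j l x)"
    and "swap i k (swap j l (swap i j (swap k l x))) = swap i l (swap j k x)"
    and "swap i k (swap j l (swap i l (swap j k x))) = swap i j (swap k l x)"
    and "swap i l (swap j k (swap i j (swap k l x))) = swap i k (swap j l x)"
    and "swap i l (swap j k (swap i k (swap j l x))) = swap i j (swap k l x)"
    and "swap i j (swap k l (swap i j (swap k l x))) = x"
    and "swap i k (swap j l (swap i k (swap j l x))) = x"
    and "swap i l (swap j k (swap i l (swap j k x))) = x"
proof -
  note fold = act_comp[symmetric] swap_permutes permutes_compose assms(1-4) cyc_def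
  let ?t = Transposition.transpose
  have eqs: "?t i j \<circ> (?t j k \<circ> (?t i j \<circ> ?t j k)) = ?t i k \<circ> ?t k j"
    "?t i j \<circ> (?t j k \<circ> (?t i k \<circ> ?t k j)) = id"
    "?t i j \<circ> (?t j k \<circ> (?t i j \<circ> ?t k l)) = ?t i k \<circ> ?t k l"
    "?t i j \<circ> (?t j k \<circ> (?t i k \<circ> ?t j l)) = ?t j l \<circ> ?t l k"
    "?t i j \<circ> (?t j k \<circ> (?t i l \<circ> ?t j k)) = ?t i l \<circ> ?t l j"
    "?t i k \<circ> (?t k j \<circ> (?t i j \<circ> ?t k l)) = ?t j k \<circ> ?t k l"
    "?t i k \<circ> (?t k j \<circ> (?t i k \<circ> ?t j l)) = ?t i j \<circ> ?t j l"
    "?t i k \<circ> (?t k j \<circ> (?t i l \<circ> ?t j k)) = ?t i l \<circ> ?t l k"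
    "?t i j \<circ> (?t k l \<circ> (?t i j \<circ> ?t j k)) = ?t i j \<circ> (?t j k \<circ> (?t i k \<circ> ?t j l))"
    "?t i k \<circ> (?t j l \<circ> (?t i j \<circ> ?t j k)) = ?t i j \<circ> (?t j k \<circ> (?t i l \<circ> ?t j k))"
    "?t i l \<circ> (?t j k \<circ> (?t i j \<circ> ?t j k)) = ?t i j \<circ> (?t j k \<circ> (?t i j \<circ> ?t k l))"
    "?t i j \<circ> (?t k l \<circ> (?t i k \<circ> ?t j l)) = ?t i l \<circ> ?t j k"
    "?t i j \<circ> (?t k l \<circ> (?t i l \<circ> ?t j k)) = ?t i k \<circ> ?t j l"
    "?t i k \<circ> (?t j l \<circ> (?t i j \<circ> ?t k l)) = ?t i l \<circ> ?t j k"
    "?t i k \<circ> (?t j l \<circ> (?t i l \<circ> ?t j k)) = ?t i j \<circ> ?t k l"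
    "?t i l \<circ> (?t j k \<circ> (?t i j \<circ> ?t k l)) = ?t i k \<circ> ?t j l"
    "?t i l \<circ> (?t j k \<circ> (?t i k \<circ> ?t j l)) = ?t i j \<circ> ?t k l"
    "?t i j \<circ> (?t k l \<circ> (?t i j \<circ> ?t k l)) = id"
    "?t i k \<circ> (?t j l \<circ> (?t i k \<circ> ?t j l)) = id"
    "?t i l \<circ> (?t j k \<circ> (?t i l \<circ> ?t j k)) = id"
    using assms(5) by (auto simp: fun_eq_iff Transposition.transpose_def)
  show "cyc i j k (cyc i j k x) = cyc i k j x" using eqs(1) by (simp add: fold)
  show "cyc i j k (cyc i k j x) = x" using eqs(2) by (simp add: fold act_id)
  show "cyc i j k (swap i j (swap k l x)) = cyc i k l x" using eqs(3) by (simp add: fold)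
  show "cyc i j k (swap i k (swap j l x)) = cyc j l k x" using eqs(4) by (simp add: fold)
  show "cyc i j k (swap i l (swap j k x)) = cyc i l j x" using eqs(5) by (simp add: fold)
  show "cyc i k j (swap i j (swap k l x)) = cyc j k l x" using eqs(6) by (simp add: fold)
  show "cyc i k j (swap i k (swap j l x)) = cyc i j l x" using eqs(7) by (simp add: fold)
  show "cyc i k j (swap i l (swap j k x)) = cyc i l k x" using eqs(8) by (simp add: fold)
  show "swap i j (swap k l (cyc i j k x)) = cyc i j k (swap i k (swap j l x))" using eqs(9) by (simp add: fold)
  show "swap i k (swap j l (cyc i j k x)) = cyc i j k (swap i l (swap j k x))" using eqs(10) by (simp add: fold)
  show "swap i l (swap j k (cyc i j k x)) = cyc i j k (swap i j (swap k l x))" using eqs(11) by (simp add: fold)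
  show "swap i j (swap k l (swap i k (swap j l x))) = swap i l (swap j k x)" using eqs(12) by (simp add: fold)
  show "swap i j (swap k l (swap i l (swap j k x))) = swap i k (swap j l x)" using eqs(13) by (simp add: fold)
  show "swap i k (swap j l (swap i j (swap k l x))) = swap i l (swap j k x)" using eqs(14) by (simp add: fold)
  show "swap i k (swap j l (swap i l (swap j k x))) = swap i j (swap k l x)" using eqs(15) by (simp add: fold)
  show "swap i l (swap j k (swap i j (swap k l x))) = swap i k (swap j l x)" using eqs(16) by (simp add: fold)
  show "swap i l (swap j k (swap i k (swap j l x))) = swap i j (swap k l x)" using eqs(17) by (simp add: fold)
  show "swap i j (swap k l (swap i j (swap k l x))) = x" using eqs(18) by (simp add: fold act_id)
  show "swap i k (swap j l (swap i k (swap j l x))) = x" using eqs(19) by (simp add: fold act_id)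
  show "swap i l (swap j k (swap i l (swap j k x))) = x" using eqs(20) by (simp add: fold act_id)
qed

text \<open>On the image the double transpositions act trivially and a three-cycle \<open>c\<close> satisfies \<open>1 + c + c\<^sup>2 = 0\<close>.\<close>

lemma quad_image:
  assumes P: "i \<in> \<Omega>" "j \<in> \<Omega>" "k \<in> \<Omega>" "l \<in> \<Omega>" "distinct [i, j, k, l]"
    and x: "x = quad i j k l y"
  shows "swap i j (swap k l x) = x" "swap i k (swap j l x) = x" "swap i l (swap j k x) = x"
    and "cyc i j k x + cyc i k j x + cyc i j l x + cyc i l j x + cyc i k l x + cyc i l k x + cyc j k l x + cyc j l k x = - 4 *\<^sub>R x"
    and "quad i j k l x = 12 *\<^sub>R x"
proof -
  note rel = cyc_relations[OF P]
  define z where "z = y + swap i j (swap k l y) + swap i k (swap j l y) + swap i l (swap j k y)"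
  define c where "c = cyc i j k"
  have lin: "swap a b (y + y') = swap a b y + swap a b y'" "swap a b (y - y') = swap a b y - swap a b y'" "swap a b (r *\<^sub>R y) = r *\<^sub>R swap a b y"
    if "a \<in> {i,j,k,l}" "b \<in> {i,j,k,l}" for a b y y' r
  proof -
    have "a \<in> \<Omega>" "b \<in> \<Omega>" using that P by auto
    then show "swap a b (y + y') = swap a b y + swap a b y'" "swap a b (y - y') = swap a b y - swap a b y'" "swap a b (r *\<^sub>R y) = r *\<^sub>R swap a b y"
      by (fact swap_linear)+
  qed
  have clin: "c (y + y') = c y + c y'" "c (y - y') = c y - c y'" "c (r *\<^sub>R y) = r *\<^sub>R c y" for y y' r
    by (simp_all add: c_def cyc_def lin)
  have cc: "c (c y) = cyc i k j y" "c (c (c y)) = y" for y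
    by (simp_all add: c_def rel(1,2))
  have zs: "swap i j (swap k l z) = z" "swap i k (swap j l z) = z" "swap i l (swap j k z) = z"
    by (simp_all add: z_def lin rel(12-20))
  have xz: "x = 2 *\<^sub>R z - c z - c (c z)"
    unfolding cc(1) by (simp add: x quad_def z_def c_def[symmetric] clin)
      (simp add: c_def cyc_def[of i k j] lin, simp add: cyc_def[of i k j, symmetric] rel(3-8) algebra_simps)
  have dc: "swap i j (swap k l (c y)) = c (swap i k (swap j l y))" "swap i k (swap j l (c y)) = c (swap i l (swap j k y))"
    "swap i l (swap j k (c y)) = c (swap i j (swap k l y))" for y
    by (simp_all add: c_def rel(9-11))
  show d: "swap i j (swap k l x) = x" "swap i k (swap j l x) = x" "swap i l (swap j k x) = x"
    unfolding xz by (simp_all add: lin dc zs)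
  have sum0: "x + c x + c (c x) = 0"
    unfolding xz by (simp add: clin cc(2) scaleR_2)
  have r: "cyc i k l x = cyc i j k x" "cyc j l k x = cyc i j k x" "cyc i l j x = cyc i j k x"
    "cyc j k l x = cyc i k j x" "cyc i j l x = cyc i k j x" "cyc i l k x = cyc i k j x"
    using rel(3-8)[of x] unfolding d by simp_all
  have cs: "cyc i k l x = c x" "cyc j l k x = c x" "cyc i l j x = c x" "cyc i j k x = c x"
    "cyc j k l x = c (c x)" "cyc i j l x = c (c x)" "cyc i l k x = c (c x)" "cyc i k j x = c (c x)"
    unfolding cc(1) r by (simp_all add: c_def)
  show s8: "cyc i j k x + cyc i k j x + cyc i j l x + cyc i l j x + cyc i k l x + cyc i l k x + cyc j k l x + cyc j l k x = - 4 *\<^sub>R x"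
  proof -
    have four: "4 *\<^sub>R y = y + (y + (y + y))" for y :: 'v
      using scaleR_add_left[of 2 2 y] by (simp add: scaleR_2)
    have "cyc i j k x + cyc i k j x + cyc i j l x + cyc i l j x + cyc i k l x + cyc i l k x + cyc j k l x + cyc j l k x
      = 4 *\<^sub>R (x + c x + c (c x)) - 4 *\<^sub>R x"
      unfolding cs using four by (simp add: algebra_simps)
    then show ?thesis by (simp add: sum0)
  qed
  show "quad i j k l x = 12 *\<^sub>R x"
    unfolding quad_def s8 d by (simp add: scaleR_add_right) (simp flip: scaleR_add_left)
qed

lemma cyc_rotate:
  assumes "a \<in> \<Omega>" "b \<in> \<Omega>" "c \<in> \<Omega>" "distinct [a, b, c]"
  shows "cyc b c a x = cyc a b c x"
  using swap_braid(2)[of a c b x] assms by (auto simp: cyc_def transpose_commute)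

lemma ip_cyc:
  assumes "a \<in> \<Omega>" "b \<in> \<Omega>" "c \<in> \<Omega>" "distinct [a, b, c]"
  shows "ip (cyc a b c x) y = ip x (cyc a c b y)"
proof -
  have "ip (cyc a b c x) y = ip x (cyc c b a y)"
    using assms by (simp add: cyc_def ip_swap swap_commute[of c b] swap_commute[of b a])
  also have "cyc c b a y = cyc a c b y"
    using cyc_rotate[of a c b y] assms by auto
  finally show ?thesis .
qed

lemma swap_disjoint:
  assumes "a \<in> \<Omega>" "b \<in> \<Omega>" "c \<in> \<Omega>" "d \<in> \<Omega>" "distinct [a, b, c, d]"
  shows "swap a b (swap c d x) = swap c d (swap a b x)"
proof -
  have "Transposition.transpose a b \<circ> Transposition.transpose c d = Transposition.transpose c d \<circ> Transposition.transpose a b"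
    using assms(5) by (auto simp: fun_eq_iff Transposition.transpose_def)
  then show ?thesis
    using assms by (simp flip: act_comp[OF swap_permutes swap_permutes])
qed

lemma quad_symmetric:
  assumes "i \<in> \<Omega>" "j \<in> \<Omega>" "k \<in> \<Omega>" "l \<in> \<Omega>" "distinct [i, j, k, l]"
  shows "quad j i k l x = quad i j k l x" "quad i k j l x = quad i j k l x" "quad i j l k x = quad i j k l x"
proof -
  have r: "cyc j k i x = cyc i j k x" "cyc j i k x = cyc i k j x" "cyc j l i x = cyc i j l x" "cyc j i l x = cyc i l j x"
    "cyc k l j x = cyc j k l x" "cyc k j l x = cyc j l k x"
    using assms cyc_rotate[of i j k x] trans[OF cyc_rotate[of k j i x] cyc_rotate[of i k j x]]
      cyc_rotate[of i j l x] trans[OF cyc_rotate[of l j i x] cyc_rotate[of i l j x]]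
      cyc_rotate[of j k l x] trans[OF cyc_rotate[of l k j x] cyc_rotate[of j l k x]]
    by fastforce+
  have d: "swap j k (swap i l x) = swap i l (swap j k x)" "swap j l (swap i k x) = swap i k (swap j l x)"
    using assms by (auto intro!: swap_disjoint)
  show "quad j i k l x = quad i j k l x"
    unfolding quad_def r d swap_commute[of j i] by simp
  show "quad i k j l x = quad i j k l x"
    unfolding quad_def r swap_commute[of k j] by simp
  show "quad i j l k x = quad i j k l x"
    unfolding quad_def swap_commute[of l k] by simp
qed

lemma ip_quad:
  assumes "i \<in> \<Omega>" "j \<in> \<Omega>" "k \<in> \<Omega>" "l \<in> \<Omega>" "distinct [i, j, k, l]"
  shows "ip (quad i j k l x) y = ip x (quad i j k l y)"
proof -
  have d: "ip (swap i j (swap k l x)) y = ip x (swap i j (swap k l y))"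
    "ip (swap i k (swap j l x)) y = ip x (swap i k (swap j l y))"
    "ip (swap i l (swap j k x)) y = ip x (swap i l (swap j k y))"
    using assms swap_disjoint[of i j k l y] swap_disjoint[of i k j l y] swap_disjoint[of i l j k y]
    by (auto simp: ip_swap)
  have cy: "ip (cyc i j k x) y = ip x (cyc i k j y)" "ip (cyc i k j x) y = ip x (cyc i j k y)"
    "ip (cyc i j l x) y = ip x (cyc i l j y)" "ip (cyc i l j x) y = ip x (cyc i j l y)"
    "ip (cyc i k l x) y = ip x (cyc i l k y)" "ip (cyc i l k x) y = ip x (cyc i k l y)"
    "ip (cyc j k l x) y = ip x (cyc j l k y)" "ip (cyc j l k x) y = ip x (cyc j k l y)"
    using assms by (auto intro!: ip_cyc)
  show ?thesis
    unfolding quad_def by (simp add: ip_bilinear d cy)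
qed

text \<open>The operator is self-adjoint and its square is \<open>12\<close> times itself.\<close>

lemma quad_form_nonneg:
  assumes P: "i \<in> \<Omega>" "j \<in> \<Omega>" "k \<in> \<Omega>" "l \<in> \<Omega>" "distinct [i, j, k, l]"
  shows "0 \<le> ip x (quad i j k l x)"
proof -
  have "ip (quad i j k l x) (quad i j k l x) = 12 * ip x (quad i j k l x)"
    using ip_quad[OF P, of x "quad i j k l x"] quad_image(5)[OF P refl, of x] by (simp add: ip_scale_right)
  then show ?thesis
    using ip_nonneg[of "quad i j k l x"] by simp
qed

text \<open>The sum \<open>Z\<close> of the four operators with \<open>h\<close> is positive and acts as \<open>12\<close> on the image of the fifth, since every
double transposition that involves \<open>h\<close> becomes a three-cycle there. So the fifth operator is below \<open>Z\<close>.\<close>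

lemma quad_five:
  assumes P: "i \<in> \<Omega>" "j \<in> \<Omega>" "k \<in> \<Omega>" "l \<in> \<Omega>" "h \<in> \<Omega>" "distinct [h, i, j, k, l]"
  shows "ip f (quad i j k l f) \<le> ip f (quad h i j k f) + ip f (quad h i j l f) + ip f (quad h i k l f) + ip f (quad h j k l f)"
proof -
  define Z where "Z x = quad h i j k x + quad h i j l x + quad h i k l x + quad h j k l x" for x
  define x where "x = quad i j k l f"
  have P': "distinct [i, j, k, l]" using P by simp
  note img = quad_image[OF P(1-4) P' x_def]
  have sw: "swap k l x = swap i j x" "swap j l x = swap i k x" "swap j k x = swap i l x"
    using img(1-3) P by (metis swap_swap)+
  have dt: "swap h i (swap j k x) = cyc h i l x" "swap h j (swap i k x) = cyc h j l x" "swap h k (swap i j x) = cyc h k l x"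
    "swap h i (swap j l x) = cyc h i k x" "swap h j (swap i l x) = cyc h j k x" "swap h l (swap i j x) = cyc h l k x"
    "swap h i (swap k l x) = cyc h i j x" "swap h k (swap i l x) = cyc h k j x" "swap h l (swap i k x) = cyc h l j x"
    "swap h j (swap k l x) = cyc h j i x" "swap h k (swap j l x) = cyc h k i x" "swap h l (swap j k x) = cyc h l i x"
    unfolding cyc_def swap_commute[of l k] swap_commute[of k j] swap_commute[of l j] swap_commute[of j i] swap_commute[of k i] swap_commute[of l i] sw
    by (rule refl)+
  have Zx: "Z x = 12 *\<^sub>R x"
  proof -
    have eight: "8 *\<^sub>R x = 2 *\<^sub>R x + 2 *\<^sub>R x + 2 *\<^sub>R x + 2 *\<^sub>R x"
      by (simp flip: scaleR_add_left)
    have "Z x = 8 *\<^sub>R x - (cyc i j k x + cyc i k j x + cyc i j l x + cyc i l j x + cyc i k l x + cyc i l k x + cyc j k l x + cyc j l k x)"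
      unfolding Z_def quad_def dt eight by (simp add: algebra_simps scaleR_2)
    then show ?thesis
      unfolding img(4) by (simp add: scaleR_add_left[symmetric])
  qed
  have Q: "h \<in> \<Omega>" "distinct [h, i, j, k]" "distinct [h, i, j, l]" "distinct [h, i, k, l]" "distinct [h, j, k, l]"
    using P by auto
  have Zadj: "ip (Z a) b = ip a (Z b)" for a b
    unfolding Z_def by (simp only: ip_add_left ip_add_right ip_quad[OF Q(1) P(1-3) Q(2)] ip_quad[OF Q(1) P(1,2,4) Q(3)]
        ip_quad[OF Q(1) P(1,3,4) Q(4)] ip_quad[OF Q(1) P(2-4) Q(5)])
  have Zlin: "Z (a - r *\<^sub>R b) = Z a - r *\<^sub>R Z b" for a b r
    unfolding Z_def using P by (simp add: quad_linear algebra_simps)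
  have Zpos: "0 \<le> ip a (Z a)" for a
    unfolding Z_def ip_add_right
    by (intro add_nonneg_nonneg quad_form_nonneg P Q)
  have xx: "ip x x = 12 * ip f x"
    using ip_quad[OF P(1-4) P', of f x] img(5) unfolding x_def[symmetric] by (simp add: ip_scale_right)
  have "ip x (Z f) = 12 * ip f x"
    using Zadj[of x f] unfolding Zx by (simp add: ip_scale_left ip_sym[of x f])
  then have "0 \<le> ip f (Z f) - ip f x"
    using Zpos[of "f - (1/12) *\<^sub>R x"] unfolding Zlin Zx
    by (simp add: ip_diff_left ip_diff_right ip_scale_left ip_scale_right xx ip_sym[of x f])
  then show ?thesis
    unfolding Z_def x_def by (simp add: ip_add_right)
qed

definition edge_ip :: "'v \<Rightarrow> 'a \<Rightarrow> 'a \<Rightarrow> 'a \<Rightarrow> 'a \<Rightarrow> real"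
  where "edge_ip f i j k l = ip (swap i j f) (swap k l f)"

definition swap_ip :: "'v \<Rightarrow> 'a \<Rightarrow> 'a \<Rightarrow> real"
  where "swap_ip f i j = ip f (swap i j f)"

text \<open>The values on degenerate triples are such that the identity \<open>quad_ip_degenerate\<close> holds for all coincidences of indices.\<close>

definition tri_ip :: "'v \<Rightarrow> 'a \<Rightarrow> 'a \<Rightarrow> 'a \<Rightarrow> real"
  where "tri_ip f a b c = (if a = b then (ip f f + swap_ip f b c) / 2 else if a = c then (ip f f + swap_ip f a b) / 2
     else if b = c then (ip f f + swap_ip f a b) / 2 else ip f (cyc a b c f))"

definition quad_ip :: "'v \<Rightarrow> 'a \<Rightarrow> 'a \<Rightarrow> 'a \<Rightarrow> 'a \<Rightarrow> real"
  where "quad_ip f i j k l = (if distinct [i, j, k, l] then ip f (quad i j k l f) else 0)"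

lemma swap_ip_refl: "swap_ip f i i = ip f f"
  by (simp add: swap_ip_def act_id)

lemma swap_ip_simps:
  assumes "i \<in> \<Omega>" "j \<in> \<Omega>"
  shows "swap_ip f i j = swap_ip f j i"
    and "edge_ip f k k i j = swap_ip f i j" "edge_ip f i j k k = swap_ip f i j"
    and "edge_ip f i j i j = ip f f" "edge_ip f i j j i = ip f f"
  using assms by (simp_all add: swap_ip_def edge_ip_def act_id swap_commute[of j i] ip_swap swap_swap)

lemma edge_ip_swap:
  assumes "i \<in> \<Omega>" "j \<in> \<Omega>"
  shows "edge_ip f i j k l = ip f (swap i j (swap k l f))"
  using assms by (simp add: edge_ip_def ip_swap)

lemma tri_ip_simps:
  assumes "a \<in> \<Omega>" "b \<in> \<Omega>" "c \<in> \<Omega>" "a \<noteq> b" "a \<noteq> c" "b \<noteq> c"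
  shows "tri_ip f a b c = tri_ip f b a c" "tri_ip f a b c = tri_ip f a c b"
    and "edge_ip f a b a c = tri_ip f a b c" "edge_ip f a b c a = tri_ip f a b c"
    and "edge_ip f b a a c = tri_ip f a b c" "edge_ip f b a c a = tri_ip f a b c"
    and "ip f (cyc a b c f) = tri_ip f a b c" "ip f (cyc a c b f) = tri_ip f a b c"
proof -
  have rot: "ip f (cyc b c a f) = ip f (cyc a b c f)" "ip f (cyc c a b f) = ip f (cyc a b c f)"
    using cyc_rotate[of a b c f] cyc_rotate[of b c a f] assms by auto
  have rev: "ip f (cyc a c b f) = ip f (cyc a b c f)"
    using ip_cyc[of a b c f f] assms by (simp add: ip_sym[of "cyc a b c f" f])
  have rot': "ip f (cyc c b a f) = ip f (cyc a c b f)" "ip f (cyc b a c f) = ip f (cyc a c b f)"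
    using cyc_rotate[of a c b f] cyc_rotate[of c b a f] assms by auto
  show "tri_ip f a b c = tri_ip f b a c" "tri_ip f a b c = tri_ip f a c b"
    using assms rot' rev by (simp_all add: tri_ip_def)
  show "ip f (cyc a b c f) = tri_ip f a b c" "ip f (cyc a c b f) = tri_ip f a b c"
    using assms rev by (simp_all add: tri_ip_def)
  have "edge_ip f b a a c = tri_ip f a b c"
    using assms rot' rev by (simp add: edge_ip_swap tri_ip_def cyc_def)
  then show "edge_ip f a b a c = tri_ip f a b c" "edge_ip f a b c a = tri_ip f a b c"
    "edge_ip f b a a c = tri_ip f a b c" "edge_ip f b a c a = tri_ip f a b c"
    by (simp_all add: edge_ip_def swap_commute[of a b] swap_commute[of c a])
qed

lemma quad_ip_eq:
  assumes "i \<in> \<Omega>" "j \<in> \<Omega>" "k \<in> \<Omega>" "l \<in> \<Omega>" "distinct [i, j, k, l]"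
  shows "quad_ip f i j k l = 2 * ip f f + 2 * (edge_ip f i j k l + edge_ip f i k j l + edge_ip f i l j k)
    - 2 * (tri_ip f i j k + tri_ip f i j l + tri_ip f i k l + tri_ip f j k l)"
proof -
  have c: "ip f (cyc i j k f) = tri_ip f i j k" "ip f (cyc i k j f) = tri_ip f i j k"
    "ip f (cyc i j l f) = tri_ip f i j l" "ip f (cyc i l j f) = tri_ip f i j l"
    "ip f (cyc i k l f) = tri_ip f i k l" "ip f (cyc i l k f) = tri_ip f i k l"
    "ip f (cyc j k l f) = tri_ip f j k l" "ip f (cyc j l k f) = tri_ip f j k l"
    using assms by (auto intro!: tri_ip_simps(7,8))
  have e: "ip f (swap i j (swap k l f)) = edge_ip f i j k l" "ip f (swap i k (swap j l f)) = edge_ip f i k j l"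
    "ip f (swap i l (swap j k f)) = edge_ip f i l j k"
    using assms by (simp_all add: edge_ip_swap)
  show ?thesis
    using assms(5) unfolding quad_ip_def quad_def by (simp add: ip_bilinear c e)
qed

lemma tri_ip_degenerate:
  assumes "a \<in> \<Omega>" "b \<in> \<Omega>"
  shows "tri_ip f a a b = (ip f f + swap_ip f a b) / 2" "tri_ip f a b a = (ip f f + swap_ip f a b) / 2"
    "tri_ip f b a a = (ip f f + swap_ip f a b) / 2"
  using assms swap_ip_simps(1)[of a b f] by (auto simp: tri_ip_def swap_ip_refl)

text \<open>The correction terms are a sum over the six pairs of indices, so that tuples with several coincidences need no
separate formula.\<close>

lemma quad_ip_degenerate:
  assumes P: "i \<in> \<Omega>" "j \<in> \<Omega>" "k \<in> \<Omega>" "l \<in> \<Omega>"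
  shows "2 * ip f f + 2 * (edge_ip f i j k l + edge_ip f i k j l + edge_ip f i l j k)
    - 2 * (tri_ip f i j k + tri_ip f i j l + tri_ip f i k l + tri_ip f j k l) = quad_ip f i j k l
   + of_bool (i = j) * (2 * swap_ip f k l - swap_ip f i k - swap_ip f i l)
   + of_bool (i = k) * (2 * swap_ip f j l - swap_ip f i j - swap_ip f i l)
   + of_bool (i = l) * (2 * swap_ip f j k - swap_ip f i j - swap_ip f i k)
   + of_bool (j = k) * (2 * swap_ip f i l - swap_ip f i j - swap_ip f j l)
   + of_bool (j = l) * (2 * swap_ip f i k - swap_ip f i j - swap_ip f j k)
   + of_bool (k = l) * (2 * swap_ip f i j - swap_ip f i k - swap_ip f j k)"
proof (cases "distinct [i, j, k, l]")
  case True
  then show ?thesis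
    using quad_ip_eq[OF P True, of f] by simp
next
  case False
  have q: "quad_ip f i j k l = 0"
    using False by (simp only: quad_ip_def if_False)
  note P [simp] and swap_ip_refl [simp] and tri_ip_degenerate [simp] and swap_ip_simps [simp]
  have "i = j \<or> i = k \<or> i = l \<or> j = k \<or> j = l \<or> k = l" using False by auto
  then show ?thesis unfolding q
    apply (cases "i = j"; cases "i = k"; cases "i = l"; cases "j = k"; cases "j = l"; cases "k = l"; simp)
    by (simp_all add: tri_ip_simps field_simps)
qed

end

definition wsum :: "('b \<Rightarrow> real) \<Rightarrow> 'b set \<Rightarrow> ('b \<Rightarrow> real) \<Rightarrow> real"
  where "wsum w Y F = (\<Sum>i\<in>Y. w i * F i)"

lemma wsum_linear:
  "wsum w Y (\<lambda>i. F i + G i) = wsum w Y F + wsum w Y G"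
  "wsum w Y (\<lambda>i. F i - G i) = wsum w Y F - wsum w Y G"
  "wsum w Y (\<lambda>i. r * F i) = r * wsum w Y F"
  "wsum w Y (\<lambda>i. F i * r) = wsum w Y F * r"
  by (simp_all add: wsum_def distrib_left right_diff_distrib sum.distrib sum_subtractf sum_distrib_left sum_distrib_right mult_ac)

lemma wsum_const: "sum w Y = 0 \<Longrightarrow> wsum w Y (\<lambda>i. r) = 0"
  by (simp add: wsum_def flip: sum_distrib_right)

lemma wsum_diagonal: "finite Y \<Longrightarrow> wsum w Y (\<lambda>i. wsum w Y (\<lambda>j. of_bool (i = j))) = (\<Sum>i\<in>Y. (w i)\<^sup>2)"
  unfolding wsum_def by (intro sum.cong refl) (simp add: power2_eq_square of_bool_def if_distrib[of "(*) _"] cong: if_cong)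

lemma wsum_cong: "(\<And>i. i \<in> Y \<Longrightarrow> F i = G i) \<Longrightarrow> wsum w Y F = wsum w Y G"
  by (simp add: wsum_def)

context perm_rep begin

lemma quad_ip_nonneg:
  assumes "i \<in> \<Omega>" "j \<in> \<Omega>" "k \<in> \<Omega>" "l \<in> \<Omega>"
  shows "0 \<le> quad_ip f i j k l"
  using assms quad_form_nonneg[OF assms] by (simp add: quad_ip_def)

lemma quad_ip_symmetric:
  assumes "i \<in> \<Omega>" "j \<in> \<Omega>" "k \<in> \<Omega>" "l \<in> \<Omega>"
  shows "quad_ip f j i k l = quad_ip f i j k l" "quad_ip f i k j l = quad_ip f i j k l" "quad_ip f i j l k = quad_ip f i j k l"
  using quad_symmetric[OF assms, of f] by (auto simp: quad_ip_def)

lemma quad_ip_five: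
  assumes "i \<in> X" "j \<in> X" "k \<in> X" "l \<in> X" "X \<subseteq> \<Omega>" "h \<in> \<Omega>" "h \<notin> X"
  shows "quad_ip f i j k l \<le> quad_ip f h i j k + quad_ip f h i j l + quad_ip f h i k l + quad_ip f h j k l"
proof (cases "distinct [i, j, k, l]")
  case True
  then have "distinct [h, i, j, k, l]" using assms by auto
  with quad_five[of i j k l h f] assms show ?thesis
    unfolding quad_ip_def by auto
next
  case False
  then have "quad_ip f i j k l = 0" by (simp only: quad_ip_def if_False)
  then show ?thesis
    using assms by (simp add: quad_ip_nonneg subset_iff)
qed

text \<open>As the weights add up to zero, every term that misses one of the four indices drops out. There remain the products of
two transpositions, which add up to the square of \<open>W\<close>, and the terms that involve the two indices other than the
coincident pair.\<close>

lemma wsum_edge_square: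
  fixes f :: 'v
  assumes Y: "finite Y" "Y \<subseteq> \<Omega>" and w: "sum w Y = 0"
  defines "W \<equiv> \<Sum>i\<in>Y. \<Sum>j\<in>Y. (w i * w j) *\<^sub>R swap i j f"
  shows "wsum w Y (\<lambda>i. wsum w Y (\<lambda>j. wsum w Y (\<lambda>k. wsum w Y (\<lambda>l. quad_ip f i j k l))))
    = 6 * ip W W - 12 * (\<Sum>i\<in>Y. (w i)\<^sup>2) * wsum w Y (\<lambda>i. wsum w Y (\<lambda>j. swap_ip f i j))"
proof -
  define L where "L = wsum w Y"
  note lin = wsum_linear[of w Y, folded L_def] wsum_const[OF w, folded L_def]
  let ?E = "edge_ip f" and ?T = "tri_ip f" and ?s = "swap_ip f"
  have "ip W W = L (\<lambda>i. L (\<lambda>j. L (\<lambda>k. L (\<lambda>l. ?E k l i j))))"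
    by (simp add: W_def L_def wsum_def edge_ip_def ip_sum_left ip_sum_right ip_scale_left ip_scale_right sum_distrib_left mult_ac)
  also have "\<dots> = L (\<lambda>i. L (\<lambda>j. L (\<lambda>k. L (\<lambda>l. ?E i j k l))))"
    unfolding L_def edge_ip_def by (intro wsum_cong ip_sym)
  finally have W: "ip W W = L (\<lambda>i. L (\<lambda>j. L (\<lambda>k. L (\<lambda>l. ?E i j k l))))" .
  have W': "L (\<lambda>i. L (\<lambda>j. L (\<lambda>k. L (\<lambda>l. ?E i k j l)))) = ip W W"
    unfolding W L_def wsum_def sum_distrib_left
    by (rule sum.cong[OF refl], rule trans[OF sum.swap]) (simp add: mult_ac)
  have W'': "L (\<lambda>i. L (\<lambda>j. L (\<lambda>k. L (\<lambda>l. ?E i l j k)))) = ip W W"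
  proof -
    have "L (\<lambda>i. L (\<lambda>j. L (\<lambda>k. L (\<lambda>l. ?E i l j k)))) = L (\<lambda>i. L (\<lambda>j. L (\<lambda>k. L (\<lambda>l. ?E i k j l))))"
      unfolding L_def wsum_def sum_distrib_left
      by (rule sum.cong[OF refl], rule sum.cong[OF refl], rule trans[OF sum.swap]) (simp add: mult_ac)
    then show ?thesis using W' by simp
  qed
  have diag: "L (\<lambda>i. L (\<lambda>j. of_bool (i = j))) = (\<Sum>i\<in>Y. (w i)\<^sup>2)"
    unfolding L_def by (rule wsum_diagonal[OF Y(1)])
  have "L (\<lambda>i. L (\<lambda>j. L (\<lambda>k. L (\<lambda>l. 2 * ip f f + 2 * (?E i j k l + ?E i k j l + ?E i l j k)
      - 2 * (?T i j k + ?T i j l + ?T i k l + ?T j k l)))))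
    = L (\<lambda>i. L (\<lambda>j. L (\<lambda>k. L (\<lambda>l. quad_ip f i j k l
     + of_bool (i = j) * (2 * ?s k l - ?s i k - ?s i l)
     + of_bool (i = k) * (2 * ?s j l - ?s i j - ?s i l)
     + of_bool (i = l) * (2 * ?s j k - ?s i j - ?s i k)
     + of_bool (j = k) * (2 * ?s i l - ?s i j - ?s j l)
     + of_bool (j = l) * (2 * ?s i k - ?s i j - ?s j k)
     + of_bool (k = l) * (2 * ?s i j - ?s i k - ?s j k)))))"
    unfolding L_def using Y(2) by (intro wsum_cong quad_ip_degenerate) auto
  then show ?thesis
    by (simp add: lin right_diff_distrib W[symmetric] W' W'' diag L_def[symmetric])
qed

text \<open>The inequality is due to Caputo, Liggett and Richthammer. Give the sites the weights \<open>c\<close> and the hub minus their sum. The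
weighted sum of \<open>quad_ip\<close> over all quadruples is at most zero by \<open>quad_five\<close>, as the hub can occur only once.
Then \<open>wsum_edge_square\<close> bounds the weighted sum of \<open>ip f (swap x y f)\<close>, which is twice the claim, from below by a square.\<close>

theorem octopus_inequality:
  assumes X: "finite X" "X \<subseteq> \<Omega>" and hub: "hub \<in> \<Omega>" "hub \<notin> X" and c: "\<And>x. x \<in> X \<Longrightarrow> 0 \<le> c x"
  shows "0 \<le> (\<Sum>x\<in>X. c x) * (\<Sum>x\<in>X. c x * (ip f f - ip f (swap hub x f)))
    - (\<Sum>x\<in>X. \<Sum>y\<in>X. c x * c y * (ip f f - ip f (swap x y f))) / 2"
proof -
  define S where "S = sum c X"
  define Y where "Y = insert hub X"
  define w where "w i = (if i = hub then - S else c i)" for i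
  define L where "L = wsum c X"
  define q where "q = quad_ip f"
  note lin = wsum_linear[of c X, folded L_def]
  have Lconst: "L (\<lambda>i. r) = S * r" for r
    by (simp add: L_def wsum_def S_def flip: sum_distrib_right)
  have Y: "finite Y" "Y \<subseteq> \<Omega>" using X hub by (auto simp: Y_def)
  have wX: "sum w X = S" "\<And>F. (\<Sum>x\<in>X. w x * F x) = L F"
    unfolding S_def L_def wsum_def using hub(2) by (auto simp: w_def intro!: sum.cong)
  have w0: "sum w Y = 0"
    using X(1) hub(2) wX(1) by (simp add: Y_def w_def)
  have split: "wsum w Y F = L F - S * F hub" for F
    using X(1) hub(2) wX(2)[of F] by (simp add: wsum_def Y_def w_def)
  define \<theta> where "\<theta> = wsum w Y (\<lambda>i. wsum w Y (\<lambda>j. swap_ip f i j))"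
  have \<theta>: "\<theta> = 2 * ((\<Sum>x\<in>X. c x) * (\<Sum>x\<in>X. c x * (ip f f - ip f (swap hub x f)))
    - (\<Sum>x\<in>X. \<Sum>y\<in>X. c x * c y * (ip f f - ip f (swap x y f))) / 2)"
  proof -
    have hs: "L (\<lambda>i. swap_ip f i hub) = L (\<lambda>i. swap_ip f hub i)"
      unfolding L_def using X(2) hub(1) by (intro wsum_cong swap_ip_simps) auto
    have 1: "(\<Sum>x\<in>X. c x * (ip f f - ip f (swap hub x f))) = S * ip f f - L (\<lambda>x. swap_ip f hub x)"
      by (simp add: L_def wsum_def S_def swap_ip_def right_diff_distrib sum_subtractf sum_distrib_right)
    have "(\<Sum>x\<in>X. \<Sum>y\<in>X. c x * c y * (ip f f - ip f (swap x y f))) = L (\<lambda>x. L (\<lambda>y. ip f f - swap_ip f x y))"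
      by (simp add: L_def wsum_def sum_distrib_left swap_ip_def mult.assoc)
    then have 2: "(\<Sum>x\<in>X. \<Sum>y\<in>X. c x * c y * (ip f f - ip f (swap x y f))) = S * (S * ip f f) - L (\<lambda>x. L (\<lambda>y. swap_ip f x y))"
      by (simp add: lin Lconst)
    show ?thesis
      unfolding \<theta>_def split 1 2 by (simp add: lin hs swap_ip_refl S_def[symmetric]) (simp add: field_simps)
  qed
  have "wsum w Y (\<lambda>i. wsum w Y (\<lambda>j. wsum w Y (\<lambda>k. wsum w Y (\<lambda>l. q i j k l)))) \<le> 0"
  proof -
    have q0: "q i i k l = 0" "q i j i l = 0" "q i j k i = 0" "q i j j l = 0" "q i j k j = 0" "q i j k k = 0" for i j k l
      by (simp_all add: q_def quad_ip_def)
    have q0': "q i i k = (\<lambda>l. 0)" "q i j i = (\<lambda>l. 0)" "q i j j = (\<lambda>l. 0)" for i j k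
      by (simp_all add: fun_eq_iff q0)
    have qs: "L (\<lambda>i. L (\<lambda>j. L (\<lambda>k. q i hub j k))) = L (\<lambda>i. L (\<lambda>j. L (\<lambda>k. q hub i j k)))"
      "L (\<lambda>i. L (\<lambda>j. L (\<lambda>k. q i j hub k))) = L (\<lambda>i. L (\<lambda>j. L (\<lambda>k. q hub i j k)))"
      "L (\<lambda>i. L (\<lambda>j. L (\<lambda>k. q i j k hub))) = L (\<lambda>i. L (\<lambda>j. L (\<lambda>k. q hub i j k)))"
      unfolding L_def q_def using X(2) hub(1)
      by (auto intro!: wsum_cong simp: quad_ip_symmetric subset_iff)
    have "wsum w Y (\<lambda>i. wsum w Y (\<lambda>j. wsum w Y (\<lambda>k. wsum w Y (\<lambda>l. q i j k l))))
      = L (\<lambda>i. L (\<lambda>j. L (\<lambda>k. L (\<lambda>l. q i j k l)))) - 4 * S * L (\<lambda>i. L (\<lambda>j. L (\<lambda>k. q hub i j k)))"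
      unfolding split by (simp add: lin q0 q0' qs Lconst right_diff_distrib)
    also have "4 * S * L (\<lambda>i. L (\<lambda>j. L (\<lambda>k. q hub i j k)))
      = L (\<lambda>i. L (\<lambda>j. L (\<lambda>k. L (\<lambda>l. q hub i j k + q hub i j l + q hub i k l + q hub j k l))))"
      by (simp add: lin Lconst)
    also have "L (\<lambda>i. L (\<lambda>j. L (\<lambda>k. L (\<lambda>l. q i j k l)))) \<le> \<dots>"
      unfolding L_def wsum_def q_def
      by (intro sum_mono mult_left_mono c quad_ip_five[OF _ _ _ _ X(2) hub])
    finally show ?thesis by simp
  qed
  then have "0 \<le> 12 * (\<Sum>i\<in>Y. (w i)\<^sup>2) * \<theta>"
    using wsum_edge_square[OF Y w0, of f] ip_nonneg unfolding q_def \<theta>_def by (smt (verit))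
  moreover have "0 \<le> \<theta>" if "(\<Sum>i\<in>Y. (w i)\<^sup>2) = 0"
  proof -
    have "w i = 0" if "i \<in> Y" for i
      using \<open>(\<Sum>i\<in>Y. (w i)\<^sup>2) = 0\<close> Y(1) that by (simp add: sum_nonneg_eq_0_iff)
    then show ?thesis by (simp add: \<theta>_def wsum_def)
  qed
  moreover have "0 \<le> (\<Sum>i\<in>Y. (w i)\<^sup>2)"
    by (simp add: sum_nonneg)
  ultimately have "0 \<le> \<theta>"
    by (cases "(\<Sum>i\<in>Y. (w i)\<^sup>2) = 0") (auto simp: zero_le_mult_iff)
  then have half: "0 \<le> a" if "\<theta> = 2 * a" for a
    using that by simp
  show ?thesis by (rule half[OF \<theta>])
qed

end

section \<open>The inequality for an arbitrary vector\<close>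

lemma sum_offdiag:
  fixes F :: "'b \<Rightarrow> 'b \<Rightarrow> real"
  assumes "finite X"
  shows "(\<Sum>x\<in>X. \<Sum>y\<in>X - {x}. F x y) = (\<Sum>x\<in>X. \<Sum>y\<in>X. F x y) - (\<Sum>x\<in>X. F x x)"
  using assms by (simp add: sum_diff1 flip: sum_subtractf)

context perm_rep begin

text \<open>The quadratic form of the group algebra element \<open>alpha A\<close>, see \<open>sum_alpha_energy\<close>.\<close>

definition energy :: "'a set \<Rightarrow> 'v \<Rightarrow> real"
  where "energy A f = real (card A) * (ip f f - ip (avg A f) (avg A f))"

lemma energy_empty: "energy {} f = 0"
  by (simp add: energy_def)

lemma energy_singleton: "a \<in> \<Omega> \<Longrightarrow> energy {a} f = 0"
  using avg_of_invariant[of "{a}" f] by (simp add: energy_def invariant_def act_id)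

lemma energy_pair:
  assumes "a \<in> \<Omega>" "b \<in> \<Omega>" "a \<noteq> b"
  shows "energy {a, b} f = ip f f - ip f (swap a b f)"
proof -
  have "2 *\<^sub>R avg {a, b} f = f + swap a b f"
    using avg_insert[of "{b}" a f] assms by (simp add: invariant_def act_id)
  then have "2 * ip f (avg {a, b} f) = ip f f + ip f (swap a b f)"
    by (metis ip_add_right ip_scale_right)
  moreover have "ip (avg {a, b} f) (avg {a, b} f) = ip f (avg {a, b} f)"
    using assms by (intro ip_avg_avg) auto
  ultimately show ?thesis
    using assms by (simp add: energy_def algebra_simps)
qed

text \<open>All sets contain \<open>A\<close>, so the part of \<open>f\<close> orthogonal to the invariants of \<open>A\<close> enters only through its norm \<open>d\<close>, and
the coefficients of \<open>d\<close> on the two sides agree. Hence \<open>f\<close> may be replaced by its projection to the invariants of \<open>A\<close>, for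
which the claim is \<open>star_inequality\<close>, or the octopus inequality if \<open>A\<close> is empty.\<close>

theorem energy_inequality:
  assumes A: "A \<subseteq> \<Omega>" and hub: "hub \<in> \<Omega>" "hub \<notin> A" "hub \<notin> X"
    and X: "X \<subseteq> \<Omega>" "X \<inter> A = {}" and c: "\<And>x. x \<in> X \<Longrightarrow> 0 \<le> c x" and c0: "0 \<le> c0"
  defines "a \<equiv> real (card A)"
  shows "c0\<^sup>2 * energy A f + (\<Sum>x\<in>X. (c x)\<^sup>2 * energy (insert x A) f)
      + (\<Sum>x\<in>X. c0 * c x * (energy (insert x A) f + energy A f))
      + (\<Sum>x\<in>X. \<Sum>y\<in>X - {x}. c x * c y * (energy (insert x (insert y A)) f + energy A f)) / 2
    \<le> (c0 * a + (\<Sum>x\<in>X. c x * (a + 1))) * (c0 * (energy (insert hub A) f - energy A f)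
        + (\<Sum>x\<in>X. c x * (energy (insert hub (insert x A)) f - energy (insert x A) f)))"
proof -
  have fin: "finite X" "finite A"
    using A X(1) finite_points by (auto intro: finite_subset)
  define S where "S = sum c X"
  have S1: "(\<Sum>x\<in>X. c x * r) = S * r" for r
    by (simp add: S_def flip: sum_distrib_right)
  show ?thesis
  proof (cases "A = {}")
    case True
    let ?\<theta> = "\<lambda>x y. ip f f - ip f (swap x y f)"
    have "(\<Sum>x\<in>X. \<Sum>y\<in>X - {x}. c x * c y * (energy (insert x (insert y A)) f + energy A f))
      = (\<Sum>x\<in>X. \<Sum>y\<in>X - {x}. c x * c y * ?\<theta> x y)"
      using X True by (intro sum.cong refl) (auto simp: energy_pair energy_empty subset_iff)
    also have "\<dots> = (\<Sum>x\<in>X. \<Sum>y\<in>X. c x * c y * ?\<theta> x y)"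
      by (simp add: sum_offdiag[OF fin(1)] act_id)
    finally have pairs: "(\<Sum>x\<in>X. \<Sum>y\<in>X - {x}. c x * c y * (energy (insert x (insert y A)) f + energy A f))
      = (\<Sum>x\<in>X. \<Sum>y\<in>X. c x * c y * ?\<theta> x y)" .
    have "(\<Sum>x\<in>X. c x * (energy (insert hub (insert x A)) f - energy (insert x A) f)) = (\<Sum>x\<in>X. c x * ?\<theta> hub x)"
    proof (intro sum.cong refl)
      fix x assume "x \<in> X"
      then have "hub \<noteq> x" "x \<in> \<Omega>" using hub X by auto
      then show "c x * (energy (insert hub (insert x A)) f - energy (insert x A) f) = c x * ?\<theta> hub x"
        using True hub(1) by (simp add: energy_pair energy_singleton)
    qed
    moreover have "(\<Sum>x\<in>X. (c x)\<^sup>2 * energy (insert x A) f) = 0" "(\<Sum>x\<in>X. c0 * c x * (energy (insert x A) f + energy A f)) = 0"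
      using X True by (auto intro!: sum.neutral simp: energy_singleton energy_empty subset_iff)
    ultimately show ?thesis
      unfolding pairs using octopus_inequality[where f = f, OF fin(1) X(1) hub(1,3) c] True hub(1)
      by (simp add: a_def S1 energy_empty energy_singleton S_def)
  next
    case False
    define h where "h = avg A f"
    define d where "d = ip f f - ip h h"
    define Q where "Q C = ip h h - ip (avg C h) (avg C h)" for C
    interpret star \<Omega> act ip A hub X h
      by unfold_locales (use A False hub X avg_invariant[OF A] in \<open>auto simp: h_def\<close>)
    have a: "a = m - 1" by (simp add: a_def m_def)
    have en: "energy C f = real (card C) * (d + Q C)" if "C \<subseteq> \<Omega>" "A \<subseteq> C" for C
      by (simp add: energy_def d_def Q_def avg_avg_subset(1)[OF that, of f, folded h_def])
    have Q0: "Q A = 0"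
      using avg_idem[OF A, of f] by (simp add: Q_def h_def)
    have e0: "energy A f = (m - 1) * d"
      using en[OF A] Q0 by (simp add: m_def)
    have e1: "energy (insert hub A) f = m * (d + Q (insert hub A))"
      using en[of "insert hub A"] A hub fin by (auto simp: m_def add.commute)
    have e2: "energy (insert x A) f = m * (d + Q (insert x A))"
      "energy (insert hub (insert x A)) f = p * (d + Q (insert hub (insert x A)))" if "x \<in> X" for x
    proof -
      have "x \<notin> A" "hub \<noteq> x" "x \<in> \<Omega>" using X hub that by auto
      then have "card (insert x A) = card A + 1" "card (insert hub (insert x A)) = card A + 2"
        using hub fin by auto
      then show "energy (insert x A) f = m * (d + Q (insert x A))"
        "energy (insert hub (insert x A)) f = p * (d + Q (insert hub (insert x A)))"
        using en[of "insert x A"] en[of "insert hub (insert x A)"] A hub(1) \<open>x \<in> \<Omega>\<close> by (auto simp: m_def p_def add.commute)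
    qed
    have e3: "energy (insert x (insert y A)) f = p * (d + Q (insert x (insert y A)))" if "x \<in> X" "y \<in> X" "x \<noteq> y" for x y
    proof -
      have "card (insert x (insert y A)) = card A + 2"
        using that X fin by (auto simp: card_insert_if)
      then show ?thesis
        using en[of "insert x (insert y A)"] A X that by (auto simp: m_def p_def)
    qed
    define T1 where "T1 = (\<Sum>x\<in>X. c x * (p * Q (insert hub (insert x A)) - m * Q (insert x A)))"
    define T2 where "T2 = (\<Sum>x\<in>X. (c x)\<^sup>2 * (m * Q (insert x A)))"
    define T3 where "T3 = (\<Sum>x\<in>X. c x * (m * Q (insert x A)))"
    define T4 where "T4 = (\<Sum>x\<in>X. \<Sum>y\<in>X - {x}. c x * c y * (p * Q (insert x (insert y A))))"
    define SS where "SS = (\<Sum>x\<in>X. (c x)\<^sup>2)"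
    have s1: "(\<Sum>x\<in>X. c x * (energy (insert hub (insert x A)) f - energy (insert x A) f)) = T1 + S * d"
    proof -
      have "c x * (energy (insert hub (insert x A)) f - energy (insert x A) f)
          = c x * (p * Q (insert hub (insert x A)) - m * Q (insert x A)) + c x * d" if "x \<in> X" for x
        using that by (simp add: e2 p_def algebra_simps)
      then show ?thesis
        by (simp add: T1_def sum.distrib S1)
    qed
    have s2: "(\<Sum>x\<in>X. (c x)\<^sup>2 * energy (insert x A) f) = T2 + SS * (m * d)"
      by (simp add: T2_def SS_def e2 distrib_left sum.distrib sum_distrib_right)
    have s3: "(\<Sum>x\<in>X. c0 * c x * (energy (insert x A) f + energy A f)) = c0 * T3 + c0 * (S * ((2 * m - 1) * d))"
    proof -
      have "c0 * c x * (energy (insert x A) f + energy A f) = c0 * (c x * (m * Q (insert x A)) + c x * ((2 * m - 1) * d))" if "x \<in> X" for x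
        using that by (simp add: e2 e0 algebra_simps)
      then show ?thesis
        by (simp add: T3_def sum.distrib S1 distrib_left flip: sum_distrib_left)
    qed
    have s4: "(\<Sum>x\<in>X. \<Sum>y\<in>X - {x}. c x * c y * (energy (insert x (insert y A)) f + energy A f)) = T4 + (S * S - SS) * (2 * m * d)"
    proof -
      have "(\<Sum>x\<in>X. \<Sum>y\<in>X - {x}. c x * c y * (energy (insert x (insert y A)) f + energy A f))
        = (\<Sum>x\<in>X. \<Sum>y\<in>X - {x}. c x * c y * (p * Q (insert x (insert y A))) + c x * c y * (2 * m * d))"
        by (intro sum.cong refl) (auto simp: e3 e0 p_def algebra_simps)
      also have "\<dots> = T4 + (\<Sum>x\<in>X. \<Sum>y\<in>X - {x}. c x * c y) * (2 * m * d)"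
        by (simp add: T4_def sum.distrib sum_distrib_right)
      also have "(\<Sum>x\<in>X. \<Sum>y\<in>X - {x}. c x * c y) = S * S - SS"
        by (simp add: sum_offdiag[OF fin(1)] SS_def S_def power2_eq_square sum_product)
      finally show ?thesis .
    qed
    have "0 \<le> (c0 * (m - 1) + m * S) * (c0 * m * Q (insert hub A) + T1) - T2 - c0 * T3 - T4 / 2"
      using star_inequality[of c c0, OF fin(1) c c0] unfolding T1_def T2_def T3_def T4_def Q_def S_def by blast
    also have "\<dots> = (c0 * (m - 1) + m * S) * (c0 * (m * (d + Q (insert hub A)) - (m - 1) * d) + (T1 + S * d))
      - (c0\<^sup>2 * ((m - 1) * d) + (T2 + SS * (m * d)) + (c0 * T3 + c0 * (S * ((2 * m - 1) * d))) + (T4 + (S * S - SS) * (2 * m * d)) / 2)"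
      by (simp add: field_simps power2_eq_square)
    finally show ?thesis
      unfolding s1 s2 s3 s4 unfolding e0 e1 a S1 by (simp add: mult.commute)
  qed
qed

text \<open>The coefficients are those of \<open>alpha A\<close> with its definition unfolded, for an arbitrary set of points. The sum over
the permutations of \<open>A\<close> is \<open>card A\<close> factorial times the projection, which leaves the factor \<open>card A\<close>.\<close>

lemma sum_alpha_energy:
  assumes "A \<subseteq> \<Omega>"
  shows "(\<Sum>\<sigma> | \<sigma> permutes \<Omega>. (if A = {} then 0 else 1 / fact (card A - 1) * (\<Sum>\<pi> | \<pi> permutes A. (if \<sigma> = id then 1 else 0) - (if \<sigma> = \<pi> then 1 else 0))) * ip f (act \<sigma> f)) = energy A f"
proof (cases "A = {}")
  case True
  then show ?thesis by (simp add: energy_def)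
next
  case False
  have finA: "finite A" "finite {\<pi>. \<pi> permutes A}" "finite {\<pi>. \<pi> permutes \<Omega>}"
    using assms finite_points finite_subset finite_permutations by blast+
  have sub: "{\<pi>. \<pi> permutes A} \<subseteq> {\<pi>. \<pi> permutes \<Omega>}"
    using permutes_points[OF _ assms] by blast
  have delta: "(\<Sum>\<sigma> | \<sigma> permutes \<Omega>. (if \<sigma> = \<pi> then 1 else 0) * ip f (act \<sigma> f)) = ip f (act \<pi> f)" if "\<pi> permutes \<Omega>" for \<pi>
    using finA(3) that by (simp add: if_distrib[of "\<lambda>r. r * _"] cong: if_cong)
  have "(\<Sum>\<sigma> | \<sigma> permutes \<Omega>. (\<Sum>\<pi> | \<pi> permutes A. (if \<sigma> = id then 1 else 0) - (if \<sigma> = \<pi> then 1 else 0)) * ip f (act \<sigma> f))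
    = (\<Sum>\<pi> | \<pi> permutes A. \<Sum>\<sigma> | \<sigma> permutes \<Omega>. (if \<sigma> = id then 1 else 0) * ip f (act \<sigma> f) - (if \<sigma> = \<pi> then 1 else 0) * ip f (act \<sigma> f))"
    unfolding sum_distrib_right by (rule trans[OF sum.swap]) (simp only: left_diff_distrib)
  also have "\<dots> = (\<Sum>\<pi> | \<pi> permutes A. ip f f - ip f (act \<pi> f))"
    unfolding sum_subtractf using sub by (auto simp: delta permutes_id act_id subset_iff)
  also have "\<dots> = fact (card A) * (ip f f - ip f (avg A f))"
    using card_permutations[OF refl finA(1)]
    by (simp add: sum_subtractf avg_def ip_scale_right ip_sum_right right_diff_distrib)
  also have "\<dots> = fact (card A) * (ip f f - ip (avg A f) (avg A f))"
    by (simp only: ip_avg_avg[OF assms])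
  finally have "(\<Sum>\<sigma> | \<sigma> permutes \<Omega>. (\<Sum>\<pi> | \<pi> permutes A. (if \<sigma> = id then 1 else 0) - (if \<sigma> = \<pi> then 1 else 0)) * ip f (act \<sigma> f))
    = fact (card A) * (ip f f - ip (avg A f) (avg A f))" .
  moreover have "(\<Sum>\<sigma> | \<sigma> permutes \<Omega>. (if A = {} then 0 else 1 / fact (card A - 1) * (\<Sum>\<pi> | \<pi> permutes A. (if \<sigma> = id then 1 else 0) - (if \<sigma> = \<pi> then 1 else 0))) * ip f (act \<sigma> f))
    = 1 / fact (card A - 1) * (\<Sum>\<sigma> | \<sigma> permutes \<Omega>. (\<Sum>\<pi> | \<pi> permutes A. (if \<sigma> = id then 1 else 0) - (if \<sigma> = \<pi> then 1 else 0)) * ip f (act \<sigma> f))"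
    using False by (simp only: if_False mult.assoc sum_distrib_left[symmetric])
  moreover have "fact (card A) = real (card A) * fact (card A - 1)"
    using False finA(1) by (simp add: fact_reduce card_gt_0_iff)
  ultimately show ?thesis
    by (simp add: energy_def)
qed

end

lemma (in perm_rep) energy_inequality_indexed:
  fixes I :: "'b set" and x :: "'b \<Rightarrow> 'a" and c :: "'b \<Rightarrow> real"
  assumes A: "A \<subseteq> \<Omega>" and hub: "hub \<in> \<Omega>" "hub \<notin> A" "hub \<notin> x ` I"
    and x: "inj_on x I" "x ` I \<subseteq> \<Omega>" "x ` I \<inter> A = {}" and c: "\<And>i. i \<in> I \<Longrightarrow> 0 \<le> c i" and c0: "0 \<le> c0"
  defines "a \<equiv> real (card A)"
  shows "c0\<^sup>2 * energy A f + (\<Sum>i\<in>I. (c i)\<^sup>2 * energy (insert (x i) A) f)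
      + (\<Sum>i\<in>I. c0 * c i * (energy (insert (x i) A) f + energy A f))
      + (\<Sum>i\<in>I. \<Sum>j\<in>I - {i}. c i * c j * (energy (insert (x i) (insert (x j) A)) f + energy A f)) / 2
    \<le> (c0 * a + (\<Sum>i\<in>I. c i * (a + 1))) * (c0 * (energy (insert hub A) f - energy A f)
        + (\<Sum>i\<in>I. c i * (energy (insert hub (insert (x i) A)) f - energy (insert (x i) A) f)))"
proof -
  have inv: "inv_into I x (x i) = i" if "i \<in> I" for i
    using x(1) that by simp
  have diff: "x ` I - {x i} = x ` (I - {i})" if "i \<in> I" for i
    using x(1) that by (auto simp: inj_on_def)
  have inner: "(\<Sum>y\<in>x ` I - {x i}. c i * c (inv_into I x y) * F y) = (\<Sum>j\<in>I - {i}. c i * c j * F (x j))"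
    if "i \<in> I" for i and F :: "'a \<Rightarrow> real"
    unfolding diff[OF that] using x(1) by (auto simp: sum.reindex inj_on_diff inv intro!: sum.cong)
  have "0 \<le> c (inv_into I x y)" if "y \<in> x ` I" for y
    using that c by (auto simp: inv)
  from energy_inequality[of A hub "x ` I" "\<lambda>y. c (inv_into I x y)", OF A hub x(2,3) this c0, of f]
  show ?thesis
    by (simp add: sum.reindex[OF x(1)] inner inv a_def cong: sum.cong)
qed

lemma sum_pairs_star:
  fixes H :: "nat \<Rightarrow> nat \<Rightarrow> real"
  assumes "\<And>i j. H i j = H j i"
  shows "(\<Sum>j\<le>t. \<Sum>i<j. H i j) = (\<Sum>j\<in>{1..t}. H 0 j) + (\<Sum>i\<in>{1..t}. \<Sum>j\<in>{1..t} - {i}. H i j) / 2"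
proof (unfold sum_offdiag[OF finite_atLeastAtMost], induction t)
  case (Suc t)
  have "{..<Suc t} = insert 0 {1..t}" by auto
  then have "(\<Sum>i<Suc t. H i (Suc t)) = H 0 (Suc t) + (\<Sum>i\<in>{1..t}. H i (Suc t))"
    by simp
  then show ?case
    using Suc.IH assms by (simp add: sum.distrib field_simps)
qed simp

section \<open>From positive definite kernels to operators\<close>

lemma wsum_sum: "wsum w Y (\<lambda>i. \<Sum>k\<in>I. F k i) = (\<Sum>k\<in>I. wsum w Y (F k))"
  unfolding wsum_def sum_distrib_left by (rule sum.swap)

text \<open>Finitely supported functions on the permutations, with the left regular action, carry the form defined by any kernel.
They provide one real vector space for representations of every dimension.\<close>

definition translate :: "('a \<Rightarrow> 'a) \<Rightarrow> (('a \<Rightarrow> 'a) \<Rightarrow>\<^sub>0 real) \<Rightarrow> (('a \<Rightarrow> 'a) \<Rightarrow>\<^sub>0 real)"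
  where "translate \<tau> x = Poly_Mapping.map_key ((\<circ>) (inv_into UNIV \<tau>)) x"

definition kernel_form :: "'a set \<Rightarrow> (('a \<Rightarrow> 'a) \<Rightarrow> ('a \<Rightarrow> 'a) \<Rightarrow> real) \<Rightarrow> (('a \<Rightarrow> 'a) \<Rightarrow>\<^sub>0 real) \<Rightarrow> (('a \<Rightarrow> 'a) \<Rightarrow>\<^sub>0 real) \<Rightarrow> real"
  where "kernel_form \<Omega> K x y = (\<Sum>\<pi> | \<pi> permutes \<Omega>. \<Sum>\<sigma> | \<sigma> permutes \<Omega>. Poly_Mapping.lookup x \<pi> * Poly_Mapping.lookup y \<sigma> * K \<pi> \<sigma>)"

lemma lookup_translate:
  assumes "\<tau> permutes \<Omega>"
  shows "Poly_Mapping.lookup (translate \<tau> x) \<pi> = Poly_Mapping.lookup x (inv_into UNIV \<tau> \<circ> \<pi>)"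
proof -
  have "inj (inv_into UNIV \<tau>)"
    using permutes_inj[OF permutes_inv[OF assms]] .
  then have "inj ((\<circ>) (inv_into UNIV \<tau>) :: ('a \<Rightarrow> 'a) \<Rightarrow> 'a \<Rightarrow> 'a)"
    by (simp add: inj_def fun_eq_iff)
  then show ?thesis
    by (simp add: translate_def map_key.rep_eq)
qed

lemma lookup_scaleR: "Poly_Mapping.lookup (r *\<^sub>R x) k = r * Poly_Mapping.lookup x k"
  for x :: "'b \<Rightarrow>\<^sub>0 real"
proof -
  have "finite {i. r * Poly_Mapping.lookup x i \<noteq> 0}"
    by (rule finite_subset[OF _ finite_keys[of x]]) (auto simp: in_keys_iff)
  then show ?thesis
    by (simp add: scaleR_poly_mapping_def)
qed

lemma perm_rep_kernel:
  assumes fin: "finite \<Omega>"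
    and sym: "\<And>\<pi> \<sigma>. \<pi> permutes \<Omega> \<Longrightarrow> \<sigma> permutes \<Omega> \<Longrightarrow> K \<pi> \<sigma> = K \<sigma> \<pi>"
    and inv: "\<And>\<tau> \<pi> \<sigma>. \<tau> permutes \<Omega> \<Longrightarrow> \<pi> permutes \<Omega> \<Longrightarrow> \<sigma> permutes \<Omega> \<Longrightarrow> K (\<tau> \<circ> \<pi>) (\<tau> \<circ> \<sigma>) = K \<pi> \<sigma>"
    and pos: "\<And>a. 0 \<le> (\<Sum>\<pi> | \<pi> permutes \<Omega>. \<Sum>\<sigma> | \<sigma> permutes \<Omega>. a \<pi> * a \<sigma> * K \<pi> \<sigma>)"
  shows "perm_rep \<Omega> translate (kernel_form \<Omega> K)"
proof
  show "finite \<Omega>" by (rule fin)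
  fix x y z :: "('a \<Rightarrow> 'a) \<Rightarrow>\<^sub>0 real" and r :: real and \<pi> \<sigma> :: "'a \<Rightarrow> 'a"
  show "translate id x = x"
    using lookup_translate[OF permutes_id, of x] by (intro poly_mapping_eqI) (simp add: inv_id)
  show "kernel_form \<Omega> K (x + y) z = kernel_form \<Omega> K x z + kernel_form \<Omega> K y z"
    by (simp add: kernel_form_def lookup_add distrib_right sum.distrib)
  show "kernel_form \<Omega> K (r *\<^sub>R x) y = r * kernel_form \<Omega> K x y"
    by (simp add: kernel_form_def lookup_scaleR sum_distrib_left mult.assoc)
  show "kernel_form \<Omega> K x y = kernel_form \<Omega> K y x"
    unfolding kernel_form_def by (rule trans[OF sum.swap]) (auto intro!: sum.cong simp: sym)
  show "0 \<le> kernel_form \<Omega> K x x"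
    unfolding kernel_form_def by (rule pos)
  assume \<pi>: "\<pi> permutes \<Omega>"
  show "translate \<pi> (x + y) = translate \<pi> x + translate \<pi> y"
    by (intro poly_mapping_eqI) (simp add: lookup_translate[OF \<pi>] lookup_add)
  show "translate \<pi> (r *\<^sub>R x) = r *\<^sub>R translate \<pi> x"
    by (intro poly_mapping_eqI) (simp add: lookup_translate[OF \<pi>] lookup_scaleR)
  have reindex: "(\<Sum>\<rho> | \<rho> permutes \<Omega>. F \<rho>) = (\<Sum>\<rho> | \<rho> permutes \<Omega>. F (\<pi> \<circ> \<rho>))" for F :: "('a \<Rightarrow> 'a) \<Rightarrow> real"
    by (rule sum.reindex_bij_witness[where j = "\<lambda>\<rho>. inv_into UNIV \<pi> \<circ> \<rho>" and i = "\<lambda>\<rho>. \<pi> \<circ> \<rho>"])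
      (use \<pi> in \<open>auto simp: o_assoc permutes_inv_o intro: permutes_compose permutes_inv\<close>)
  have "kernel_form \<Omega> K (translate \<pi> x) (translate \<pi> y)
    = (\<Sum>\<rho> | \<rho> permutes \<Omega>. \<Sum>\<sigma> | \<sigma> permutes \<Omega>. Poly_Mapping.lookup (translate \<pi> x) (\<pi> \<circ> \<rho>) * Poly_Mapping.lookup (translate \<pi> y) (\<pi> \<circ> \<sigma>) * K (\<pi> \<circ> \<rho>) (\<pi> \<circ> \<sigma>))"
    unfolding kernel_form_def by (rule trans[OF reindex], rule sum.cong[OF refl], rule reindex)
  also have "\<dots> = kernel_form \<Omega> K x y"
    unfolding kernel_form_def
    by (intro sum.cong refl) (simp add: lookup_translate[OF \<pi>] o_assoc permutes_inv_o[OF \<pi>] inv[OF \<pi>])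
  finally show "kernel_form \<Omega> K (translate \<pi> x) (translate \<pi> y) = kernel_form \<Omega> K x y" .
  assume \<sigma>: "\<sigma> permutes \<Omega>"
  show "translate (\<pi> \<circ> \<sigma>) x = translate \<pi> (translate \<sigma> x)"
    by (intro poly_mapping_eqI)
      (simp add: lookup_translate[OF \<pi>] lookup_translate[OF \<sigma>] lookup_translate[OF permutes_compose[OF \<sigma> \<pi>]]
        o_inv_distrib permutes_bij[OF \<pi>] permutes_bij[OF \<sigma>] o_assoc)
qed

text \<open>The point mass at the identity plays the part of the vector from which the kernel was made.\<close>

lemma kernel_form_translate:
  assumes fin: "finite \<Omega>" and \<pi>: "\<pi> permutes \<Omega>"
  shows "kernel_form \<Omega> K (Poly_Mapping.single id 1) (translate \<pi> (Poly_Mapping.single id 1)) = K id \<pi>"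
proof -
  have eq: "(id = inv_into UNIV \<pi> \<circ> \<sigma>) = (\<sigma> = \<pi>)" for \<sigma>
  proof
    assume "id = inv_into UNIV \<pi> \<circ> \<sigma>"
    then have "\<pi> \<circ> id = \<pi> \<circ> (inv_into UNIV \<pi> \<circ> \<sigma>)" by simp
    then show "\<sigma> = \<pi>" by (simp add: o_assoc permutes_inv_o[OF \<pi>])
  qed (simp add: permutes_inv_o[OF \<pi>])
  have "kernel_form \<Omega> K (Poly_Mapping.single id 1) (translate \<pi> (Poly_Mapping.single id 1))
    = (\<Sum>\<rho> | \<rho> permutes \<Omega>. if id = \<rho> then (\<Sum>\<sigma> | \<sigma> permutes \<Omega>. if \<sigma> = \<pi> then K id \<pi> else 0) else 0)"
    unfolding kernel_form_def by (intro sum.cong refl) (auto simp: lookup_translate[OF \<pi>] lookup_single when_def eq intro!: sum.cong)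
  then show ?thesis
    using finite_permutations[OF fin] \<pi> by (simp add: permutes_id)
qed

lemma inner_product_onD:
  assumes "inner_product_on d ip" "u \<in> carrier_vec d" "v \<in> carrier_vec d"
  shows "w \<in> carrier_vec d \<Longrightarrow> ip (u + v) w = ip u w + ip v w"
    and "ip (a \<cdot>\<^sub>v u) v = a * ip u v"
    and "ip u v = cnj (ip v u)"
    and "u \<noteq> 0\<^sub>v d \<Longrightarrow> ip u u \<in> \<real>" "u \<noteq> 0\<^sub>v d \<Longrightarrow> 0 < Re (ip u u)"
  using assms unfolding inner_product_on_def by blast+

text \<open>The linear combination is written entrywise because vectors of varying dimension have no common zero.\<close>

lemma inner_product_sum:
  assumes ip: "inner_product_on d ip" and S: "finite S" "\<And>s. s \<in> S \<Longrightarrow> g s \<in> carrier_vec d" and u: "u \<in> carrier_vec d"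
  shows "ip (vec d (\<lambda>i. \<Sum>s\<in>S. a s * g s $ i)) u = (\<Sum>s\<in>S. a s * ip (g s) u)"
  using S
proof (induction S rule: finite_induct)
  case empty
  have "vec d (\<lambda>i. \<Sum>s\<in>{}. a s * g s $ i) = 0 \<cdot>\<^sub>v u"
    using u by (intro eq_vecI) auto
  then show ?case
    using inner_product_onD(2)[OF ip u u, of 0] by simp
next
  case (insert s S)
  have gs: "g s \<in> carrier_vec d" "dim_vec (g s) = d"
    using insert.prems by auto
  have "vec d (\<lambda>i. \<Sum>s\<in>insert s S. a s * g s $ i) = a s \<cdot>\<^sub>v g s + vec d (\<lambda>i. \<Sum>s\<in>S. a s * g s $ i)"
    using insert.hyps gs by (intro eq_vecI) auto
  moreover have "ip (a s \<cdot>\<^sub>v g s + vec d (\<lambda>i. \<Sum>s\<in>S. a s * g s $ i)) u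
    = a s * ip (g s) u + ip (vec d (\<lambda>i. \<Sum>s\<in>S. a s * g s $ i)) u"
    using gs u by (simp add: inner_product_onD(1,2)[OF ip])
  ultimately show ?case
    using insert by simp
qed

lemma representation_props:
  assumes "representation n d \<rho>"
  shows "\<pi> permutes {1..n} \<Longrightarrow> \<rho> \<pi> \<in> carrier_mat d d"
    and "\<pi> permutes {1..n} \<Longrightarrow> \<sigma> permutes {1..n} \<Longrightarrow> \<rho> (\<pi> \<circ> \<sigma>) = \<rho> \<pi> * \<rho> \<sigma>"
    and "\<rho> id = 1\<^sub>m d"
proof -
  let ?R = "ring_mat TYPE(complex) d ()"
  interpret R: ring ?R by (rule ring_mat)
  have hom: "\<rho> \<in> hom (sym_group n) (units_of ?R)"
    using assms by (simp add: representation_def)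
  show "\<rho> \<pi> \<in> carrier_mat d d" if "\<pi> permutes {1..n}"
  proof -
    have "\<rho> \<pi> \<in> carrier (units_of ?R)"
      using hom that by (auto simp: hom_def sym_group_carrier)
    then have "\<rho> \<pi> \<in> carrier ?R"
      unfolding units_of_carrier by (rule R.Units_closed)
    then show ?thesis by (simp add: ring_mat_simps)
  qed
  show "\<rho> (\<pi> \<circ> \<sigma>) = \<rho> \<pi> * \<rho> \<sigma>" if "\<pi> permutes {1..n}" "\<sigma> permutes {1..n}"
    using hom_mult[OF hom, of \<pi> \<sigma>] that by (simp add: sym_group_carrier sym_group_mult units_of_mult ring_mat_simps)
  show "\<rho> id = 1\<^sub>m d"
    using hom_one[OF hom sym_group_is_group R.units_group] by (simp add: sym_group_one units_of_one ring_mat_simps)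
qed

lemma rep_operator_mult_vec:
  assumes \<rho>: "representation n d \<rho>" and u: "u \<in> carrier_vec d"
  shows "rep_operator n d \<rho> x *\<^sub>v u
    = vec d (\<lambda>i. \<Sum>\<pi> | \<pi> permutes {1..n}. complex_of_real (x \<pi>) * (\<rho> \<pi> *\<^sub>v u) $ i)"
proof (rule eq_vecI)
  have G: "carrier (sym_group n) = {\<pi>. \<pi> permutes {1..n}}"
    by (auto simp: sym_group_carrier)
  fix i assume "i < dim_vec (vec d (\<lambda>i. \<Sum>\<pi> | \<pi> permutes {1..n}. complex_of_real (x \<pi>) * (\<rho> \<pi> *\<^sub>v u) $ i))"
  then have i: "i < d" by simp
  have "(\<rho> \<pi> *\<^sub>v u) $ i = (\<Sum>j<d. \<rho> \<pi> $$ (i, j) * u $ j)" if "\<pi> permutes {1..n}" for \<pi>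
    using representation_props(1)[OF \<rho> that] i u by (simp add: scalar_prod_def atLeast0LessThan)
  then have "(\<Sum>\<pi> | \<pi> permutes {1..n}. complex_of_real (x \<pi>) * (\<rho> \<pi> *\<^sub>v u) $ i)
    = (\<Sum>\<pi> | \<pi> permutes {1..n}. \<Sum>j<d. complex_of_real (x \<pi>) * \<rho> \<pi> $$ (i, j) * u $ j)"
    by (simp add: sum_distrib_left mult.assoc)
  also have "\<dots> = (\<Sum>j<d. \<Sum>\<pi> | \<pi> permutes {1..n}. complex_of_real (x \<pi>) * \<rho> \<pi> $$ (i, j) * u $ j)"
    by (rule sum.swap)
  also have "\<dots> = (rep_operator n d \<rho> x *\<^sub>v u) $ i"
    using i u by (simp add: rep_operator_def scalar_prod_def atLeast0LessThan G sum_distrib_right)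
  finally show "(rep_operator n d \<rho> x *\<^sub>v u) $ i
    = vec d (\<lambda>i. \<Sum>\<pi> | \<pi> permutes {1..n}. complex_of_real (x \<pi>) * (\<rho> \<pi> *\<^sub>v u) $ i) $ i"
    using i by simp
qed (simp add: rep_operator_def)

text \<open>Coefficients that are symmetric under inversion give a self-adjoint operator, and an eigenvalue is then the Rayleigh
quotient of its eigenvector. The real part of the quadratic form suffices, since the form is real.\<close>

lemma psd_rep_operatorI:
  assumes \<rho>: "representation n d \<rho>" and inv: "invariant_inner_product n d \<rho> ip"
    and sym: "\<And>\<pi>. \<pi> permutes {1..n} \<Longrightarrow> x (inv_into UNIV \<pi>) = x \<pi>"
    and pos: "\<And>v. v \<in> carrier_vec d \<Longrightarrow> 0 \<le> (\<Sum>\<pi> | \<pi> permutes {1..n}. x \<pi> * Re (ip v (\<rho> \<pi> *\<^sub>v v)))"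
  shows "psd_operator d ip (rep_operator n d \<rho> x)"
proof -
  let ?M = "rep_operator n d \<rho> x" and ?G = "{\<pi>. \<pi> permutes {1..n}}"
  have ip: "inner_product_on d ip"
    using inv by (simp add: invariant_inner_product_def)
  have conj: "ip u v = cnj (ip v u)" if "u \<in> carrier_vec d" "v \<in> carrier_vec d" for u v
    using inner_product_onD(3)[OF ip that] .
  have scale: "ip (a \<cdot>\<^sub>v u) v = a * ip u v" if "u \<in> carrier_vec d" "v \<in> carrier_vec d" for a u v
    using inner_product_onD(2)[OF ip that] .
  have fin: "finite ?G" by (simp add: finite_permutations)
  have \<rho>v: "\<rho> \<pi> *\<^sub>v v \<in> carrier_vec d" if "\<pi> permutes {1..n}" "v \<in> carrier_vec d" for \<pi> v
    using representation_props(1)[OF \<rho> that(1)] that(2) by simp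
  have M: "?M \<in> carrier_mat d d" by (simp add: rep_operator_def)
  have left: "ip (?M *\<^sub>v u) w = (\<Sum>\<pi>\<in>?G. complex_of_real (x \<pi>) * ip (\<rho> \<pi> *\<^sub>v u) w)"
    if "u \<in> carrier_vec d" "w \<in> carrier_vec d" for u w
    unfolding rep_operator_mult_vec[OF \<rho> that(1)] using that \<rho>v by (intro inner_product_sum[OF ip fin]) auto
  have adj: "ip (\<rho> \<pi> *\<^sub>v u) w = ip u (\<rho> (inv_into UNIV \<pi>) *\<^sub>v w)"
    if \<pi>: "\<pi> permutes {1..n}" and u: "u \<in> carrier_vec d" "w \<in> carrier_vec d" for \<pi> u w
  proof -
    have \<pi>': "inv_into UNIV \<pi> permutes {1..n}" using permutes_inv[OF \<pi>] .
    have "\<rho> \<pi> *\<^sub>v (\<rho> (inv_into UNIV \<pi>) *\<^sub>v w) = (\<rho> \<pi> * \<rho> (inv_into UNIV \<pi>)) *\<^sub>v w"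
      using assoc_mult_mat_vec[OF representation_props(1)[OF \<rho> \<pi>] representation_props(1)[OF \<rho> \<pi>'] u(2)] by simp
    also have "\<rho> \<pi> * \<rho> (inv_into UNIV \<pi>) = 1\<^sub>m d"
      using representation_props(2)[OF \<rho> \<pi> \<pi>'] by (simp only: permutes_inv_o[OF \<pi>] representation_props(3)[OF \<rho>])
    finally have "\<rho> \<pi> *\<^sub>v (\<rho> (inv_into UNIV \<pi>) *\<^sub>v w) = w"
      using u(2) by simp
    then have "ip (\<rho> \<pi> *\<^sub>v u) w = ip (\<rho> \<pi> *\<^sub>v u) (\<rho> \<pi> *\<^sub>v (\<rho> (inv_into UNIV \<pi>) *\<^sub>v w))"
      by simp
    also have "\<dots> = ip u (\<rho> (inv_into UNIV \<pi>) *\<^sub>v w)"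
      using inv \<pi> u \<rho>v[OF \<pi>'] unfolding invariant_inner_product_def by (simp add: sym_group_carrier)
    finally show ?thesis .
  qed
  have selfadj: "ip (?M *\<^sub>v u) w = ip u (?M *\<^sub>v w)" if uw: "u \<in> carrier_vec d" "w \<in> carrier_vec d" for u w
  proof -
    have "ip (?M *\<^sub>v u) w = (\<Sum>\<pi>\<in>?G. complex_of_real (x \<pi>) * ip u (\<rho> (inv_into UNIV \<pi>) *\<^sub>v w))"
      using uw by (simp add: left adj)
    also have "\<dots> = (\<Sum>\<pi>\<in>?G. complex_of_real (x \<pi>) * ip u (\<rho> \<pi> *\<^sub>v w))"
      by (rule sum.reindex_bij_witness[where i = "inv_into UNIV" and j = "inv_into UNIV"])
        (auto simp: permutes_inv permutes_inv_inv sym)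
    also have "\<dots> = cnj (\<Sum>\<pi>\<in>?G. complex_of_real (x \<pi>) * ip (\<rho> \<pi> *\<^sub>v w) u)"
      using uw \<rho>v by (auto simp: conj[of u] intro!: sum.cong)
    also have "\<dots> = ip u (?M *\<^sub>v w)"
      using uw M conj[of u "?M *\<^sub>v w"] by (simp add: left)
    finally show ?thesis .
  qed
  have eig: "k \<in> \<real> \<and> 0 \<le> Re k" if ev: "eigenvalue ?M k" for k
  proof -
    obtain v where v: "v \<in> carrier_vec d" "v \<noteq> 0\<^sub>v d" "?M *\<^sub>v v = k \<cdot>\<^sub>v v"
      using ev M unfolding eigenvalue_def eigenvector_def by auto
    have vv: "ip v v \<in> \<real>" "0 < Re (ip v v)"
      using inner_product_onD(4,5)[OF ip v(1) v(1) v(2)] .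
    have kl: "ip (?M *\<^sub>v v) v = k * ip v v"
      unfolding v(3) using v(1) by (simp add: scale)
    have kr: "ip v (?M *\<^sub>v v) = cnj k * ip v v"
      unfolding v(3) using conj[of v "k \<cdot>\<^sub>v v"] v(1) conj[of v v] by (simp add: scale)
    have "k * ip v v = cnj k * ip v v"
      using selfadj[OF v(1) v(1)] unfolding kl kr .
    moreover have "ip v v \<noteq> 0" using vv(2) by auto
    ultimately have "cnj k = k" by simp
    then have k: "k \<in> \<real>" by (simp add: Reals_cnj_iff)
    have "k * ip v v = (\<Sum>\<pi>\<in>?G. complex_of_real (x \<pi>) * ip (\<rho> \<pi> *\<^sub>v v) v)"
      using kl left[OF v(1) v(1)] by simp
    then have "Re (k * ip v v) = (\<Sum>\<pi>\<in>?G. x \<pi> * Re (ip (\<rho> \<pi> *\<^sub>v v) v))"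
      by (simp add: Re_sum)
    also have "\<dots> = (\<Sum>\<pi>\<in>?G. x \<pi> * Re (ip v (\<rho> \<pi> *\<^sub>v v)))"
      using v(1) \<rho>v by (auto simp: conj[of "_ *\<^sub>v v" v] intro!: sum.cong)
    finally have "0 \<le> Re (k * ip v v)"
      using pos[OF v(1)] by simp
    then have "0 \<le> Re k * Re (ip v v)"
      using k vv(1) by (auto elim!: Reals_cases)
    then show ?thesis
      using k vv(2) by (simp add: zero_le_mult_iff)
  qed
  show ?thesis
    unfolding psd_operator_def using selfadj eig by blast
qed

text \<open>The kernel is the real part of the Gram matrix of the orbit of \<open>v\<close>, so it is positive definite.\<close>

lemma perm_rep_of_representation:
  assumes \<rho>: "representation n d \<rho>" and inv: "invariant_inner_product n d \<rho> ip" and v: "v \<in> carrier_vec d"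
    and \<Omega>: "\<And>\<pi>. \<pi> permutes \<Omega> \<longleftrightarrow> \<pi> permutes {1..n}" "finite \<Omega>"
  shows "perm_rep \<Omega> translate (kernel_form \<Omega> (\<lambda>\<pi> \<sigma>. Re (ip (\<rho> \<pi> *\<^sub>v v) (\<rho> \<sigma> *\<^sub>v v))))"
proof (rule perm_rep_kernel[OF \<Omega>(2)], unfold \<Omega>(1))
  have ip: "inner_product_on d ip"
    using inv by (simp add: invariant_inner_product_def)
  have conj: "ip u v = cnj (ip v u)" if "u \<in> carrier_vec d" "v \<in> carrier_vec d" for u v
    using inner_product_onD(3)[OF ip that] .
  have fin: "finite {\<pi>. \<pi> permutes {1..n}}" by (simp add: finite_permutations)
  have \<rho>v: "\<rho> \<pi> *\<^sub>v u \<in> carrier_vec d" if "\<pi> permutes {1..n}" "u \<in> carrier_vec d" for \<pi> u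
    using representation_props(1)[OF \<rho> that(1)] that(2) by simp
  show resym: "Re (ip (\<rho> \<pi> *\<^sub>v v) (\<rho> \<sigma> *\<^sub>v v)) = Re (ip (\<rho> \<sigma> *\<^sub>v v) (\<rho> \<pi> *\<^sub>v v))"
    if "\<pi> permutes {1..n}" "\<sigma> permutes {1..n}" for \<pi> \<sigma>
    using conj[OF \<rho>v[OF that(1) v] \<rho>v[OF that(2) v]] by simp
  show "Re (ip (\<rho> (\<tau> \<circ> \<pi>) *\<^sub>v v) (\<rho> (\<tau> \<circ> \<sigma>) *\<^sub>v v)) = Re (ip (\<rho> \<pi> *\<^sub>v v) (\<rho> \<sigma> *\<^sub>v v))"
    if "\<tau> permutes {1..n}" "\<pi> permutes {1..n}" "\<sigma> permutes {1..n}" for \<tau> \<pi> \<sigma>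
  proof -
    have "\<rho> (\<tau> \<circ> \<kappa>) *\<^sub>v v = \<rho> \<tau> *\<^sub>v (\<rho> \<kappa> *\<^sub>v v)" if "\<kappa> permutes {1..n}" for \<kappa>
      using representation_props(2)[OF \<rho> \<open>\<tau> permutes {1..n}\<close> that] v
        representation_props(1)[OF \<rho> \<open>\<tau> permutes {1..n}\<close>] representation_props(1)[OF \<rho> that]
      by (simp add: assoc_mult_mat_vec[of _ d d _ d])
    then show ?thesis
      using inv that \<rho>v[OF _ v] unfolding invariant_inner_product_def by (simp add: sym_group_carrier)
  qed
  fix a :: "(nat \<Rightarrow> nat) \<Rightarrow> real"
  define w where "w = vec d (\<lambda>i. \<Sum>\<pi> | \<pi> permutes {1..n}. complex_of_real (a \<pi>) * (\<rho> \<pi> *\<^sub>v v) $ i)"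
  have w: "w \<in> carrier_vec d" by (simp add: w_def)
  have ipw: "ip w u = (\<Sum>\<pi> | \<pi> permutes {1..n}. complex_of_real (a \<pi>) * ip (\<rho> \<pi> *\<^sub>v v) u)" if "u \<in> carrier_vec d" for u
    unfolding w_def using that v \<rho>v by (intro inner_product_sum[OF ip fin]) auto
  have "ip w w = (\<Sum>\<pi> | \<pi> permutes {1..n}. complex_of_real (a \<pi>) * cnj (ip w (\<rho> \<pi> *\<^sub>v v)))"
    unfolding ipw[OF w] using conj[OF \<rho>v[OF _ v] w] by (auto intro!: sum.cong)
  also have "\<dots> = (\<Sum>\<pi> | \<pi> permutes {1..n}. \<Sum>\<sigma> | \<sigma> permutes {1..n}. complex_of_real (a \<pi>) * (complex_of_real (a \<sigma>) * cnj (ip (\<rho> \<sigma> *\<^sub>v v) (\<rho> \<pi> *\<^sub>v v))))"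
    using \<rho>v[OF _ v] by (auto simp: ipw sum_distrib_left intro!: sum.cong)
  finally have "Re (ip w w) = (\<Sum>\<pi> | \<pi> permutes {1..n}. \<Sum>\<sigma> | \<sigma> permutes {1..n}. a \<pi> * (a \<sigma> * Re (ip (\<rho> \<sigma> *\<^sub>v v) (\<rho> \<pi> *\<^sub>v v))))"
    by (simp add: Re_sum)
  also have "\<dots> = (\<Sum>\<pi> | \<pi> permutes {1..n}. \<Sum>\<sigma> | \<sigma> permutes {1..n}. a \<pi> * a \<sigma> * Re (ip (\<rho> \<pi> *\<^sub>v v) (\<rho> \<sigma> *\<^sub>v v)))"
    by (intro sum.cong refl) (simp add: mult.assoc resym)
  finally show "0 \<le> (\<Sum>\<pi> | \<pi> permutes {1..n}. \<Sum>\<sigma> | \<sigma> permutes {1..n}. a \<pi> * a \<sigma> * Re (ip (\<rho> \<pi> *\<^sub>v v) (\<rho> \<sigma> *\<^sub>v v)))"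
  proof (rule subst)
    show "0 \<le> Re (ip w w)"
    proof (cases "w = 0\<^sub>v d")
      case True
      then have "0 \<cdot>\<^sub>v w = w" by (intro eq_vecI) auto
      moreover have "ip (0 \<cdot>\<^sub>v w) w = 0 * ip w w"
        by (rule inner_product_onD(2)[OF ip w w])
      ultimately have "ip w w = 0" by simp
      then show ?thesis by simp
    next
      case False
      then show ?thesis
        using inner_product_onD(5)[OF ip w w] by (simp add: less_imp_le)
    qed
  qed
qed

lemma alpha_inv:
  assumes "bij \<sigma>"
  shows "alpha A (inv_into UNIV \<sigma>) = alpha A \<sigma>"
proof -
  have inv: "inv_into UNIV \<sigma> = \<pi> \<longleftrightarrow> \<sigma> = inv_into UNIV \<pi>" if "bij \<pi>" for \<pi>
    using inv_inv_eq[OF assms] inv_inv_eq[OF that] by auto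
  have id: "inv_into UNIV \<sigma> = id \<longleftrightarrow> \<sigma> = id"
    using inv[OF bij_id] by (simp only: inv_id)
  have "(\<Sum>\<pi> | \<pi> permutes A. group_elem id (inv_into UNIV \<sigma>) - group_elem \<pi> (inv_into UNIV \<sigma>))
    = (\<Sum>\<pi> | \<pi> permutes A. group_elem id \<sigma> - group_elem \<pi> \<sigma>)"
    by (rule sum.reindex_bij_witness[where i = "inv_into UNIV" and j = "inv_into UNIV"])
      (auto simp: permutes_inv permutes_inv_inv group_elem_def id inv permutes_bij)
  then show ?thesis by (simp add: alpha_def)
qed

section \<open>The operator inequality\<close>

theorem theorem1p8:
  fixes n t :: nat and A :: "nat \<Rightarrow> nat set" and c :: "nat \<Rightarrow> real"
  assumes "A 0 \<subseteq> {2..n}"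
    and "\<And>i. i \<in> {1..t} \<Longrightarrow> A 0 \<subseteq> A i"
    and "\<And>i. i \<in> {1..t} \<Longrightarrow> A i \<subseteq> {2..n}"
    and "\<And>i. i \<in> {1..t} \<Longrightarrow> card (A i - A 0) = 1"
    and "inj_on A {1..t}"
    and "\<And>i. i \<le> t \<Longrightarrow> c i \<ge> 0"
  shows "operator_ge n
    (\<lambda>\<sigma>. (\<Sum>i\<le>t. c i * real (card (A i))) *
          (\<Sum>j\<le>t. c j * (alpha (A j \<union> {1}) \<sigma> - alpha (A j) \<sigma>)))
    (\<lambda>\<sigma>. (\<Sum>i\<le>t. (c i)\<^sup>2 * alpha (A i) \<sigma>) +
          (\<Sum>j\<le>t. \<Sum>i<j. c i * c j * (alpha (A i \<union> A j) \<sigma> + alpha (A 0) \<sigma>)))"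
proof (unfold operator_ge_def, intro allI impI)
  fix d \<rho> ip
  assume \<rho>: "representation n d \<rho>" and inv: "invariant_inner_product n d \<rho> ip"
  define x where "x i = the_elem (A i - A 0)" for i
  have xA: "A i = insert (x i) (A 0)" "x i \<notin> A 0" if i: "i \<in> {1..t}" for i
  proof -
    obtain y where "A i - A 0 = {y}"
      using assms(4)[OF i] by (auto simp: card_1_singleton_iff)
    then show "A i = insert (x i) (A 0)" "x i \<notin> A 0"
      using assms(2)[OF i] by (auto simp: x_def)
  qed
  have x_inj: "inj_on x {1..t}"
    using assms(5) xA(1) by (metis inj_on_def)
  have A_sub: "A i \<subseteq> {2..n}" if "i \<le> t" for i
    using assms(1,3) that by (cases "i = 0") auto
  \<comment> \<open>The point \<open>1\<close> is adjoined so that it is available as the hub even for \<open>n = 0\<close>; the permutations are the same.\<close>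
  define \<Omega> where "\<Omega> = insert 1 {1..n}"
  have \<Omega>: "\<pi> permutes \<Omega> \<longleftrightarrow> \<pi> permutes {1..n}" for \<pi>
    by (cases "n = 0") (auto simp: \<Omega>_def insert_absorb)
  have split0: "(\<Sum>i\<le>t. F i) = F 0 + (\<Sum>i\<in>{1..t}. F i)" for F :: "nat \<Rightarrow> real"
  proof -
    have "{..t} = insert 0 {1..t}" by auto
    then show ?thesis by simp
  qed
  have un: "A i \<union> A j = insert (x i) (insert (x j) (A 0))" if "i \<in> {1..t}" "j \<in> {1..t}" for i j
    using xA(1)[OF that(1)] xA(1)[OF that(2)] by auto
  let ?z = "\<lambda>\<sigma>. (\<Sum>i\<le>t. c i * real (card (A i))) * (\<Sum>j\<le>t. c j * (alpha (A j \<union> {1}) \<sigma> - alpha (A j) \<sigma>))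
    - ((\<Sum>i\<le>t. (c i)\<^sup>2 * alpha (A i) \<sigma>) + (\<Sum>j\<le>t. \<Sum>i<j. c i * c j * (alpha (A i \<union> A j) \<sigma> + alpha (A 0) \<sigma>)))"
  show "psd_operator d ip (rep_operator n d \<rho> ?z)"
  proof (rule psd_rep_operatorI[OF \<rho> inv])
    fix \<pi> assume "\<pi> permutes {1..n}"
    then show "?z (inv_into UNIV \<pi>) = ?z \<pi>"
      by (simp add: alpha_inv permutes_bij)
  next
    fix v :: "complex vec" assume v: "v \<in> carrier_vec d"
    define form where "form = kernel_form \<Omega> (\<lambda>\<pi> \<sigma>. Re (ip (\<rho> \<pi> *\<^sub>v v) (\<rho> \<sigma> *\<^sub>v v)))"
    have fin\<Omega>: "finite \<Omega>" by (simp add: \<Omega>_def)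
    interpret perm_rep \<Omega> translate form
      unfolding form_def by (rule perm_rep_of_representation[OF \<rho> inv v \<Omega> fin\<Omega>])
    define f :: "(nat \<Rightarrow> nat) \<Rightarrow>\<^sub>0 real" where "f = Poly_Mapping.single id 1"
    define \<Phi> where "\<Phi> = wsum (\<lambda>\<pi>. form f (translate \<pi> f)) {\<pi>. \<pi> permutes \<Omega>}"
    define E where "E C = energy C f" for C
    have \<Phi>: "(\<Sum>\<pi> | \<pi> permutes {1..n}. z \<pi> * Re (ip v (\<rho> \<pi> *\<^sub>v v))) = \<Phi> z" for z
      using v by (auto simp: \<Phi>_def wsum_def \<Omega> form_def f_def kernel_form_translate[OF fin\<Omega>]
          representation_props(3)[OF \<rho>] mult.commute intro!: sum.cong)
    have \<Phi>_alpha: "\<Phi> (alpha C) = E C" if "C \<subseteq> \<Omega>" for C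
    proof -
      have "\<Phi> (alpha C) = (\<Sum>\<sigma> | \<sigma> permutes \<Omega>. alpha C \<sigma> * form f (translate \<sigma> f))"
        by (simp add: \<Phi>_def wsum_def mult.commute)
      also have "\<dots> = E C"
        unfolding alpha_def group_elem_def E_def by (rule sum_alpha_energy[OF that])
      finally show ?thesis .
    qed
    have sub: "A i \<subseteq> \<Omega>" "A i \<union> {1} \<subseteq> \<Omega>" if "i \<le> t" for i
      using A_sub[OF that] by (auto simp: \<Omega>_def)
    have \<Phi>z: "\<Phi> ?z = (\<Sum>i\<le>t. c i * real (card (A i))) * (\<Sum>j\<le>t. c j * (E (A j \<union> {1}) - E (A j)))
      - ((\<Sum>i\<le>t. (c i)\<^sup>2 * E (A i)) + (\<Sum>j\<le>t. \<Sum>i<j. c i * c j * (E (A i \<union> A j) + E (A 0))))"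
    proof -
      note lin = wsum_linear(1-3)[where w = "\<lambda>\<pi>. form f (translate \<pi> f)" and Y = "{\<pi>. \<pi> permutes \<Omega>}", folded \<Phi>_def]
        wsum_sum[where w = "\<lambda>\<pi>. form f (translate \<pi> f)" and Y = "{\<pi>. \<pi> permutes \<Omega>}", folded \<Phi>_def]
      have "\<Phi> ?z = (\<Sum>i\<le>t. c i * real (card (A i))) * (\<Sum>j\<le>t. c j * (\<Phi> (alpha (A j \<union> {1})) - \<Phi> (alpha (A j))))
      - ((\<Sum>i\<le>t. (c i)\<^sup>2 * \<Phi> (alpha (A i))) + (\<Sum>j\<le>t. \<Sum>i<j. c i * c j * (\<Phi> (alpha (A i \<union> A j)) + \<Phi> (alpha (A 0)))))"
        by (simp only: lin)
      also have "\<dots> = (\<Sum>i\<le>t. c i * real (card (A i))) * (\<Sum>j\<le>t. c j * (E (A j \<union> {1}) - E (A j)))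
      - ((\<Sum>i\<le>t. (c i)\<^sup>2 * E (A i)) + (\<Sum>j\<le>t. \<Sum>i<j. c i * c j * (E (A i \<union> A j) + E (A 0))))"
        using sub by (intro arg_cong2[where f = "(-)"] arg_cong2[where f = "(*)"] arg_cong2[where f = "(+)"] sum.cong refl)
          (auto simp: \<Phi>_alpha)
      finally show ?thesis .
    qed
    have pairs: "(\<Sum>j\<le>t. \<Sum>i<j. c i * c j * (E (A i \<union> A j) + E (A 0)))
      = (\<Sum>j\<in>{1..t}. c 0 * c j * (E (insert (x j) (A 0)) + E (A 0)))
        + (\<Sum>i\<in>{1..t}. \<Sum>j\<in>{1..t} - {i}. c i * c j * (E (insert (x i) (insert (x j) (A 0))) + E (A 0))) / 2"
    proof -
      have "A 0 \<union> A j = insert (x j) (A 0)" if "j \<in> {1..t}" for j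
        using xA(1)[OF that] by auto
      then show ?thesis
        by (subst sum_pairs_star) (auto simp: Un_commute un mult.commute intro!: sum.cong arg_cong2[where f = "(+)"])
    qed
    have card: "real (card (A i)) = real (card (A 0)) + 1" if "i \<in> {1..t}" for i
      using xA[OF that] finite_subset[OF assms(1)] by simp
    have squares: "(\<Sum>i\<in>{1..t}. (c i)\<^sup>2 * E (insert (x i) (A 0))) = (\<Sum>i\<in>{1..t}. (c i)\<^sup>2 * E (A i))"
      by (rule sum.cong[OF refl]) (simp add: xA(1)[symmetric])
    have xm: "x i \<in> {2..n}" if "i \<in> {1..t}" for i
      using xA(1)[OF that] assms(3)[OF that] by blast
    have "1 \<in> \<Omega>" "1 \<notin> A 0"
      using assms(1) by (auto simp: \<Omega>_def)
    moreover have "1 \<notin> x ` {1..t}"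
      using xm by fastforce
    moreover have "x ` {1..t} \<subseteq> \<Omega>"
      using xm by (fastforce simp: \<Omega>_def)
    moreover have "x ` {1..t} \<inter> A 0 = {}"
      using xA(2) by blast
    moreover have "A 0 \<subseteq> \<Omega>" "0 \<le> c 0" "\<And>i. i \<in> {1..t} \<Longrightarrow> 0 \<le> c i"
      using sub(1)[of 0] assms(6) by auto
    ultimately have "(c 0)\<^sup>2 * E (A 0) + (\<Sum>i\<in>{1..t}. (c i)\<^sup>2 * E (insert (x i) (A 0)))
      + (\<Sum>i\<in>{1..t}. c 0 * c i * (E (insert (x i) (A 0)) + E (A 0)))
      + (\<Sum>i\<in>{1..t}. \<Sum>j\<in>{1..t} - {i}. c i * c j * (E (insert (x i) (insert (x j) (A 0))) + E (A 0))) / 2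
    \<le> (c 0 * real (card (A 0)) + (\<Sum>i\<in>{1..t}. c i * (real (card (A 0)) + 1))) * (c 0 * (E (insert 1 (A 0)) - E (A 0))
        + (\<Sum>i\<in>{1..t}. c i * (E (insert 1 (insert (x i) (A 0))) - E (insert (x i) (A 0)))))"
      unfolding E_def by (intro energy_inequality_indexed x_inj)
    also have "\<dots> = (\<Sum>i\<le>t. c i * real (card (A i))) * (\<Sum>j\<le>t. c j * (E (A j \<union> {1}) - E (A j)))"
      unfolding split0 by (intro arg_cong2[where f = "(*)"] arg_cong2[where f = "(+)"] sum.cong refl) (simp_all add: card xA(1)[symmetric])
    finally have "0 \<le> \<Phi> ?z"
      unfolding \<Phi>z pairs split0[of "\<lambda>i. (c i)\<^sup>2 * E (A i)"] squares by linarith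
    then show "0 \<le> (\<Sum>\<pi> | \<pi> permutes {1..n}. ?z \<pi> * Re (ip v (\<rho> \<pi> *\<^sub>v v)))"
      by (simp only: \<Phi>)
  qed
qed

end
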